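(* Let $M$ be the closed simply connected 6-manifold (defined in the context; it is a Calabi–Yau 3-fold with zero Euler characteristic, carrying metrics with holonomy $SU(3)$) obtained by resolving the singularities of the torus orbifold $\mathbb T^6/\Gamma$. Then $M$ admits a polarized $\mathcal F$-structure in which all but one of the Galois coverings are trivial.
   Context: **$\mathcal F$-structures.** An $\mathcal F$-structure on a closed manifold $M$ is given by the following data and conditions: (1) a finite open cover $\{U_{1},\dots,U_{N}\}$ of $M$; (2) finite Galois coverings $\pi_{i}:\widetilde{U}_{i}\to U_{i}$ with group of deck transformations $\Gamma_{i}$, $1\leq i\leq N$; (3) a smooth action with finite kernel of the $k_{i}$-dimensional torus $T^{k_i}$ ($k_i\ge 1$), $\phi_{i}:T^{k_{i}}\to \mathrm{Diff}(\widetilde{U}_{i})$, $1\leq i\leq N$; (4) a homomorphism $\Psi_{i}:\Gamma_{i}\to \mathrm{Aut}(T^{k_{i}})$ such that $\gamma(\phi_{i}(t)(x))=\phi_{i}(\Psi_{i}(\gamma)(t))(\gamma x)$ for all $\gamma\in \Gamma_{i}$, $t\in T^{k_{i}}$, $x\in \widetilde{U}_{i}$; (5) for any finite sub-collection $\{U_{i_{1}},\dots,U_{i_{l}}\}$ such that $U_{i_{1}\dots i_{l}}:=U_{i_{1}}\cap\dots\cap U_{i_{l}}\neq\emptyset$, let $\widetilde{U}_{i_{1}\dots i_{l}}$ be the set of all $(x_{i_{1}},\dots,x_{i_{l}})\in \widetilde{U}_{i_{1}}\times\dots\times\widetilde{U}_{i_{l}}$ such that $\pi_{i_{1}}(x_{i_{1}})=\dots=\pi_{i_{l}}(x_{i_{l}})$;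 it covers $\pi_{i_{j}}^{-1}(U_{i_{1}\dots i_{l}})\subset \widetilde{U}_{i_{j}}$ for all $1\leq j\leq l$. It is required that each $\phi_{i_{j}}$ leaves $\pi_{i_{j}}^{-1}(U_{i_{1}\dots i_{l}})$ invariant and lifts to an action on $\widetilde{U}_{i_{1}\dots i_{l}}$, and that all the lifted actions commute. A Galois covering $\pi_i$ is trivial if it is one-sheeted. A subset $S\subset M$ is invariant if for any $y\in S\cap U_i$, any $x\in\widetilde U_i$ with $\pi_i(x)=y$ and any $t\in T^{k_i}$, we have $\pi_i(\phi_i(t)(x))\in S$. The orbit of a point of $M$ is the minimal invariant set containing it. The $\mathcal F$-structure is polarized if for any $I\subset\{1,\dots,N\}$, with $U=\bigcap_{i\in I}U_i$ (assumed non-empty) and $V=\bigcup_{i\in I^c}U_i$, the dimension of the orbits is constant in $U-V$. **The manifold $M$.** Let $\mathbb T^6=\mathbb R^6/\mathbb Z^6$ and consider the involutions $$\alpha(x)=(-x_{1},-x_{2},-x_{3},-x_{4},x_{5},x_{6}),\qquad \beta(x)=(\tfrac12-x_{1},-x_{2},x_{3},x_{4},-x_{5},-x_{6}).$$ They commute and generate a group $\Gamma\cong\mathbb Z_2^2$. The singular set of $\mathbb T^6/\Gamma$ consists of 16 disjoint copies of $\mathbb T^2$ (8 coming from the fixed points of $\alpha$ and 8 from those of $\beta$), each with a neighbourhood isometric to $\mathbb T^2\times B^4_\varepsilon/\{\pm1\}$ for small $\varepsilon$. Let $X$ be the Eguchi–Hanson space: the 4-manifold diffeomorphic to $T^*S^2$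 obtained as the blow-up $b:X\to\mathbb C^2/\{\pm1\}$ at the origin. The map $b$ is a diffeomorphism from the complement of the zero section onto $(\mathbb C^2\setminus0)/\{\pm1\}$, and $b^{-1}(B^4_\varepsilon/\{\pm1\})$ is diffeomorphic to $X$. The manifold $M$ is obtained from $\mathbb T^6/\Gamma$ by replacing each of the 16 neighbourhoods $\mathbb T^2\times B^4_\varepsilon/\{\pm1\}$ by $\mathbb T^2\times b^{-1}(B^4_\varepsilon/\{\pm1\})$ via $b$. Here the normal directions are identified (constantly along the tori) with $\mathbb C^2$ by the complex coordinates $(x_1+ix_2,x_3+ix_4)$ for $\alpha$ and $(x_1+ix_2,x_5+ix_6)$ for $\beta$, each centred at the fixed point in question. *)

theory Defs
  imports "HOL-Analysis.Analysis"
begin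

section \<open>Smooth manifolds\<close>

text \<open>
  \<open>Ck_on k S f\<close>: on the open set \<open>S\<close> all iterated directional derivatives of \<open>f\<close> of order at
  most \<open>k\<close> exist and are continuous.
\<close>

primrec Ck_on ::
  "nat \<Rightarrow> 'e::real_normed_vector set \<Rightarrow> ('e \<Rightarrow> 'f::real_normed_vector) \<Rightarrow> bool" where
  "Ck_on 0 S f \<longleftrightarrow> continuous_on S f"
| "Ck_on (Suc k) S f \<longleftrightarrow>
     (\<forall>x\<in>S. f differentiable (at x)) \<and>
     (\<forall>v. Ck_on k S (\<lambda>x. frechet_derivative f (at x) v))"

definition smooth_on ::
  "'e::real_normed_vector set \<Rightarrow> ('e \<Rightarrow> 'f::real_normed_vector) \<Rightarrow> bool" where
  "smooth_on S f \<longleftrightarrow> (\<forall>k. Ck_on k S f)"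

text \<open>
  A manifold is presented as in do Carmo's textbook, by a set of injective parametrizations
  \<open>(S, \<sigma>)\<close>, with \<open>S\<close> an open subset of the Euclidean model space and \<open>\<sigma>\<close> only relevant on \<open>S\<close>.
  The underlying set and the topology are determined by the parametrizations.
\<close>

type_synonym ('e, 'a) atlas = "('e set \<times> ('e \<Rightarrow> 'a)) set"

definition carrier_of :: "('e, 'a) atlas \<Rightarrow> 'a set" where
  "carrier_of A = (\<Union>(S, \<sigma>)\<in>A. \<sigma> ` S)"

definition atlas_topology :: "('e::topological_space, 'a) atlas \<Rightarrow> 'a topology" where
  "atlas_topology A =
     topology (\<lambda>W. W \<subseteq> carrier_of A \<and> (\<forall>(S, \<sigma>)\<in>A. open {x \<in> S. \<sigma> x \<in> W}))"

lemma openin_atlas_topology: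
  fixes A :: "('e::topological_space, 'a) atlas"
  shows "openin (atlas_topology A) W \<longleftrightarrow>
     W \<subseteq> carrier_of A \<and> (\<forall>(S, \<sigma>)\<in>A. open {x \<in> S. \<sigma> x \<in> W})"
proof -
  have "open {x \<in> S. \<sigma> x \<in> U \<inter> V}"
    if "open {x \<in> S. \<sigma> x \<in> U}" "open {x \<in> S. \<sigma> x \<in> V}"
    for S :: "'e set" and \<sigma> and U V :: "'a set"
    using open_Int[OF that] by (rule back_subst[where P = "open"]) auto
  moreover have "open {x \<in> S. \<sigma> x \<in> \<Union>K}" if "\<forall>U\<in>K. open {x \<in> S. \<sigma> x \<in> U}"
    for S :: "'e set" and \<sigma> and K :: "'a set set"
    using open_UN[OF that] by (rule back_subst[where P = "open"]) auto
  ultimately have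
    "istopology (\<lambda>W. W \<subseteq> carrier_of A \<and> (\<forall>(S, \<sigma>)\<in>A. open {x \<in> S. \<sigma> x \<in> W}))"
    unfolding istopology_def case_prod_beta by (intro conjI allI impI ballI Union_least) auto
  then show ?thesis
    by (simp add: atlas_topology_def topology_inverse')
qed

text \<open>Smooth maps between charted sets; openness of the domains below is continuity.\<close>

definition smooth_map ::
  "('e::euclidean_space, 'a) atlas \<Rightarrow> ('f::euclidean_space, 'b) atlas \<Rightarrow> ('a \<Rightarrow> 'b) \<Rightarrow> bool" where
  "smooth_map A B f \<longleftrightarrow>
     f ` carrier_of A \<subseteq> carrier_of B \<and>
     (\<forall>(S, \<sigma>)\<in>A. \<forall>(T, \<tau>)\<in>B.
        open {x \<in> S. f (\<sigma> x) \<in> \<tau> ` T} \<and>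
        smooth_on {x \<in> S. f (\<sigma> x) \<in> \<tau> ` T} (\<lambda>x. inv_into T \<tau> (f (\<sigma> x))))"

definition smooth_atlas :: "('e::euclidean_space, 'a) atlas \<Rightarrow> bool" where
  "smooth_atlas A \<longleftrightarrow>
     (\<forall>(S, \<sigma>)\<in>A. open S \<and> inj_on \<sigma> S) \<and> smooth_map A A (\<lambda>p. p)"

definition smooth_manifold :: "('e::euclidean_space, 'a) atlas \<Rightarrow> bool" where
  "smooth_manifold A \<longleftrightarrow>
     smooth_atlas A \<and> Hausdorff_space (atlas_topology A) \<and>
     second_countable (atlas_topology A)"

definition closed_manifold :: "('e::euclidean_space, 'a) atlas \<Rightarrow> bool" where
  "closed_manifold A \<longleftrightarrow> smooth_manifold A \<and> compact_space (atlas_topology A)"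

text \<open>The open submanifold with underlying set \<open>U\<close> (for \<open>U\<close> open).\<close>

definition restrict_atlas :: "('e, 'a) atlas \<Rightarrow> 'a set \<Rightarrow> ('e, 'a) atlas" where
  "restrict_atlas A U = (\<lambda>(S, \<sigma>). ({x \<in> S. \<sigma> x \<in> U}, \<sigma>)) ` A"

definition prod_atlas :: "('e, 'a) atlas \<Rightarrow> ('f, 'b) atlas \<Rightarrow> ('e \<times> 'f, 'a \<times> 'b) atlas" where
  "prod_atlas A B = (\<lambda>((S, \<sigma>), (T, \<tau>)). (S \<times> T, map_prod \<sigma> \<tau>)) ` (A \<times> B)"

definition diffeo ::
  "('e::euclidean_space, 'a) atlas \<Rightarrow> ('f::euclidean_space, 'b) atlas \<Rightarrow> ('a \<Rightarrow> 'b) \<Rightarrow> bool" where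
  "diffeo A B f \<longleftrightarrow>
     bij_betw f (carrier_of A) (carrier_of B) \<and> smooth_map A B f \<and>
     smooth_map B A (inv_into (carrier_of A) f)"

text \<open>
  \<open>P\<close> is an embedded \<open>d\<close>-dimensional submanifold: around each of its points there is a
  parametrization, compatible with the atlas, in which \<open>P\<close> is a \<open>d\<close>-dimensional linear slice.
\<close>

definition embedded_submanifold ::
  "('e::euclidean_space, 'a) atlas \<Rightarrow> nat \<Rightarrow> 'a set \<Rightarrow> bool" where
  "embedded_submanifold A d P \<longleftrightarrow>
     P \<subseteq> carrier_of A \<and>
     (\<forall>p\<in>P. \<exists>S \<sigma> L. \<sigma> ` S \<subseteq> carrier_of A \<and> smooth_atlas (insert (S, \<sigma>) A) \<and> p \<in> \<sigma> ` S \<and>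
        subspace L \<and> dim L = d \<and> {x \<in> S. \<sigma> x \<in> P} = S \<inter> L)"


section \<open>Finite Galois coverings\<close>

definition smooth_covering ::
  "('e::euclidean_space, 'b) atlas \<Rightarrow> ('f::euclidean_space, 'a) atlas \<Rightarrow> ('b \<Rightarrow> 'a) \<Rightarrow> bool" where
  "smooth_covering C B \<pi> \<longleftrightarrow>
     smooth_map C B \<pi> \<and> \<pi> ` carrier_of C = carrier_of B \<and>
     (\<forall>y\<in>carrier_of B. \<exists>V \<W>.
        openin (atlas_topology B) V \<and> y \<in> V \<and>
        \<Union>\<W> = {x \<in> carrier_of C. \<pi> x \<in> V} \<and> pairwise disjnt \<W> \<and>
        (\<forall>W\<in>\<W>. openin (atlas_topology C) W \<and>
                diffeo (restrict_atlas C W) (restrict_atlas B V) \<pi>))"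

text \<open>
  Deck transformations are extensional functions, so that they form a set of genuine maps of the
  carrier; their group law is \<open>compose (carrier_of C)\<close>.
\<close>

definition deck_group :: "('e::euclidean_space, 'b) atlas \<Rightarrow> ('b \<Rightarrow> 'a) \<Rightarrow> ('b \<Rightarrow> 'b) set" where
  "deck_group C \<pi> =
     {\<gamma> \<in> extensional (carrier_of C). diffeo C C \<gamma> \<and> (\<forall>x\<in>carrier_of C. \<pi> (\<gamma> x) = \<pi> x)}"

definition finite_galois_covering ::
  "('e::euclidean_space, 'b) atlas \<Rightarrow> ('f::euclidean_space, 'a) atlas \<Rightarrow> ('b \<Rightarrow> 'a) \<Rightarrow> bool" where
  "finite_galois_covering C B \<pi> \<longleftrightarrow>
     smooth_covering C B \<pi> \<and>
     (\<forall>y\<in>carrier_of B. finite {x \<in> carrier_of C. \<pi> x = y}) \<and>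
     (\<forall>x\<in>carrier_of C. \<forall>x'\<in>carrier_of C. \<pi> x = \<pi> x' \<longrightarrow> (\<exists>\<gamma>\<in>deck_group C \<pi>. \<gamma> x = x'))"


section \<open>Torus actions\<close>

text \<open>
  Circle factors are labelled by elements of a finite type \<open>'k\<close>. For \<open>J \<subseteq> UNIV\<close> the torus
  of dimension \<open>card J\<close> is realised as the group of tuples of unit complex numbers whose
  coordinates outside \<open>J\<close> are 1 (multiplication on \<open>complex ^ 'k\<close> is componentwise). Letting \<open>J\<close>
  vary gives tori of varying dimension within a single type.
\<close>

definition torus :: "'k::finite set \<Rightarrow> (complex ^ 'k) set" where
  "torus J = {t. (\<forall>j. cmod (t $ j) = 1) \<and> (\<forall>j. j \<notin> J \<longrightarrow> t $ j = 1)}"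

definition torus_exp :: "'k::finite set \<Rightarrow> real ^ 'k \<Rightarrow> complex ^ 'k" where
  "torus_exp J \<theta> = (\<chi> j. if j \<in> J then cis (2 * pi * \<theta> $ j) else 1)"

definition torus_action ::
  "'k::finite set \<Rightarrow> 'b set \<Rightarrow> (complex ^ 'k \<Rightarrow> 'b \<Rightarrow> 'b) \<Rightarrow> bool" where
  "torus_action J X \<phi> \<longleftrightarrow>
     (\<forall>t\<in>torus J. \<forall>x\<in>X. \<phi> t x \<in> X) \<and>
     (\<forall>x\<in>X. \<phi> 1 x = x) \<and>
     (\<forall>s\<in>torus J. \<forall>t\<in>torus J. \<forall>x\<in>X. \<phi> (s * t) x = \<phi> s (\<phi> t x))"

text \<open>
  Smoothness of \<open>(t, x) \<mapsto> \<phi> t x\<close> is expressed after composing with the surjective submersion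
  \<open>torus_exp J\<close> onto the torus.
\<close>

definition smooth_torus_action ::
  "'k::finite set \<Rightarrow> ('e::euclidean_space, 'b) atlas \<Rightarrow> (complex ^ 'k \<Rightarrow> 'b \<Rightarrow> 'b) \<Rightarrow> bool" where
  "smooth_torus_action J C \<phi> \<longleftrightarrow>
     torus_action J (carrier_of C) \<phi> \<and>
     smooth_map (prod_atlas {(UNIV :: (real ^ 'k) set, \<lambda>\<theta>. \<theta>)} C) C
       (\<lambda>(\<theta>, x). \<phi> (torus_exp J \<theta>) x)"

definition torus_aut :: "'k::finite set \<Rightarrow> (complex ^ 'k \<Rightarrow> complex ^ 'k) \<Rightarrow> bool" where
  "torus_aut J h \<longleftrightarrow>
     bij_betw h (torus J) (torus J) \<and> continuous_on (torus J) h \<and>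
     (\<forall>s\<in>torus J. \<forall>t\<in>torus J. h (s * t) = h s * h t)"


section \<open>F-structures\<close>

text \<open>
  The data, for \<open>i < fs_num\<close>: the open sets \<open>fs_open i\<close>, the covering manifolds \<open>fs_cover i\<close> with
  their projections \<open>fs_proj i\<close>, the tori \<open>torus (fs_dirs i)\<close> of dimension \<open>card (fs_dirs i)\<close>, their
  actions \<open>fs_act i\<close>, and the homomorphisms \<open>fs_aut i\<close> from the deck groups to the automorphism groups
  of the tori. \<open>'a\<close> and \<open>'b\<close> are the types of the points of the manifold and of the coverings,
  \<open>'e\<close> is the common model space, and \<open>CARD('k)\<close> bounds the dimensions of the tori.
\<close>

record ('a, 'b, 'e, 'k) f_structure =
  fs_num :: nat
  fs_open :: "nat \<Rightarrow> 'a set"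
  fs_cover :: "nat \<Rightarrow> ('e set \<times> ('e \<Rightarrow> 'b)) set"
  fs_proj :: "nat \<Rightarrow> 'b \<Rightarrow> 'a"
  fs_dirs :: "nat \<Rightarrow> 'k set"
  fs_act :: "nat \<Rightarrow> complex ^ 'k \<Rightarrow> 'b \<Rightarrow> 'b"
  fs_aut :: "nat \<Rightarrow> ('b \<Rightarrow> 'b) \<Rightarrow> complex ^ 'k \<Rightarrow> complex ^ 'k"

text \<open>The fibre product of the coverings indexed by \<open>I\<close>, over the intersection of the open sets.\<close>

definition fs_fibre_product ::
  "('a, 'b, 'e::euclidean_space, 'k::finite) f_structure \<Rightarrow> nat set \<Rightarrow> (nat \<Rightarrow> 'b) set" where
  "fs_fibre_product F I =
     {x \<in> (\<Pi>\<^sub>E i\<in>I. carrier_of (fs_cover F i)). \<forall>i\<in>I. \<forall>j\<in>I. fs_proj F i (x i) = fs_proj F j (x j)}"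

definition fs_fibre_topology ::
  "('a, 'b, 'e::euclidean_space, 'k::finite) f_structure \<Rightarrow> nat set \<Rightarrow> (nat \<Rightarrow> 'b) topology" where
  "fs_fibre_topology F I =
     subtopology (product_topology (\<lambda>i. atlas_topology (fs_cover F i)) I) (fs_fibre_product F I)"

text \<open>
  Compatibility of the actions over the sub-collection \<open>I\<close>: invariance of the preimages of the
  intersection, and existence of commuting lifts to the fibre product. The projection from the fibre product to the
  \<open>i\<close>-th covering is a local diffeomorphism, so a continuous lift \<open>\<psi> i\<close> of the smooth action
  \<open>fs_act F i\<close> is automatically smooth.
\<close>

definition fs_lifts_commute ::
  "('a, 'b, 'e::euclidean_space, 'k::finite) f_structure \<Rightarrow> nat set \<Rightarrow> bool" where
  "fs_lifts_commute F I \<longleftrightarrow>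
     (\<forall>i\<in>I. \<forall>t\<in>torus (fs_dirs F i). \<forall>x\<in>carrier_of (fs_cover F i).
        fs_proj F i x \<in> (\<Inter>j\<in>I. fs_open F j) \<longrightarrow>
        fs_proj F i (fs_act F i t x) \<in> (\<Inter>j\<in>I. fs_open F j)) \<and>
     (\<exists>\<psi>. (\<forall>i\<in>I.
             torus_action (fs_dirs F i) (fs_fibre_product F I) (\<psi> i) \<and>
             continuous_map
               (prod_topology (top_of_set (torus (fs_dirs F i))) (fs_fibre_topology F I))
               (fs_fibre_topology F I) (\<lambda>(t, x). \<psi> i t x) \<and>
             (\<forall>t\<in>torus (fs_dirs F i). \<forall>x\<in>fs_fibre_product F I.
                \<psi> i t x i = fs_act F i t (x i))) \<and>
          (\<forall>i\<in>I. \<forall>j\<in>I. \<forall>s\<in>torus (fs_dirs F i). \<forall>t\<in>torus (fs_dirs F j).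
             \<forall>x\<in>fs_fibre_product F I. \<psi> i s (\<psi> j t x) = \<psi> j t (\<psi> i s x)))"

definition is_f_structure ::
  "('e::euclidean_space, 'a) atlas \<Rightarrow> ('a, 'b, 'e, 'k::finite) f_structure \<Rightarrow> bool" where
  "is_f_structure A F \<longleftrightarrow>
     (\<forall>i<fs_num F. openin (atlas_topology A) (fs_open F i)) \<and>
     (\<Union>i<fs_num F. fs_open F i) = carrier_of A \<and>
     (\<forall>i<fs_num F.
        smooth_manifold (fs_cover F i) \<and>
        finite_galois_covering (fs_cover F i) (restrict_atlas A (fs_open F i)) (fs_proj F i) \<and>
        fs_dirs F i \<noteq> {} \<and>
        smooth_torus_action (fs_dirs F i) (fs_cover F i) (fs_act F i) \<and>
        finite {t \<in> torus (fs_dirs F i). \<forall>x\<in>carrier_of (fs_cover F i). fs_act F i t x = x} \<and>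
        (\<forall>\<gamma>\<in>deck_group (fs_cover F i) (fs_proj F i).
           torus_aut (fs_dirs F i) (fs_aut F i \<gamma>) \<and>
           (\<forall>\<delta>\<in>deck_group (fs_cover F i) (fs_proj F i). \<forall>t\<in>torus (fs_dirs F i).
              fs_aut F i (compose (carrier_of (fs_cover F i)) \<gamma> \<delta>) t =
              fs_aut F i \<gamma> (fs_aut F i \<delta> t)) \<and>
           (\<forall>t\<in>torus (fs_dirs F i). \<forall>x\<in>carrier_of (fs_cover F i).
              \<gamma> (fs_act F i t x) = fs_act F i (fs_aut F i \<gamma> t) (\<gamma> x)))) \<and>
     (\<forall>I. I \<noteq> {} \<and> I \<subseteq> {..<fs_num F} \<and> (\<Inter>i\<in>I. fs_open F i) \<noteq> {} \<longrightarrow> fs_lifts_commute F I)"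

definition trivial_covering ::
  "('a, 'b, 'e::euclidean_space, 'k::finite) f_structure \<Rightarrow> nat \<Rightarrow> bool" where
  "trivial_covering F i \<longleftrightarrow> inj_on (fs_proj F i) (carrier_of (fs_cover F i))"

definition fs_invariant ::
  "('a, 'b, 'e::euclidean_space, 'k::finite) f_structure \<Rightarrow> 'a set \<Rightarrow> bool" where
  "fs_invariant F S \<longleftrightarrow>
     (\<forall>i<fs_num F. \<forall>y\<in>S \<inter> fs_open F i. \<forall>x\<in>carrier_of (fs_cover F i). \<forall>t\<in>torus (fs_dirs F i).
        fs_proj F i x = y \<longrightarrow> fs_proj F i (fs_act F i t x) \<in> S)"

definition fs_orbit ::
  "('e::euclidean_space, 'a) atlas \<Rightarrow> ('a, 'b, 'e, 'k::finite) f_structure \<Rightarrow> 'a \<Rightarrow> 'a set" where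
  "fs_orbit A F p = \<Inter>{S. S \<subseteq> carrier_of A \<and> fs_invariant F S \<and> p \<in> S}"

definition polarized ::
  "('e::euclidean_space, 'a) atlas \<Rightarrow> ('a, 'b, 'e, 'k::finite) f_structure \<Rightarrow> bool" where
  "polarized A F \<longleftrightarrow>
     (\<forall>I. I \<noteq> {} \<and> I \<subseteq> {..<fs_num F} \<and> (\<Inter>i\<in>I. fs_open F i) \<noteq> {} \<longrightarrow>
        (\<exists>d. \<forall>p\<in>(\<Inter>i\<in>I. fs_open F i) - (\<Union>i\<in>{..<fs_num F} - I. fs_open F i).
           embedded_submanifold A d (fs_orbit A F p)))"


section \<open>The torus orbifold\<close>

text \<open>The class of \<open>x\<close> in \<open>\<real>\<^sup>6 / \<int>\<^sup>6\<close>, and the two involutions, given on representatives.\<close>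

definition T6 :: "real ^ 6 \<Rightarrow> (real ^ 6) set" where
  "T6 x = {y. \<forall>i. y $ i - x $ i \<in> \<int>}"

definition inv_alpha :: "real ^ 6 \<Rightarrow> real ^ 6" where
  "inv_alpha x = vector [- x$1, - x$2, - x$3, - x$4, x$5, x$6]"

definition inv_beta :: "real ^ 6 \<Rightarrow> real ^ 6" where
  "inv_beta x = vector [1/2 - x$1, - x$2, x$3, x$4, - x$5, - x$6]"

definition Gam :: "(real ^ 6 \<Rightarrow> real ^ 6) set" where
  "Gam = {id, inv_alpha, inv_beta, inv_alpha \<circ> inv_beta}"

text \<open>The point of \<open>\<real>\<^sup>6 / \<int>\<^sup>6\<close> modulo \<open>Gam\<close> determined by \<open>x\<close>, as an orbit of points of the torus.\<close>

definition orb :: "real ^ 6 \<Rightarrow> (real ^ 6) set set" where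
  "orb x = (\<lambda>g. T6 (g x)) ` Gam"

definition singular :: "real ^ 6 \<Rightarrow> bool" where
  "singular x \<longleftrightarrow> (\<exists>g\<in>Gam - {id}. T6 (g x) = T6 x)"

text \<open>
  One fixed point on a representative of each singular torus of the orbifold, with coordinates 0
  along the torus. Each singular torus has two preimages in \<open>\<real>\<^sup>6 / \<int>\<^sup>6\<close>: \<open>inv_beta\<close> exchanges the
  fixed tori of \<open>inv_alpha\<close> with \<open>x\<^sub>1 = 0\<close> and \<open>x\<^sub>1 = 1/2\<close>, and \<open>inv_alpha\<close> those of \<open>inv_beta\<close> with
  \<open>x\<^sub>1 = 1/4\<close> and \<open>x\<^sub>1 = 3/4\<close>.
\<close>

definition alpha_centres :: "(real ^ 6) set" where
  "alpha_centres = {p. p$1 = 0 \<and> {p$2, p$3, p$4} \<subseteq> {0, 1/2} \<and> p$5 = 0 \<and> p$6 = 0}"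

definition beta_centres :: "(real ^ 6) set" where
  "beta_centres = {p. p$1 = 1/4 \<and> {p$2, p$5, p$6} \<subseteq> {0, 1/2} \<and> p$3 = 0 \<and> p$4 = 0}"

text \<open>
  Coordinates around the fixed torus through \<open>p\<close>: \<open>(a, b)\<close> along the torus, and complex normal
  coordinates \<open>(z, w)\<close>.
\<close>

definition near_torus :: "real ^ 6 \<Rightarrow> real \<times> real \<Rightarrow> complex \<times> complex \<Rightarrow> real ^ 6" where
  "near_torus p = (\<lambda>(a, b) (z, w).
     p + (if p \<in> alpha_centres then vector [Re z, Im z, Re w, Im w, a, b]
          else vector [Re z, Im z, a, b, Re w, Im w]))"

definition T2 :: "real \<times> real \<Rightarrow> (real \<times> real) set" where
  "T2 = (\<lambda>(a, b). {(a', b'). a' - a \<in> \<int> \<and> b' - b \<in> \<int>})"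


section \<open>The Eguchi--Hanson space\<close>

text \<open>
  Points of \<open>\<complex>\<^sup>2 / {\<plusminus>1}\<close> are sets \<open>{v, -v}\<close>, and a point of the blow-up at the origin is such a
  set together with a complex line containing it; the blow-down map forgets the line.
\<close>

type_synonym eh_point = "(complex \<times> complex) set \<times> (complex \<times> complex) set"

definition pm :: "complex \<times> complex \<Rightarrow> (complex \<times> complex) set" where
  "pm v = {v, - v}"

definition cline :: "complex \<times> complex \<Rightarrow> (complex \<times> complex) set" where
  "cline v = range (\<lambda>c. (c * fst v, c * snd v))"

definition EH :: "eh_point set" where
  "EH = {(q, l). (\<exists>v. v \<noteq> 0 \<and> l = cline v) \<and> (\<exists>v\<in>l. q = pm v)}"

definition blow_down :: "eh_point \<Rightarrow> (complex \<times> complex) set" where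
  "blow_down = fst"

text \<open>
  The two standard parametrizations of the blow-up by \<open>(\<zeta>, u) \<in> \<complex>\<^sup>2\<close>: the line is spanned by \<open>(1, u)\<close>
  or \<open>(u, 1)\<close>, and \<open>\<zeta>\<close> is the square of the first or second coordinate of \<open>v\<close>. The choice of square
  root is irrelevant because of \<open>pm\<close>. On the overlap, \<open>(\<zeta>, u)\<close> corresponds to \<open>(\<zeta> u\<^sup>2, 1/u)\<close>.
\<close>

definition eh_chart0 :: "complex \<times> complex \<Rightarrow> eh_point" where
  "eh_chart0 = (\<lambda>(\<zeta>, u). (pm (csqrt \<zeta>, csqrt \<zeta> * u), cline (1, u)))"

definition eh_chart1 :: "complex \<times> complex \<Rightarrow> eh_point" where
  "eh_chart1 = (\<lambda>(\<zeta>, u). (pm (csqrt \<zeta> * u, csqrt \<zeta>), cline (u, 1)))"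


lemma EH_eq_charts: "EH = range eh_chart0 \<union> range eh_chart1"
proof (intro equalityI subsetI)
  fix x assume "x \<in> range eh_chart0 \<union> range eh_chart1"
  then obtain \<zeta> u where "x = eh_chart0 (\<zeta>, u) \<or> x = eh_chart1 (\<zeta>, u)"
    by auto
  moreover have "eh_chart0 (\<zeta>, u) \<in> EH"
    unfolding EH_def eh_chart0_def cline_def mem_Collect_eq prod.case
    by (intro conjI exI[of _ "(1, u)"] bexI[of _ "(csqrt \<zeta>, csqrt \<zeta> * u)"])
       (auto simp: zero_prod_def)
  moreover have "eh_chart1 (\<zeta>, u) \<in> EH"
    unfolding EH_def eh_chart1_def cline_def mem_Collect_eq prod.case
    by (intro conjI exI[of _ "(u, 1)"] bexI[of _ "(csqrt \<zeta> * u, csqrt \<zeta>)"])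
       (auto simp: zero_prod_def)
  ultimately show "x \<in> EH"
    by blast
next
  fix x assume "x \<in> EH"
  then obtain a b c where x: "x = (pm (c * a, c * b), cline (a, b))" and ab: "(a, b) \<noteq> 0"
    by (auto simp: EH_def cline_def)
  have sq: "csqrt (d\<^sup>2) = d \<or> csqrt (d\<^sup>2) = - d" for d
    by (metis power2_csqrt power2_eq_iff)
  have pm: "pm (csqrt (d\<^sup>2) * e, csqrt (d\<^sup>2) * f) = pm (d * e, d * f)" for d e f
    using sq[of d] by (auto simp: pm_def)
  have line: "cline (d * e, d * f) = cline (e, f)" if "d \<noteq> 0" for d e f
  proof -
    have "range (\<lambda>k. (k * (d * e), k * (d * f))) = (\<lambda>k. (k * e, k * f)) ` range (\<lambda>k. k * d)"
      by (simp add: image_image mult.assoc)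
    moreover have "range (\<lambda>k. k * d) = UNIV"
      using that by (intro surjI[of _ "\<lambda>k. k / d"]) simp
    ultimately show ?thesis
      by (simp add: cline_def)
  qed
  show "x \<in> range eh_chart0 \<union> range eh_chart1"
  proof (cases "a = 0")
    case False
    then have "x = eh_chart0 ((c * a)\<^sup>2, b / a)"
      using pm[of "c * a" 1 "b / a"] line[of a 1 "b / a"] by (simp add: x eh_chart0_def)
    then show ?thesis by blast
  next
    case True
    with ab have "b \<noteq> 0" by (simp add: zero_prod_def)
    then have "x = eh_chart1 ((c * b)\<^sup>2, a / b)"
      using pm[of "c * b" "a / b" 1] line[of b "a / b" 1] by (simp add: x eh_chart1_def)
    then show ?thesis by blast
  qed
qed


section \<open>The resolved manifold\<close>

text \<open>
  A point is either a regular point of the orbifold, or a point of one of the 16 exceptional sets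
  \<open>T\<^sup>2 \<times> (zero section)\<close>, labelled by the chosen centre \<open>p\<close>. This is a set of representatives for the
  gluing of the regular part of the orbifold with the 16 pieces \<open>T\<^sup>2 \<times> b\<^sup>-\<^sup>1(B\<^sub>\<epsilon> / {\<plusminus>1})\<close>: the blow-down
  map \<open>b\<close> is injective off the zero section, where points of the pieces are identified with regular
  points of the orbifold.
\<close>

datatype m_point =
    Regular "(real ^ 6) set set"
  | Exceptional "real ^ 6" "(real \<times> real) set" eh_point

definition glue :: "real ^ 6 \<Rightarrow> real \<times> real \<Rightarrow> eh_point \<Rightarrow> m_point" where
  "glue p ab x =
     (if blow_down x = {0} then Exceptional p (T2 ab) x
      else Regular (orb (near_torus p ab (SOME v. v \<in> blow_down x))))"

definition y_T2 :: "real ^ 6 \<Rightarrow> real \<times> real" where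
  "y_T2 y = (y$1, y$2)"

definition y_C2 :: "real ^ 6 \<Rightarrow> complex \<times> complex" where
  "y_C2 y = (Complex (y$3) (y$4), Complex (y$5) (y$6))"

definition regular_charts :: "(real ^ 6, m_point) atlas" where
  "regular_charts =
     {(S, \<lambda>x. Regular (orb x)) | S. open S \<and> (\<forall>x\<in>S. \<not> singular x) \<and> inj_on orb S}"

text \<open>Local parametrizations of \<open>T\<^sup>2 \<times> b\<^sup>-\<^sup>1(B\<^sub>\<epsilon> / {\<plusminus>1})\<close>, composed with the gluing map.\<close>

definition resolution_charts :: "real \<Rightarrow> (real ^ 6, m_point) atlas" where
  "resolution_charts \<epsilon> =
     {(S, \<lambda>y. glue p (y_T2 y) (c (y_C2 y))) | S p c.
        p \<in> alpha_centres \<union> beta_centres \<and> c \<in> {eh_chart0, eh_chart1} \<and>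
        open S \<and> inj_on (\<lambda>y. (T2 (y_T2 y), c (y_C2 y))) S \<and>
        (\<forall>y\<in>S. \<forall>v\<in>blow_down (c (y_C2 y)). norm v < \<epsilon>)}"

definition resolved_M :: "real \<Rightarrow> (real ^ 6, m_point) atlas" where
  "resolved_M \<epsilon> = regular_charts \<union> resolution_charts \<epsilon>"

end

(*
  Modulo the orbifold group and the integer lattice, the coordinate x_1 runs over the interval
  [0, 1/4], with the fixed tori of alpha over one end and those of beta over the other.  Away from
  the beta end the translations in x_5 and x_6 descend to the resolved manifold, and away from the
  alpha end so do those in x_3 and x_4: the group elements that reverse these directions are the
  ones that change the sign of cos (2 pi x_1), respectively of sin (2 pi x_1), so the translations
  only have to be multiplied by that sign.  On the exceptional sets they act on the torus factor.
  This gives two T^2-actions on two open sets covering M, which commute on the intersection.  The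
  orbits have dimension 2 over the ends of the interval and 4 over its interior.

  The charts of M are restrictions of local diffeomorphisms from open subsets of R^6.  The smooth
  structure, the actions and the slices along the orbits are all described in these maps.
*)
theory Submission
  imports Defs "HOL-Complex_Analysis.Cauchy_Integral_Formula"
begin

section \<open>Calculus of smooth maps\<close>

text \<open>Every element of the orbifold group lifts to an affine map of R^6 whose linear part is a
  diagonal matrix of signs and whose translation vector is half-integral. Each coordinate is
  therefore transformed separately, and discreteness of the half-integers in a single coordinate
  gives local injectivity of the quotient map, the Hausdorff property and the embeddedness of the
  orbits.

  The main obstacle is the comparison of the orbifold with the blow-up, whose chart coordinate is
  the square of a coordinate of C^2. A branch of the square root exists only locally and off the
  exceptional set; its sign ambiguity is absorbed by the involution that fixes the torus. At
  exceptional points only blow-up charts of the same torus have to be compared.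

  The bound 1/8 on \<open>eps\<close> is half the distance 1/4 between the values of x_1 at the
  fixed tori of the two kinds. It makes the 16 tubes disjoint and keeps 2 pi x_1 within pi/4 of its
  value at the core torus, so that the relevant cosine or sine stays positive on the tube and the
  sign-corrected translations are plain translations of the torus factor.\<close>

lemma Ck_on_subset: "Ck_on k S f \<Longrightarrow> T \<subseteq> S \<Longrightarrow> Ck_on k T f"
  by (induction k arbitrary: f) (auto intro: continuous_on_subset)

lemma frechet_derivative_cong_open:
  assumes "open S" "x \<in> S" "\<And>y. y \<in> S \<Longrightarrow> f y = g y"
  shows "frechet_derivative f (at x) = frechet_derivative g (at x)"
proof -
  have "(f has_derivative D) (at x) \<longleftrightarrow> (g has_derivative D) (at x)" for D
    using assms has_derivative_transform_within_open[of f D x UNIV S g]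
      has_derivative_transform_within_open[of g D x UNIV S f] by auto
  then show ?thesis
    by (simp add: frechet_derivative_def)
qed

lemma differentiable_cong_open:
  assumes "open S" "x \<in> S" "\<And>y. y \<in> S \<Longrightarrow> f y = g y" "f differentiable (at x)"
  shows "g differentiable (at x)"
  using assms has_derivative_transform_within_open[of f _ x UNIV S g]
  by (auto simp: differentiable_def)

lemma Ck_on_cong:
  assumes "open S" "\<And>y. y \<in> S \<Longrightarrow> f y = g y" "Ck_on k S f"
  shows "Ck_on k S g"
  using assms(2,3)
proof (induction k arbitrary: f g)
  case 0
  then show ?case by (simp cong: continuous_on_cong)
next
  case (Suc k)
  have "g differentiable (at x)" if "x \<in> S" for x
    using differentiable_cong_open[OF assms(1) that Suc.prems(1)] Suc.prems(2) that by auto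
  moreover have "Ck_on k S (\<lambda>x. frechet_derivative g (at x) v)" for v
  proof (rule Suc.IH)
    show "frechet_derivative f (at x) v = frechet_derivative g (at x) v" if "x \<in> S" for x
      using frechet_derivative_cong_open[OF assms(1) that Suc.prems(1)] by simp
    show "Ck_on k S (\<lambda>x. frechet_derivative f (at x) v)"
      using Suc.prems(2) by simp
  qed
  ultimately show ?case by auto
qed

lemma Ck_on_SucD: "Ck_on (Suc k) S f \<Longrightarrow> Ck_on k S f"
proof (induction k arbitrary: f)
  case 0
  then show ?case
    by (auto intro!: differentiable_imp_continuous_on differentiable_at_imp_differentiable_on)
next
  case (Suc k)
  then have "Ck_on k S (\<lambda>x. frechet_derivative f (at x) v)" for v
    by (metis Ck_on.simps(2))
  with Suc.prems show ?case by simp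
qed

text \<open>Uniqueness of the Frechet derivative lets any explicit formula for it replace the chosen
  \<open>frechet_derivative\<close> in the recursion. Sums, products, composites and holomorphic
  functions are all treated through this rule.\<close>

lemma Ck_on_SucI:
  assumes "open S"
    and "\<And>x. x \<in> S \<Longrightarrow> (f has_derivative f' x) (at x)"
    and "\<And>v. Ck_on k S (\<lambda>x. f' x v)"
  shows "Ck_on (Suc k) S f"
proof -
  have "frechet_derivative f (at x) = f' x" if "x \<in> S" for x
    using frechet_derivative_at assms(2)[OF that] by metis
  then have "Ck_on k S (\<lambda>x. frechet_derivative f (at x) v)" for v
    by (intro Ck_on_cong[OF assms(1) _ assms(3)[of v]]) simp
  with assms(2) show ?thesis
    by (auto simp: differentiable_def)
qed

lemma Ck_on_SucD1:
  "Ck_on (Suc k) S f \<Longrightarrow> x \<in> S \<Longrightarrow> (f has_derivative frechet_derivative f (at x)) (at x)"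
  by (simp add: frechet_derivative_works)

lemma Ck_on_SucD2: "Ck_on (Suc k) S f \<Longrightarrow> Ck_on k S (\<lambda>x. frechet_derivative f (at x) v)"
  by simp

text \<open>Derivatives at interior points are local, so no gluing is involved. Coordinate
  expressions of maps are only ever identified with smooth functions in this local way.\<close>

lemma Ck_on_local:
  assumes "\<And>x. x \<in> S \<Longrightarrow> \<exists>W. open W \<and> x \<in> W \<and> Ck_on k W f"
  shows "Ck_on k S f"
  using assms
proof (induction k arbitrary: f)
  case 0
  then show ?case
    by (metis Ck_on.simps(1) continuous_at_imp_continuous_on continuous_on_eq_continuous_at)
next
  case (Suc k)
  have "Ck_on k S (\<lambda>x. frechet_derivative f (at x) v)" for v
    using Suc.prems by (intro Suc.IH) (metis Ck_on.simps(2))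
  moreover have "f differentiable (at x)" if "x \<in> S" for x
    using Suc.prems[OF that] by auto
  ultimately show ?case by auto
qed

lemma Ck_on_const [simp]: "Ck_on k S (\<lambda>x. c)"
proof (induction k arbitrary: c)
  case (Suc k)
  then show ?case by (simp add: frechet_derivative_const)
qed simp

lemma Ck_on_bounded_linear:
  assumes "bounded_linear f"
  shows "Ck_on k S f"
proof (cases k)
  case 0
  then show ?thesis using assms linear_continuous_on by auto
next
  case (Suc j)
  have d: "(f has_derivative f) (at x)" for x
    by (rule bounded_linear_imp_has_derivative[OF assms])
  then have "frechet_derivative f (at x) = f" for x
    using frechet_derivative_at by metis
  with d Suc show ?thesis by (auto simp: differentiable_def)
qed

lemma Ck_on_add:
  assumes "open S" "Ck_on k S f" "Ck_on k S g"
  shows "Ck_on k S (\<lambda>x. f x + g x)"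
  using assms(2,3)
proof (induction k arbitrary: f g)
  case 0
  then show ?case by (auto intro: continuous_intros)
next
  case (Suc k)
  show ?case
  proof (rule Ck_on_SucI[OF assms(1)])
    show "((\<lambda>x. f x + g x) has_derivative
        (\<lambda>v. frechet_derivative f (at x) v + frechet_derivative g (at x) v)) (at x)" if "x \<in> S"
            for x
      using that Ck_on_SucD1[OF Suc.prems(1)] Ck_on_SucD1[OF Suc.prems(2)]
      by (intro has_derivative_add)
    show "Ck_on k S (\<lambda>x. frechet_derivative f (at x) v + frechet_derivative g (at x) v)" for v
      using Suc.prems by (intro Suc.IH Ck_on_SucD2)
  qed
qed

lemma Ck_on_sum:
  assumes "open S" "\<And>i. i \<in> A \<Longrightarrow> Ck_on k S (f i)"
  shows "Ck_on k S (\<lambda>x. \<Sum>i\<in>A. f i x)"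
  using assms(2) by (induction A rule: infinite_finite_induct) (auto intro: Ck_on_add[OF assms(1)])

text \<open>In the Leibniz rule each summand pairs a derivative with an undifferentiated factor. The
  latter is lowered by one order with \<open>Ck_on_SucD\<close>, after which the induction, with
  both functions arbitrary, applies.\<close>

lemma Ck_on_bilinear:
  assumes "open S" "bounded_bilinear p" "Ck_on k S f" "Ck_on k S g"
  shows "Ck_on k S (\<lambda>x. p (f x) (g x))"
  using assms(3,4)
proof (induction k arbitrary: f g)
  case 0
  then show ?case by (auto intro: bounded_bilinear.continuous_on[OF assms(2)])
next
  case (Suc k)
  show ?case
  proof (rule Ck_on_SucI[OF assms(1)])
    show "((\<lambda>x. p (f x) (g x)) has_derivative
        (\<lambda>v. p (f x) (frechet_derivative g (at x) v) + p (frechet_derivative f (at x) v) (g x)))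
            (at x)"
      if "x \<in> S" for x
      using that Ck_on_SucD1[OF Suc.prems(1)] Ck_on_SucD1[OF Suc.prems(2)]
      by (intro bounded_bilinear.FDERIV[OF assms(2)])
    show "Ck_on k S (\<lambda>x. p (f x) (frechet_derivative g (at x) v) + p (frechet_derivative f (at x)
        v) (g x))" for v
      using Suc.prems by (intro Suc.IH Ck_on_SucD2 Ck_on_add[OF assms(1)]) (auto intro: Ck_on_SucD)
  qed
qed

text \<open>The chain rule differentiates \<open>g\<close> in the direction of the derivative of
  \<open>f\<close>, which varies with the point, whereas the recursion knows only fixed directions.
  Expanding that direction in a basis gives products of scalar functions with derivatives of
  \<open>g\<close> in fixed directions composed with \<open>f\<close>, to which the induction
  applies.\<close>

lemma Ck_on_compose:
  fixes f :: "'a::real_normed_vector \<Rightarrow> 'b::euclidean_space"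
  assumes "open S" "open T" "f ` S \<subseteq> T" "Ck_on k S f" "Ck_on k T g"
  shows "Ck_on k S (\<lambda>x. g (f x))"
  using assms(4,5)
proof (induction k arbitrary: g)
  case 0
  then show ?case using assms(3) by (auto intro: continuous_on_compose2)
next
  case (Suc k)
  let ?f' = "\<lambda>x. frechet_derivative f (at x)" and ?g' = "\<lambda>x. frechet_derivative g (at x)"
  have f': "(f has_derivative ?f' x) (at x)" if "x \<in> S" for x
    using Ck_on_SucD1[OF Suc.prems(1) that] .
  have g': "(g has_derivative ?g' x) (at x)" if "x \<in> T" for x
    using Ck_on_SucD1[OF Suc.prems(2) that] .
  have "((\<lambda>x. g (f x)) has_derivative (\<lambda>v. \<Sum>b\<in>Basis. (?f' x v \<bullet> b) *\<^sub>R ?g' (f x) b)) (at x)"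
    if "x \<in> S" for x
  proof -
    have "f x \<in> T" using that assms(3) by auto
    then interpret linear "?g' (f x)"
      using g' has_derivative_linear by blast
    have "(\<Sum>b\<in>Basis. (?f' x v \<bullet> b) *\<^sub>R ?g' (f x) b) = ?g' (f x) (?f' x v)" for v
      by (subst (2) euclidean_representation[symmetric, of "?f' x v"]) (simp add: sum scale)
    then show ?thesis
      using has_derivative_compose[OF f'[OF that] g'[OF \<open>f x \<in> T\<close>]] by simp
  qed
  moreover have "Ck_on k S (\<lambda>x. \<Sum>b\<in>Basis. (?f' x v \<bullet> b) *\<^sub>R ?g' (f x) b)" for v
  proof (intro Ck_on_sum Ck_on_bilinear[OF _ bounded_bilinear_scaleR] assms(1))
    fix b :: 'b
    show "Ck_on k S (\<lambda>x. ?f' x v \<bullet> b)"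
      using Suc.prems(1) assms(1)
      by (intro Ck_on_bilinear[OF _ bounded_bilinear_inner]) (auto intro: Ck_on_SucD2)
    show "Ck_on k S (\<lambda>x. ?g' (f x) b)"
      using Suc.prems by (intro Suc.IH Ck_on_SucD[OF Suc.prems(1)]) auto
  qed
  ultimately show ?case
    by (rule Ck_on_SucI[OF assms(1)])
qed

text \<open>The real derivative is multiplication by the complex derivative, which is again
  holomorphic. This supplies the smoothness of inverses and of branches of the square root.\<close>

lemma Ck_on_holomorphic:
  assumes "open S" "f holomorphic_on S"
  shows "Ck_on k S f"
  using assms(2)
proof (induction k arbitrary: f)
  case 0
  then show ?case by (simp add: holomorphic_on_imp_continuous_on)
next
  case (Suc k)
  have "(f has_derivative (\<lambda>v. deriv f x * v)) (at x)" if "x \<in> S" for x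
    using holomorphic_derivI[OF Suc.prems assms(1) that] by (simp add: has_field_derivative_def)
  moreover have "Ck_on k S (\<lambda>x. deriv f x * v)" for v
    using Suc.prems assms(1) by (intro Suc.IH holomorphic_intros holomorphic_deriv)
  ultimately show ?case
    by (rule Ck_on_SucI[OF assms(1)])
qed

section \<open>Closure properties of smooth functions\<close>

lemma smooth_on_subset: "smooth_on S f \<Longrightarrow> T \<subseteq> S \<Longrightarrow> smooth_on T f"
  by (auto simp: smooth_on_def intro: Ck_on_subset)

lemma smooth_on_cong:
  assumes "open S" "\<And>y. y \<in> S \<Longrightarrow> f y = g y" "smooth_on S f"
  shows "smooth_on S g"
  using Ck_on_cong[OF assms(1,2)] assms(3) by (auto simp: smooth_on_def)

lemma smooth_on_local:
  assumes "\<And>x. x \<in> S \<Longrightarrow> \<exists>W. open W \<and> x \<in> W \<and> smooth_on W f"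
  shows "smooth_on S f"
  using assms unfolding smooth_on_def by (meson Ck_on_local)

lemma smooth_on_continuous: "smooth_on S f \<Longrightarrow> continuous_on S f"
  using Ck_on.simps(1) smooth_on_def by blast

lemma smooth_on_const [simp]: "smooth_on S (\<lambda>x. c)"
  by (simp add: smooth_on_def)

lemma smooth_on_bounded_linear: "bounded_linear f \<Longrightarrow> smooth_on S f"
  by (simp add: smooth_on_def Ck_on_bounded_linear)

lemma smooth_on_id [simp]: "smooth_on S (\<lambda>x. x)"
  by (intro smooth_on_bounded_linear bounded_linear_ident)

lemma smooth_on_add:
  "open S \<Longrightarrow> smooth_on S f \<Longrightarrow> smooth_on S g \<Longrightarrow> smooth_on S (\<lambda>x. f x + g x)"
  by (simp add: smooth_on_def Ck_on_add)

lemma smooth_on_sum: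
  "open S \<Longrightarrow> (\<And>i. i \<in> A \<Longrightarrow> smooth_on S (f i)) \<Longrightarrow> smooth_on S (\<lambda>x. \<Sum>i\<in>A. f i x)"
  by (simp add: smooth_on_def Ck_on_sum)

lemma smooth_on_bilinear:
  "open S \<Longrightarrow> bounded_bilinear p \<Longrightarrow> smooth_on S f \<Longrightarrow> smooth_on S g \<Longrightarrow>
     smooth_on S (\<lambda>x. p (f x) (g x))"
  by (simp add: smooth_on_def Ck_on_bilinear)

lemmas smooth_on_scaleR = smooth_on_bilinear[OF _ bounded_bilinear_scaleR]
lemmas smooth_on_mult = smooth_on_bilinear[OF _ bounded_bilinear_mult]

lemma smooth_on_compose:
  fixes f :: "'a::real_normed_vector \<Rightarrow> 'b::euclidean_space"
  assumes "open S" "open T" "f ` S \<subseteq> T" "smooth_on S f" "smooth_on T g"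
  shows "smooth_on S (\<lambda>x. g (f x))"
  using assms Ck_on_compose[OF assms(1-3)] unfolding smooth_on_def by blast

lemma smooth_on_linear_compose:
  fixes f :: "'a::real_normed_vector \<Rightarrow> 'b::euclidean_space"
  assumes "open S" "bounded_linear l" "smooth_on S f"
  shows "smooth_on S (\<lambda>x. l (f x))"
  by (rule smooth_on_compose[OF assms(1) open_UNIV subset_UNIV assms(3)
        smooth_on_bounded_linear[OF assms(2)]])

lemma smooth_on_holomorphic_compose:
  assumes "open S" "open T" "f ` S \<subseteq> T" "smooth_on S f" "g holomorphic_on T"
  shows "smooth_on S (\<lambda>x. g (f x))"
proof -
  have "smooth_on T g"
    using Ck_on_holomorphic[OF assms(2,5)] by (simp add: smooth_on_def)
  then show ?thesis
    by (rule smooth_on_compose[OF assms(1-4)])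
qed

lemma smooth_on_vec:
  fixes f :: "'a::real_normed_vector \<Rightarrow> real ^ 'n"
  assumes "open S" "\<And>i. smooth_on S (\<lambda>x. f x $ i)"
  shows "smooth_on S f"
proof -
  have "smooth_on S (\<lambda>x. \<Sum>i\<in>UNIV. (f x $ i) *\<^sub>R axis i 1)"
    by (intro smooth_on_sum smooth_on_scaleR assms smooth_on_const)
  then show ?thesis
    by (rule smooth_on_cong[OF assms(1), rotated]) (simp add: vec_eq_iff axis_def if_distrib cong:
        if_cong)
qed

lemma smooth_on_Complex:
  assumes "open S" "smooth_on S f" "smooth_on S g"
  shows "smooth_on S (\<lambda>x. Complex (f x) (g x))"
proof -
  have "smooth_on S (\<lambda>x. f x *\<^sub>R 1 + g x *\<^sub>R \<i>)"
    by (intro smooth_on_add smooth_on_scaleR assms smooth_on_const)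
  then show ?thesis
    by (rule smooth_on_cong[OF assms(1), rotated]) (simp add: complex_eq_iff)
qed

section \<open>Atlases generated by local diffeomorphisms\<close>

text \<open>
  Both kinds of parametrizations of the resolved manifold are restrictions of a few maps, defined on
  open subsets of the model space, that are only locally injective.  It is enough to study
  transitions between these maps.
\<close>

definition etale_atlas ::
  "'i set \<Rightarrow> ('i \<Rightarrow> 'e::euclidean_space set) \<Rightarrow> ('i \<Rightarrow> 'e \<Rightarrow> 'a) \<Rightarrow> ('e, 'a) atlas" where
  "etale_atlas I D \<rho> = {(S, \<rho> i) | S i. i \<in> I \<and> open S \<and> S \<subseteq> D i \<and> inj_on (\<rho> i) S}"

text \<open>Smoothness near a point is witnessed by one lift through one parametrization of the
  target, both freely chosen; \<open>smooth_near_lift\<close> converts it into a lift through any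
  prescribed parametrization and preimage.\<close>

definition smooth_near ::
  "'i set \<Rightarrow> ('i \<Rightarrow> 'e::euclidean_space set) \<Rightarrow> ('i \<Rightarrow> 'e \<Rightarrow> 'a) \<Rightarrow> ('f::euclidean_space \<Rightarrow> 'a) \<Rightarrow> 'f \<Rightarrow>
      bool"
  where
  "smooth_near I D \<rho> g x \<longleftrightarrow>
     (\<exists>W h j. open W \<and> x \<in> W \<and> j \<in> I \<and> smooth_on W h \<and> h ` W \<subseteq> D j \<and> (\<forall>w\<in>W. g w = \<rho> j (h w)))"

lemma smooth_nearI:
  assumes "open W" "x \<in> W" "j \<in> I" "smooth_on W h" "\<And>w. w \<in> W \<Longrightarrow> h w \<in> D j"
    "\<And>w. w \<in> W \<Longrightarrow> g w = \<rho> j (h w)"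
  shows "smooth_near I D \<rho> g x"
  unfolding smooth_near_def using assms by blast

lemma smooth_near_compose:
  assumes "smooth_near I D \<rho> g (k x)" "open V" "x \<in> V" "smooth_on V k"
  shows "smooth_near I D \<rho> (\<lambda>w. g (k w)) x"
proof -
  obtain W h j where W: "open W" "k x \<in> W" "j \<in> I" "smooth_on W h" "h ` W \<subseteq> D j" "\<forall>w\<in>W. g w = \<rho> j
      (h w)"
    using assms(1) by (auto simp: smooth_near_def)
  have V': "open (V \<inter> k -` W)"
    using assms(2,4) W(1) by (auto intro: continuous_open_preimage smooth_on_continuous)
  have sm: "smooth_on (V \<inter> k -` W) k"
    using assms(4) by (rule smooth_on_subset) auto
  have "smooth_on (V \<inter> k -` W) (\<lambda>w. h (k w))"
    using W by (intro smooth_on_compose[OF V' W(1) _ sm W(4)]) auto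
  with V' W assms(3) show ?thesis
    by (intro smooth_nearI[OF V' _ W(3)]) auto
qed

lemma smooth_near_cong:
  assumes "smooth_near I D \<rho> g x" "open V" "x \<in> V" "\<And>w. w \<in> V \<Longrightarrow> g' w = g w"
  shows "smooth_near I D \<rho> g' x"
proof -
  obtain W h j where W: "open W" "x \<in> W" "j \<in> I" "smooth_on W h" "h ` W \<subseteq> D j" "\<forall>w\<in>W. g w = \<rho> j (h
      w)"
    using assms(1) by (auto simp: smooth_near_def)
  have "smooth_on (V \<inter> W) h"
    using W(4) by (rule smooth_on_subset) auto
  with W assms(2-4) show ?thesis
    by (intro smooth_nearI[of "V \<inter> W"]) auto
qed

lemma smooth_near_restrict:
  assumes "smooth_near I D \<rho> g x" "open V" "x \<in> V" "\<And>w. w \<in> V \<Longrightarrow> g w \<in> U"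
  shows "smooth_near I (\<lambda>i. {x \<in> D i. \<rho> i x \<in> U}) \<rho> g x"
proof -
  obtain W h j where W: "open W" "x \<in> W" "j \<in> I" "smooth_on W h" "h ` W \<subseteq> D j" "\<forall>w\<in>W. g w = \<rho> j (h
      w)"
    using assms(1) by (auto simp: smooth_near_def)
  have "smooth_on (V \<inter> W) h"
    using W(4) by (rule smooth_on_subset) auto
  moreover have "\<rho> j (h w) \<in> U" if "w \<in> V" "w \<in> W" for w
    using W(6) assms(4) that by metis
  ultimately show ?thesis
    using W assms(2,3) by (intro smooth_nearI[of "V \<inter> W"]) auto
qed

lemma smooth_atlas_subset: "smooth_atlas A \<Longrightarrow> B \<subseteq> A \<Longrightarrow> smooth_atlas B"
  unfolding smooth_atlas_def smooth_map_def by blast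

lemma topspace_atlas_topology:
  assumes "\<And>S \<sigma>. (S, \<sigma>) \<in> A \<Longrightarrow> open S"
  shows "topspace (atlas_topology A) = carrier_of A"
proof -
  have "{x \<in> S. \<sigma> x \<in> carrier_of A} = S" if "(S, \<sigma>) \<in> A" for S \<sigma>
    using that by (auto simp: carrier_of_def)
  then have "openin (atlas_topology A) (carrier_of A)"
    unfolding openin_atlas_topology using assms by auto
  then show ?thesis
    by (metis openin_atlas_topology openin_subset openin_topspace subset_antisym)
qed

lemma smooth_mapD:
  assumes "smooth_map A B f" "(S, \<sigma>) \<in> A" "(T, \<tau>) \<in> B"
  shows "open {x \<in> S. f (\<sigma> x) \<in> \<tau> ` T}"
    and "smooth_on {x \<in> S. f (\<sigma> x) \<in> \<tau> ` T} (\<lambda>x. inv_into T \<tau> (f (\<sigma> x)))"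
  using assms unfolding smooth_map_def by fast+

lemma smooth_map_cong:
  assumes f: "smooth_map A B f" and g: "\<And>p. p \<in> carrier_of A \<Longrightarrow> f p = g p"
  shows "smooth_map A B g"
proof -
  have "f ` carrier_of A \<subseteq> carrier_of B" using f by (simp add: smooth_map_def)
  then have "g ` carrier_of A \<subseteq> carrier_of B"
    using g by (simp cong: image_cong)
  moreover have "open {x \<in> S. g (\<sigma> x) \<in> \<tau> ` T} \<and>
      smooth_on {x \<in> S. g (\<sigma> x) \<in> \<tau> ` T} (\<lambda>x. inv_into T \<tau> (g (\<sigma> x)))"
    if S: "(S, \<sigma>) \<in> A" and T: "(T, \<tau>) \<in> B" for S \<sigma> T \<tau>
  proof -
    have eq: "f (\<sigma> x) = g (\<sigma> x)" if "x \<in> S" for x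
      using S that by (intro g) (auto simp: carrier_of_def)
    then have "{x \<in> S. g (\<sigma> x) \<in> \<tau> ` T} = {x \<in> S. f (\<sigma> x) \<in> \<tau> ` T}" by auto
    moreover have "smooth_on {x \<in> S. f (\<sigma> x) \<in> \<tau> ` T} (\<lambda>x. inv_into T \<tau> (g (\<sigma> x)))"
      by (rule smooth_on_cong[OF smooth_mapD(1)[OF f S T] _ smooth_mapD(2)[OF f S T]]) (simp add:
          eq)
    ultimately show ?thesis using smooth_mapD(1)[OF f S T] by simp
  qed
  ultimately show ?thesis
    unfolding smooth_map_def by blast
qed

text \<open>In a chart of the source, the preimage of an open set is the union, over all charts of
  the target, of its preimages under the coordinate expressions, which are continuous on open
  sets.\<close>

lemma smooth_map_imp_continuous_map:
  assumes A: "\<And>S \<sigma>. (S, \<sigma>) \<in> A \<Longrightarrow> open S" and B: "\<And>S \<sigma>. (S, \<sigma>) \<in> B \<Longrightarrow> open S"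
    and f: "smooth_map A B f"
  shows "continuous_map (atlas_topology A) (atlas_topology B) f"
proof -
  have topA: "topspace (atlas_topology A) = carrier_of A"
    by (rule topspace_atlas_topology) (rule A)
  have topB: "topspace (atlas_topology B) = carrier_of B"
    by (rule topspace_atlas_topology) (rule B)
  have maps: "f \<in> carrier_of A \<rightarrow> carrier_of B"
    using f by (auto simp: smooth_map_def)
  have "openin (atlas_topology A) {x \<in> carrier_of A. f x \<in> W}" if W: "openin (atlas_topology B) W"
      for W
  proof -
  have "open {x \<in> S. \<sigma> x \<in> {x \<in> carrier_of A. f x \<in> W}}" if S: "(S, \<sigma>) \<in> A" for S \<sigma>
  proof -
    let ?S = "\<lambda>T \<tau>. {x \<in> S. f (\<sigma> x) \<in> \<tau> ` T}"
    have "open (?S T \<tau> \<inter> (\<lambda>x. inv_into T \<tau> (f (\<sigma> x))) -` {t \<in> T. \<tau> t \<in> W})" if "(T, \<tau>) \<in> B" for T \<tau>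
    proof (rule continuous_open_preimage)
      show "continuous_on (?S T \<tau>) (\<lambda>x. inv_into T \<tau> (f (\<sigma> x)))" "open (?S T \<tau>)"
        using smooth_mapD[OF f S that] by (auto intro: smooth_on_continuous)
      show "open {t \<in> T. \<tau> t \<in> W}"
        using W that by (auto simp: openin_atlas_topology)
    qed
    then have "open (\<Union>(T, \<tau>)\<in>B. ?S T \<tau> \<inter> (\<lambda>x. inv_into T \<tau> (f (\<sigma> x))) -` {t \<in> T. \<tau> t \<in> W})"
      by auto
    also have "(\<Union>(T, \<tau>)\<in>B. ?S T \<tau> \<inter> (\<lambda>x. inv_into T \<tau> (f (\<sigma> x))) -` {t \<in> T. \<tau> t \<in> W})
        = {x \<in> S. \<sigma> x \<in> {x \<in> carrier_of A. f x \<in> W}}" (is "?L = ?R")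
    proof
      show "?L \<subseteq> ?R"
        using S by (auto simp: carrier_of_def f_inv_into_f)
      show "?R \<subseteq> ?L"
      proof
        fix x assume x: "x \<in> ?R"
        then have "f (\<sigma> x) \<in> carrier_of B" using maps by auto
        then obtain T \<tau> where "(T, \<tau>) \<in> B" "f (\<sigma> x) \<in> \<tau> ` T"
          by (auto simp: carrier_of_def)
        with x show "x \<in> ?L"
          by (auto intro!: bexI[of _ "(T, \<tau>)"] simp: f_inv_into_f inv_into_into)
      qed
    qed
    finally show ?thesis .
  qed
  then show ?thesis
    by (auto simp: openin_atlas_topology)
  qed
  with maps show ?thesis
    by (simp add: continuous_map_def topA topB)
qed

text \<open>The disjoint union of the domains \<open>D i\<close> carries the relation of having the
  same image, and \<open>transition\<close> makes this relation etale. The map \<open>h\<close> is a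
  local diffeomorphism: its local inverse is the map obtained with the roles of the two points
  exchanged, by local injectivity.\<close>

locale etale =
  fixes I :: "'i set" and D :: "'i \<Rightarrow> 'e::euclidean_space set" and \<rho> :: "'i \<Rightarrow> 'e \<Rightarrow> 'a"
  assumes open_dom: "i \<in> I \<Longrightarrow> open (D i)"
    and loc_inj: "i \<in> I \<Longrightarrow> x \<in> D i \<Longrightarrow> \<exists>S. open S \<and> x \<in> S \<and> S \<subseteq> D i \<and> inj_on (\<rho> i) S"
    and transition: "i \<in> I \<Longrightarrow> j \<in> I \<Longrightarrow> x \<in> D i \<Longrightarrow> y \<in> D j \<Longrightarrow> \<rho> i x = \<rho> j y \<Longrightarrow>
      \<exists>W h. open W \<and> x \<in> W \<and> W \<subseteq> D i \<and> smooth_on W h \<and> h x = y \<and> h ` W \<subseteq> D j \<and>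
            (\<forall>w\<in>W. \<rho> j (h w) = \<rho> i w)"
begin

abbreviation "A \<equiv> etale_atlas I D \<rho>"

lemma chart_open: "(S, \<sigma>) \<in> A \<Longrightarrow> open S"
  by (auto simp: etale_atlas_def)

lemma carrier: "carrier_of A = (\<Union>i\<in>I. \<rho> i ` D i)"
proof
  show "carrier_of A \<subseteq> (\<Union>i\<in>I. \<rho> i ` D i)"
    by (fastforce simp: carrier_of_def etale_atlas_def)
  show "(\<Union>i\<in>I. \<rho> i ` D i) \<subseteq> carrier_of A"
  proof clarify
    fix i x assume ix: "i \<in> I" "x \<in> D i"
    then obtain S where "open S" "x \<in> S" "S \<subseteq> D i" "inj_on (\<rho> i) S" using loc_inj by blast
    with ix have "(S, \<rho> i) \<in> A" by (auto simp: etale_atlas_def)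
    with \<open>x \<in> S\<close> show "\<rho> i x \<in> carrier_of A" by (auto simp: carrier_of_def)
  qed
qed

lemma topspace: "topspace (atlas_topology A) = carrier_of A"
  by (rule topspace_atlas_topology[OF chart_open])

lemma openin_iff:
  "openin (atlas_topology A) W \<longleftrightarrow> W \<subseteq> carrier_of A \<and> (\<forall>i\<in>I. open {x \<in> D i. \<rho> i x \<in> W})"
proof -
  have "open {x \<in> D i. \<rho> i x \<in> W}" if *: "\<forall>(S, \<sigma>)\<in>A. open {x \<in> S. \<sigma> x \<in> W}" and i: "i \<in> I" for i
  proof (subst open_subopen, clarify)
    fix x assume x: "x \<in> D i" "\<rho> i x \<in> W"
    then obtain S where S: "open S" "x \<in> S" "S \<subseteq> D i" "inj_on (\<rho> i) S" using loc_inj i by blast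
    with i have "(S, \<rho> i) \<in> A" by (auto simp: etale_atlas_def)
    with * have "open {x \<in> S. \<rho> i x \<in> W}" by auto
    with S x show "\<exists>T. open T \<and> x \<in> T \<and> T \<subseteq> {x \<in> D i. \<rho> i x \<in> W}"
      by (intro exI[of _ "{x \<in> S. \<rho> i x \<in> W}"]) auto
  qed
  moreover have "open {x \<in> S. \<sigma> x \<in> W}"
    if *: "\<forall>i\<in>I. open {x \<in> D i. \<rho> i x \<in> W}" and S: "(S, \<sigma>) \<in> A" for S \<sigma>
  proof -
    obtain i where i: "i \<in> I" "open S" "S \<subseteq> D i" "\<sigma> = \<rho> i"
      using S by (auto simp: etale_atlas_def)
    have "open (S \<inter> {x \<in> D i. \<rho> i x \<in> W})"
      using * i by (intro open_Int) auto
    also have "S \<inter> {x \<in> D i. \<rho> i x \<in> W} = {x \<in> S. \<sigma> x \<in> W}"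
      using i by auto
    finally show ?thesis .
  qed
  ultimately show ?thesis
    unfolding openin_atlas_topology by blast
qed

text \<open>Around any other preimage of an image point, a transition map pulls \<open>S\<close>
  back to an open set.\<close>

lemma open_image:
  assumes i: "i \<in> I" and S: "open S" "S \<subseteq> D i"
  shows "openin (atlas_topology A) (\<rho> i ` S)"
  unfolding openin_iff
proof (intro conjI ballI)
  show "\<rho> i ` S \<subseteq> carrier_of A" using i S by (auto simp: carrier)
  fix j assume j: "j \<in> I"
  show "open {y \<in> D j. \<rho> j y \<in> \<rho> i ` S}"
  proof (subst open_subopen, clarify)
    fix y x assume y: "y \<in> D j" "\<rho> j y = \<rho> i x" "x \<in> S"
    then obtain W h where W: "open W" "y \<in> W" "W \<subseteq> D j" "smooth_on W h" "h y = x" "h ` W \<subseteq> D i"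
        "\<forall>w\<in>W. \<rho> i (h w) = \<rho> j w"
      using transition[OF j i, of y x] S by auto
    have "open (W \<inter> h -` S)"
      using W S by (auto intro: continuous_open_preimage smooth_on_continuous)
    moreover have "\<rho> j w \<in> \<rho> i ` S" if "w \<in> W" "h w \<in> S" for w
      using W(7) that by (metis image_eqI)
    ultimately show "\<exists>T. open T \<and> y \<in> T \<and> T \<subseteq> {y \<in> D j. \<rho> j y \<in> \<rho> i ` S}"
      using W y by (intro exI[of _ "W \<inter> h -` S"]) auto
  qed
qed

text \<open>Because the parametrizations are open maps, it suffices to look at each point through a
  single parametrization and a single preimage, chosen at will.\<close>

lemma openin_local:
  assumes "\<And>m. m \<in> W \<Longrightarrow>
    \<exists>i x N. i \<in> I \<and> x \<in> D i \<and> \<rho> i x = m \<and> open N \<and> x \<in> N \<and> (\<forall>w\<in>N \<inter> D i. \<rho> i w \<in> W)"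
  shows "openin (atlas_topology A) W"
proof (subst openin_subopen, clarify)
  fix m assume "m \<in> W"
  then obtain i x N where *: "i \<in> I" "x \<in> D i" "\<rho> i x = m" "open N" "x \<in> N" "\<forall>w\<in>N \<inter> D i. \<rho> i w \<in> W"
    using assms by blast
  then have "openin (atlas_topology A) (\<rho> i ` (N \<inter> D i))"
    by (intro open_image open_Int open_dom) auto
  with * show "\<exists>T. openin (atlas_topology A) T \<and> m \<in> T \<and> T \<subseteq> W"
    by (intro exI[of _ "\<rho> i ` (N \<inter> D i)"]) auto
qed

lemma continuous_map_param:
  assumes "i \<in> I"
  shows "continuous_map (top_of_set (D i)) (atlas_topology A) (\<rho> i)"
  unfolding continuous_map_def
proof (intro conjI allI impI)
  show "\<rho> i \<in> topspace (top_of_set (D i)) \<rightarrow> topspace (atlas_topology A)"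
    using assms by (auto simp: topspace carrier)
  fix W assume "openin (atlas_topology A) W"
  then have "open {x \<in> D i. \<rho> i x \<in> W}" using assms by (simp add: openin_iff)
  then show "openin (top_of_set (D i)) {x \<in> topspace (top_of_set (D i)). \<rho> i x \<in> W}"
    using open_dom[OF assms] by (simp add: openin_open_eq)
qed

lemma smooth_near_lift:
  assumes "smooth_near I D \<rho> g x" "j \<in> I" "y \<in> D j" "\<rho> j y = g x"
  obtains W h where "open W" "x \<in> W" "smooth_on W h" "h x = y" "h ` W \<subseteq> D j" "\<forall>w\<in>W. g w = \<rho> j (h w)"
proof -
  obtain W h i where W: "open W" "x \<in> W" "i \<in> I" "smooth_on W h" "h ` W \<subseteq> D i" "\<forall>w\<in>W. g w = \<rho> i (h
      w)"
    using assms(1) by (auto simp: smooth_near_def)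
  have hx: "h x \<in> D i" "\<rho> i (h x) = \<rho> j y" using W assms by auto
  obtain W' h' where W': "open W'" "h x \<in> W'" "W' \<subseteq> D i" "smooth_on W' h'" "h' (h x) = y" "h' ` W'
      \<subseteq> D j"
      "\<forall>w\<in>W'. \<rho> j (h' w) = \<rho> i w"
    using transition[OF W(3) assms(2) hx(1) assms(3) hx(2)] by blast
  have V: "open (W \<inter> h -` W')"
    using W W' by (auto intro: continuous_open_preimage smooth_on_continuous)
  have sm: "smooth_on (W \<inter> h -` W') h"
    using W(4) by (rule smooth_on_subset) auto
  show thesis
  proof
    show "smooth_on (W \<inter> h -` W') (\<lambda>w. h' (h w))"
      by (rule smooth_on_compose[OF V W'(1) _ sm W'(4)]) auto
  qed (use V W W' in auto)
qed

lemma smooth_near_param: "i \<in> I \<Longrightarrow> x \<in> D i \<Longrightarrow> smooth_near I D \<rho> (\<rho> i) x"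
  using open_dom by (intro smooth_nearI[of "D i" x i I "\<lambda>w. w"]) auto

lemma smooth_map_into:
  assumes A': "\<And>S \<sigma>. (S, \<sigma>) \<in> A' \<Longrightarrow> open S"
    and f: "\<And>S \<sigma> x. (S, \<sigma>) \<in> A' \<Longrightarrow> x \<in> S \<Longrightarrow> smooth_near I D \<rho> (\<lambda>w. f (\<sigma> w)) x"
  shows "smooth_map A' A f"
proof -
  have "f p \<in> carrier_of A" if "p \<in> carrier_of A'" for p
  proof -
    obtain S \<sigma> x where S: "(S, \<sigma>) \<in> A'" "x \<in> S" "p = \<sigma> x"
      using \<open>p \<in> carrier_of A'\<close> by (auto simp: carrier_of_def)
    then show ?thesis
      using f[OF S(1,2)] by (auto simp: smooth_near_def carrier)
  qed
  moreover have "open {x \<in> S. f (\<sigma> x) \<in> \<tau> ` T} \<and>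
      smooth_on {x \<in> S. f (\<sigma> x) \<in> \<tau> ` T} (\<lambda>x. inv_into T \<tau> (f (\<sigma> x)))"
    if S: "(S, \<sigma>) \<in> A'" and T: "(T, \<tau>) \<in> A" for S \<sigma> T \<tau>
  proof -
    obtain j where j: "j \<in> I" "open T" "T \<subseteq> D j" "\<tau> = \<rho> j" "inj_on \<tau> T"
      using T by (auto simp: etale_atlas_def)
    have *: "\<exists>W. open W \<and> x \<in> W \<and> W \<subseteq> {x \<in> S. f (\<sigma> x) \<in> \<tau> ` T} \<and>
        smooth_on W (\<lambda>x. inv_into T \<tau> (f (\<sigma> x)))"
      if x: "x \<in> S" "f (\<sigma> x) \<in> \<tau> ` T" for x
    proof -
      obtain t where t: "t \<in> T" "f (\<sigma> x) = \<tau> t" using x by auto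
      obtain W h where W: "open W" "x \<in> W" "smooth_on W h" "h x = t" "h ` W \<subseteq> D j"
          "\<forall>w\<in>W. f (\<sigma> w) = \<rho> j (h w)"
        using smooth_near_lift[OF f[OF S x(1)] j(1), of t] t j by auto
      let ?V = "S \<inter> (W \<inter> h -` T)"
      have V: "open ?V"
        using W j A'[OF S] by (auto intro: continuous_open_preimage smooth_on_continuous)
      \<comment> \<open>Injectivity of the chart on \<open>T\<close> identifies the local lift with
        the coordinate expression that \<open>smooth_map\<close> asks about.\<close>
      have eq: "h w = inv_into T \<tau> (f (\<sigma> w))" if "w \<in> ?V" for w
      proof -
        have "f (\<sigma> w) = \<tau> (h w)" "h w \<in> T" using that W(6) j(4) by auto
        then show ?thesis using inv_into_f_f[OF j(5)] by metis
      qed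
      have "smooth_on ?V h" using W(3) by (rule smooth_on_subset) auto
      then have "smooth_on ?V (\<lambda>x. inv_into T \<tau> (f (\<sigma> x)))"
        by (rule smooth_on_cong[OF V, of h, rotated]) (rule eq)
      moreover have "f (\<sigma> w) \<in> \<tau> ` T" if "w \<in> ?V" for w
        using that W j by auto
      ultimately show ?thesis using V W t x by (intro exI[of _ ?V]) auto
    qed
    show ?thesis
    proof
      show "open {x \<in> S. f (\<sigma> x) \<in> \<tau> ` T}"
        by (subst open_subopen) (use * in blast)
      show "smooth_on {x \<in> S. f (\<sigma> x) \<in> \<tau> ` T} (\<lambda>x. inv_into T \<tau> (f (\<sigma> x)))"
        by (rule smooth_on_local) (use * in blast)
    qed
  qed
  ultimately show ?thesis
    unfolding smooth_map_def by blast
qed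

lemma smooth_atlas: "smooth_atlas A"
proof -
  have "smooth_map A A (\<lambda>p. p)"
    by (rule smooth_map_into[OF chart_open]) (auto simp: etale_atlas_def intro!: smooth_near_param)
  then show ?thesis
    by (auto simp: smooth_atlas_def etale_atlas_def)
qed

lemma second_countable:
  assumes "countable I"
  shows "second_countable (atlas_topology A)"
proof -
  obtain B :: "'e set set" where B: "countable B" "topological_basis B"
    using ex_countable_basis by blast
  let ?B = "(\<lambda>(i, b). \<rho> i ` (b \<inter> D i)) ` (I \<times> B)"
  have 1: "countable ?B" using assms B by auto
  have 2: "openin (atlas_topology A) V" if V: "V \<in> ?B" for V
  proof -
    obtain i b where "i \<in> I" "b \<in> B" "V = \<rho> i ` (b \<inter> D i)" using V by auto
    then show ?thesis
      using topological_basis_open[OF B(2)] open_dom by (auto intro!: open_image)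
  qed
  have 3: "\<exists>V\<in>?B. m \<in> V \<and> V \<subseteq> U" if U: "openin (atlas_topology A) U" "m \<in> U" for U m
  proof -
    have "m \<in> carrier_of A" using U openin_subset topspace by blast
    then obtain i x where i: "i \<in> I" "x \<in> D i" "m = \<rho> i x" by (auto simp: carrier)
    have "open {x \<in> D i. \<rho> i x \<in> U}" using U(1) i by (auto simp: openin_iff)
    then obtain b where b: "b \<in> B" "x \<in> b" "b \<subseteq> {x \<in> D i. \<rho> i x \<in> U}"
      using topological_basisE[OF B(2), of "{x \<in> D i. \<rho> i x \<in> U}" x] i U by blast
    then show ?thesis
      using i by (intro bexI[of _ "\<rho> i ` (b \<inter> D i)"]) auto
  qed
  show ?thesis
    unfolding second_countable_def
  proof (intro exI[of _ ?B] conjI allI impI ballI)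
    fix U m assume "openin (atlas_topology A) U \<and> m \<in> U"
    then show "\<exists>V\<in>?B. m \<in> V \<and> V \<subseteq> U" using 3 by blast
  qed (rule 1, erule 2)
qed

text \<open>Passing to an open subset merely shrinks the domains, so everything proved in the locale
  is available for open submanifolds as well.\<close>

lemma restrict:
  assumes U: "openin (atlas_topology A) U"
  shows etale_restrict: "etale I (\<lambda>i. {x \<in> D i. \<rho> i x \<in> U}) \<rho>"
    and restrict_atlas_eq: "restrict_atlas A U = etale_atlas I (\<lambda>i. {x \<in> D i. \<rho> i x \<in> U}) \<rho>"
proof -
  have oU: "open {x \<in> D i. \<rho> i x \<in> U}" if "i \<in> I" for i
    using U that by (simp add: openin_iff)
  show "etale I (\<lambda>i. {x \<in> D i. \<rho> i x \<in> U}) \<rho>"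
  proof
    fix i x assume i: "i \<in> I" and x: "x \<in> {x \<in> D i. \<rho> i x \<in> U}"
    then obtain S where S: "open S" "x \<in> S" "S \<subseteq> D i" "inj_on (\<rho> i) S" using loc_inj by blast
    then have "open (S \<inter> {x \<in> D i. \<rho> i x \<in> U})" "inj_on (\<rho> i) (S \<inter> {x \<in> D i. \<rho> i x \<in> U})"
      using oU[OF i] by (auto intro: inj_on_subset)
    then show "\<exists>S. open S \<and> x \<in> S \<and> S \<subseteq> {x \<in> D i. \<rho> i x \<in> U} \<and> inj_on (\<rho> i) S"
      using S x by blast
  next
    fix i j x y assume i: "i \<in> I" and j: "j \<in> I" and x: "x \<in> {x \<in> D i. \<rho> i x \<in> U}"
      and y: "y \<in> {x \<in> D j. \<rho> j x \<in> U}" and xy: "\<rho> i x = \<rho> j y"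
    obtain W h where W: "open W" "x \<in> W" "W \<subseteq> D i" "smooth_on W h" "h x = y" "h ` W \<subseteq> D j"
        "\<forall>w\<in>W. \<rho> j (h w) = \<rho> i w"
      using transition[OF i j _ _ xy] x y by auto
    let ?W = "W \<inter> {x \<in> D i. \<rho> i x \<in> U}"
    have "open ?W" "smooth_on ?W h"
      using W oU[OF i] by (auto intro: smooth_on_subset)
    then show "\<exists>W h. open W \<and> x \<in> W \<and> W \<subseteq> {x \<in> D i. \<rho> i x \<in> U} \<and> smooth_on W h \<and> h x = y \<and>
        h ` W \<subseteq> {x \<in> D j. \<rho> j x \<in> U} \<and> (\<forall>w\<in>W. \<rho> j (h w) = \<rho> i w)"
      using W x by (intro exI[of _ ?W] exI[of _ h]) auto
  qed (use oU in auto)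
  show "restrict_atlas A U = etale_atlas I (\<lambda>i. {x \<in> D i. \<rho> i x \<in> U}) \<rho>" (is "?L = ?R")
  proof
    show "?L \<subseteq> ?R"
    proof
      fix c assume "c \<in> ?L"
      then obtain S i where S: "i \<in> I" "open S" "S \<subseteq> D i" "inj_on (\<rho> i) S" "c = ({x \<in> S. \<rho> i x \<in>
          U}, \<rho> i)"
        by (auto simp: restrict_atlas_def etale_atlas_def)
      then have "open (S \<inter> {x \<in> D i. \<rho> i x \<in> U})" using oU by auto
      moreover have "S \<inter> {x \<in> D i. \<rho> i x \<in> U} = {x \<in> S. \<rho> i x \<in> U}" using S by auto
      ultimately show "c \<in> ?R"
        using S by (auto simp: etale_atlas_def intro: inj_on_subset)
    qed
    show "?R \<subseteq> ?L"
    proof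
      fix c assume "c \<in> ?R"
      then obtain S i where S: "i \<in> I" "open S" "S \<subseteq> {x \<in> D i. \<rho> i x \<in> U}" "inj_on (\<rho> i) S" "c =
          (S, \<rho> i)"
        by (auto simp: etale_atlas_def)
      moreover have "{x \<in> S. \<rho> i x \<in> U} = S" using S by auto
      ultimately show "c \<in> ?L"
        unfolding restrict_atlas_def etale_atlas_def
        by (intro image_eqI[of _ _ "(S, \<rho> i)"]) auto
    qed
  qed
qed

lemma carrier_of_restrict:
  assumes "openin (atlas_topology A) U"
  shows "carrier_of (restrict_atlas A U) = U"
proof -
  have "U \<subseteq> carrier_of A" using assms by (simp add: openin_iff)
  then show ?thesis
    unfolding restrict_atlas_eq[OF assms] etale.carrier[OF etale_restrict[OF assms]] carrier
    by blast
qed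

lemma openin_restrict:
  assumes "openin (atlas_topology A) U"
  shows "openin (atlas_topology (restrict_atlas A U)) W \<longleftrightarrow> openin (atlas_topology A) W \<and> W \<subseteq> U"
proof -
  have "{x \<in> {x \<in> D i. \<rho> i x \<in> U}. \<rho> i x \<in> W} = {x \<in> D i. \<rho> i x \<in> W}" if "W \<subseteq> U" for i
    using that by auto
  moreover have "U \<subseteq> carrier_of A" using assms by (simp add: openin_iff)
  ultimately show ?thesis
    using carrier_of_restrict[OF assms]
    unfolding restrict_atlas_eq[OF assms] etale.openin_iff[OF etale_restrict[OF assms]] openin_iff
    by auto
qed

lemma Hausdorff_restrict:
  assumes "openin (atlas_topology A) U" "Hausdorff_space (atlas_topology A)"
  shows "Hausdorff_space (atlas_topology (restrict_atlas A U))"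
proof -
  have "atlas_topology (restrict_atlas A U) = subtopology (atlas_topology A) U"
    unfolding topology_eq openin_restrict[OF assms(1)] openin_open_subtopology[OF assms(1)] by auto
  then show ?thesis
    using assms(2) by (simp add: Hausdorff_space_subtopology)
qed

text \<open>The slice chart required by the definition is the parametrization translated so that the
  given point sits at the origin, where a linear subspace can be used. Its compatibility with the
  atlas is obtained by adding it to the etale family and quoting \<open>smooth_atlas\<close> for the
  larger family.\<close>

lemma embedded_submanifold_slice:
  assumes P: "\<And>p. p \<in> P \<Longrightarrow> \<exists>i x L r. i \<in> I \<and> x \<in> D i \<and> \<rho> i x = p \<and> subspace L \<and> dim L = d \<and> 0 < r \<and>
      (\<forall>w. norm w < r \<longrightarrow> x + w \<in> D i \<longrightarrow> (\<rho> i (x + w) \<in> P \<longleftrightarrow> w \<in> L))"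
  shows "embedded_submanifold A d P"
  unfolding embedded_submanifold_def
proof (intro conjI ballI subsetI)
  fix p assume p: "p \<in> P"
  obtain i x L r where ix: "i \<in> I" "x \<in> D i" "\<rho> i x = p" and L: "subspace L" "dim L = d" "0 < r"
      "\<forall>w. norm w < r \<longrightarrow> x + w \<in> D i \<longrightarrow> (\<rho> i (x + w) \<in> P \<longleftrightarrow> w \<in> L)"
    using P[OF p] by auto
  show "p \<in> carrier_of A" using ix by (auto simp: carrier)
  obtain S0 where S0: "open S0" "x \<in> S0" "S0 \<subseteq> D i" "inj_on (\<rho> i) S0" using loc_inj ix by blast
  define S where "S = {w. norm w < r} \<inter> (\<lambda>w. x + w) -` S0"
  define \<sigma> where "\<sigma> = (\<lambda>w. \<rho> i (x + w))"
  have sm: "smooth_on V (\<lambda>w. c + w)" "smooth_on V (\<lambda>w. w + c)" if "open V" for V :: "'e set" and c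
    using that by (auto intro!: smooth_on_add)
  have oS: "open S"
    unfolding S_def by (intro open_Int open_Collect_less continuous_intros open_vimage S0)
  have inj: "inj_on \<sigma> S"
    using inj_onD[OF S0(4)] by (fastforce simp: \<sigma>_def S_def intro!: inj_onI)
  \<comment> \<open>The new index \<open>None\<close> stands for the translated parametrization,
    which has to be compared with itself and, in both directions, with the old maps.\<close>
  define I' where "I' = insert None (Some ` I)"
  define D' where "D' = (\<lambda>k. case k of None \<Rightarrow> S | Some j \<Rightarrow> D j)"
  define \<rho>' where "\<rho>' = (\<lambda>k. case k of None \<Rightarrow> \<sigma> | Some j \<Rightarrow> \<rho> j)"
  have "etale I' D' \<rho>'"
  proof
    fix k assume "k \<in> I'" then show "open (D' k)"
      using oS open_dom by (auto simp: I'_def D'_def)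
  next
    fix k z assume "k \<in> I'" "z \<in> D' k" then show "\<exists>S. open S \<and> z \<in> S \<and> S \<subseteq> D' k \<and> inj_on (\<rho>' k) S"
      using oS inj loc_inj by (auto simp: I'_def D'_def \<rho>'_def)
  next
    fix k l z y assume k: "k \<in> I'" and l: "l \<in> I'" and z: "z \<in> D' k" and y: "y \<in> D' l" and zy: "\<rho>'
        k z = \<rho>' l y"
    consider "k = None" "l = None" | j where "k = None" "l = Some j" "j \<in> I" |
        j where "k = Some j" "l = None" "j \<in> I" | j j' where "k = Some j" "l = Some j'" "j \<in> I"
            "j' \<in> I"
      using k l by (auto simp: I'_def)
    then show "\<exists>W h. open W \<and> z \<in> W \<and> W \<subseteq> D' k \<and> smooth_on W h \<and> h z = y \<and> h ` W \<subseteq> D' l \<and>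
        (\<forall>w\<in>W. \<rho>' l (h w) = \<rho>' k w)"
    proof cases
      case 1
      then have "z = y" using z y zy inj by (auto simp: D'_def \<rho>'_def inj_on_def)
      with 1 z oS show ?thesis
        by (intro exI[of _ S] exI[of _ "\<lambda>w. w"]) (auto simp: D'_def)
    next
      case 2
      then have *: "x + z \<in> D i" "\<rho> i (x + z) = \<rho> j y" "y \<in> D j" "z \<in> S"
        using z y zy S0 by (auto simp: D'_def \<rho>'_def \<sigma>_def S_def)
      obtain W h where W: "open W" "x + z \<in> W" "W \<subseteq> D i" "smooth_on W h" "h (x + z) = y" "h ` W \<subseteq>
          D j"
          "\<forall>w\<in>W. \<rho> j (h w) = \<rho> i w"
        using transition[OF ix(1) 2(3) *(1,3,2)] by blast
      have V: "open (S \<inter> (\<lambda>w. x + w) -` W)"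
        by (intro open_Int oS open_vimage W continuous_intros)
      have "smooth_on (S \<inter> (\<lambda>w. x + w) -` W) (\<lambda>w. h (x + w))"
        by (rule smooth_on_compose[OF V W(1) _ sm(1)[OF V] W(4)]) auto
      with V W * 2 show ?thesis
        by (intro exI[of _ "S \<inter> (\<lambda>w. x + w) -` W"] exI[of _ "\<lambda>w. h (x + w)"])
           (auto simp: D'_def \<rho>'_def \<sigma>_def)
    next
      case 3
      then have *: "x + y \<in> D i" "\<rho> j z = \<rho> i (x + y)" "z \<in> D j" "y \<in> S"
        using z y zy S0 by (auto simp: D'_def \<rho>'_def \<sigma>_def S_def)
      obtain W h where W: "open W" "z \<in> W" "W \<subseteq> D j" "smooth_on W h" "h z = x + y" "h ` W \<subseteq> D i"
          "\<forall>w\<in>W. \<rho> i (h w) = \<rho> j w"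
        using transition[OF 3(3) ix(1) *(3,1,2)] by blast
      have smh: "smooth_on W (\<lambda>w. h w + - x)"
        using W by (intro smooth_on_add) auto
      have V: "open (W \<inter> (\<lambda>w. h w + - x) -` S)"
        using smooth_on_continuous[OF smh] W(1) oS by (rule continuous_open_preimage)
      have "smooth_on (W \<inter> (\<lambda>w. h w + - x) -` S) (\<lambda>w. h w + - x)"
        using smh by (rule smooth_on_subset) auto
      with V W * 3 show ?thesis
        by (intro exI[of _ "W \<inter> (\<lambda>w. h w + - x) -` S"] exI[of _ "\<lambda>w. h w + - x"])
           (auto simp: D'_def \<rho>'_def \<sigma>_def)
    next
      case 4
      then show ?thesis
        using transition[of j j' z y] z y zy by (auto simp: D'_def \<rho>'_def)
    qed
  qed
  then have "smooth_atlas (etale_atlas I' D' \<rho>')" by (rule etale.smooth_atlas)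
  moreover have "insert (S, \<sigma>) A \<subseteq> etale_atlas I' D' \<rho>'"
  proof -
    have "(S, \<rho>' None) \<in> etale_atlas I' D' \<rho>'"
      unfolding etale_atlas_def using oS inj
      by (auto simp: I'_def D'_def \<rho>'_def intro!: exI[of _ None])
    moreover have "(T, \<rho>' (Some j)) \<in> etale_atlas I' D' \<rho>'"
      if "j \<in> I" "open T" "T \<subseteq> D j" "inj_on (\<rho> j) T" for T j
      unfolding etale_atlas_def using that
      by (auto simp: I'_def D'_def \<rho>'_def intro!: exI[of _ "Some j"])
    ultimately show ?thesis
      by (auto simp: etale_atlas_def[of I] \<rho>'_def)
  qed
  ultimately have "smooth_atlas (insert (S, \<sigma>) A)" by (rule smooth_atlas_subset)
  moreover have "\<sigma> ` S \<subseteq> carrier_of A" using S0 ix by (auto simp: \<sigma>_def S_def carrier)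
  moreover have "p \<in> \<sigma> ` S" using ix S0 L by (auto simp: \<sigma>_def S_def intro!: image_eqI[of _ _ 0])
  moreover have "{x \<in> S. \<sigma> x \<in> P} = S \<inter> L" using L(4) S0 by (auto simp: \<sigma>_def S_def)
  ultimately show "\<exists>S \<sigma> L. \<sigma> ` S \<subseteq> carrier_of A \<and> smooth_atlas (insert (S, \<sigma>) A) \<and> p \<in> \<sigma> ` S \<and>
      subspace L \<and> dim L = d \<and> {x \<in> S. \<sigma> x \<in> P} = S \<inter> L"
    using L by blast
qed

end

text \<open>One preimage of each point of the source suffices: transition maps carry the lift found
  there to all other charts.\<close>

lemma smooth_map_etale:
  assumes "etale I D \<rho>" "etale J E \<tau>"
    and f: "\<And>m. m \<in> carrier_of (etale_atlas I D \<rho>) \<Longrightarrow>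
      \<exists>i x. i \<in> I \<and> x \<in> D i \<and> \<rho> i x = m \<and> smooth_near J E \<tau> (\<lambda>w. f (\<rho> i w)) x"
  shows "smooth_map (etale_atlas I D \<rho>) (etale_atlas J E \<tau>) f"
proof -
  interpret A: etale I D \<rho> by fact
  interpret B: etale J E \<tau> by fact
  show ?thesis
  proof (rule B.smooth_map_into[OF A.chart_open])
    fix S \<sigma> y assume "(S, \<sigma>) \<in> A.A" "y \<in> S"
    then obtain j where j: "j \<in> I" "y \<in> D j" "\<sigma> = \<rho> j" by (auto simp: etale_atlas_def)
    then have "\<rho> j y \<in> carrier_of A.A" by (auto simp: A.carrier)
    then obtain i x where ix: "i \<in> I" "x \<in> D i" "\<rho> i x = \<rho> j y" "smooth_near J E \<tau> (\<lambda>w. f (\<rho> i w))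
        x"
      using f by blast
    obtain W h where W: "open W" "y \<in> W" "W \<subseteq> D j" "smooth_on W h" "h y = x" "h ` W \<subseteq> D i"
        "\<forall>w\<in>W. \<rho> i (h w) = \<rho> j w"
      using A.transition[OF j(1) ix(1) j(2) ix(2)] ix by auto
    have "smooth_near J E \<tau> (\<lambda>w. f (\<rho> i (h w))) y"
      using smooth_near_compose[of J E \<tau> "\<lambda>w. f (\<rho> i w)" h y W] ix W by auto
    then show "smooth_near J E \<tau> (\<lambda>w. f (\<sigma> w)) y"
      by (rule smooth_near_cong[OF _ W(1,2)]) (use W j in auto)
  qed
qed

text \<open>The product atlas is not itself of etale form, but its charts are products with the
  identity of a vector space, so a transition map can be applied in the second factor alone. The
  vector space will be the space of angles of a torus.\<close>

lemma smooth_map_prod_etale: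
  fixes f :: "'v::euclidean_space \<times> 'a \<Rightarrow> 'b" and D :: "'i \<Rightarrow> 'e::euclidean_space set"
  assumes "etale I D \<rho>" "etale J E \<tau>"
    and f: "\<And>m v. m \<in> carrier_of (etale_atlas I D \<rho>) \<Longrightarrow>
      \<exists>i x. i \<in> I \<and> x \<in> D i \<and> \<rho> i x = m \<and> smooth_near J E \<tau> (\<lambda>(v, w). f (v, \<rho> i w)) (v, x)"
  shows "smooth_map (prod_atlas {(UNIV, \<lambda>v. v)} (etale_atlas I D \<rho>)) (etale_atlas J E \<tau>) f"
proof -
  interpret A: etale I D \<rho> by fact
  interpret B: etale J E \<tau> by fact
  show ?thesis
  proof (rule B.smooth_map_into)
    fix S \<sigma> assume S: "(S, \<sigma>) \<in> prod_atlas {(UNIV :: 'v set, \<lambda>v. v)} A.A"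
    then show "open S"
      by (auto simp: prod_atlas_def etale_atlas_def open_Times)
    fix y assume "y \<in> S"
    then obtain j v z where j: "j \<in> I" "z \<in> D j" "\<sigma> = map_prod (\<lambda>v. v) (\<rho> j)" "y = (v, z)"
      using S by (auto simp: prod_atlas_def etale_atlas_def)
    then have "\<rho> j z \<in> carrier_of A.A" by (auto simp: A.carrier)
    then obtain i x where ix: "i \<in> I" "x \<in> D i" "\<rho> i x = \<rho> j z" "smooth_near J E \<tau> (\<lambda>(v, w). f (v,
        \<rho> i w)) (v, x)"
      using f by blast
    obtain W h where W: "open W" "z \<in> W" "W \<subseteq> D j" "smooth_on W h" "h z = x" "h ` W \<subseteq> D i"
        "\<forall>w\<in>W. \<rho> i (h w) = \<rho> j w"
      using A.transition[OF j(1) ix(1) j(2) ix(2)] ix by auto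
    have oW: "open (UNIV \<times> W :: ('v \<times> _) set)" using W by (auto intro: open_Times)
    have 1: "smooth_on (UNIV \<times> W :: ('v \<times> _) set) (\<lambda>p. h (snd p))"
      by (rule smooth_on_compose[OF oW W(1) _ smooth_on_bounded_linear[OF bounded_linear_snd]
          W(4)]) auto
    have 2: "bounded_linear (\<lambda>v::'v. (v, 0::'e))" "bounded_linear (\<lambda>w::'e. (0::'v, w))"
      by (auto intro!: bounded_linear_Pair bounded_linear_zero bounded_linear_ident)
    have "smooth_on (UNIV \<times> W :: ('v \<times> _) set) (\<lambda>p. (fst p, 0) + (0, h (snd p)))"
      by (intro smooth_on_add oW smooth_on_linear_compose[OF oW 2(1)] smooth_on_linear_compose[OF
          oW 2(2)] 1
          smooth_on_bounded_linear bounded_linear_fst)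
    then have sm: "smooth_on (UNIV \<times> W :: ('v \<times> _) set) (\<lambda>p. (fst p, h (snd p)))" by simp
    have y: "y \<in> UNIV \<times> W" "(fst y, h (snd y)) = (v, x)" using j W by auto
    have "smooth_near J E \<tau> (\<lambda>p. (\<lambda>(v, w). f (v, \<rho> i w)) (fst p, h (snd p))) y"
      by (rule smooth_near_compose[OF _ oW y(1) sm]) (unfold y(2), rule ix(4))
    moreover have "f (\<sigma> p) = (\<lambda>(v, w). f (v, \<rho> i w)) (fst p, h (snd p))" if "p \<in> UNIV \<times> W" for p
      using that W(7) j(3) by (cases p) simp
    ultimately show "smooth_near J E \<tau> (\<lambda>w. f (\<sigma> w)) y"
      by (rule smooth_near_cong[OF _ oW y(1)])
  qed
qed

section \<open>Trivial coverings with several sheets\<close>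

text \<open>The product with a discrete set of labels. One label gives the one-sheeted covering and
  two labels the two-sheeted one, so both kinds of covering have the same type of points.\<close>

definition sheets :: "('e, 'a) atlas \<Rightarrow> nat set \<Rightarrow> ('e, 'a \<times> nat) atlas" where
  "sheets A K = {(S, \<lambda>x. (\<sigma> x, k)) | S \<sigma> k. (S, \<sigma>) \<in> A \<and> k \<in> K}"

lemma carrier_of_sheets: "carrier_of (sheets A K) = carrier_of A \<times> K"
proof
  show "carrier_of (sheets A K) \<subseteq> carrier_of A \<times> K"
    by (fastforce simp: carrier_of_def sheets_def)
  show "carrier_of A \<times> K \<subseteq> carrier_of (sheets A K)"
  proof clarify
    fix p k assume "p \<in> carrier_of A" "k \<in> K"
    then obtain S \<sigma> x where "(S, \<sigma>) \<in> A" "x \<in> S" "p = \<sigma> x" by (auto simp: carrier_of_def)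
    with \<open>k \<in> K\<close> have "(S, \<lambda>x. (\<sigma> x, k)) \<in> sheets A K" by (auto simp: sheets_def)
    with \<open>x \<in> S\<close> \<open>p = \<sigma> x\<close> show "(p, k) \<in> carrier_of (sheets A K)"
      unfolding carrier_of_def by force
  qed
qed

abbreviation "sheet_dom D \<equiv> \<lambda>(i, k::nat). D i"
abbreviation "sheet_map \<rho> \<equiv> \<lambda>(i, k::nat) x. (\<rho> i x, k)"

lemma sheets_etale_atlas:
  "sheets (etale_atlas I D \<rho>) K = etale_atlas (I \<times> K) (sheet_dom D) (sheet_map \<rho>)"
proof -
  have inj: "inj_on (\<lambda>x. (\<rho> i x, k :: nat)) S \<longleftrightarrow> inj_on (\<rho> i) S" for i k S
    by (auto simp: inj_on_def)
  show ?thesis (is "?L = ?R")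
  proof
    show "?L \<subseteq> ?R"
    proof
      fix c assume "c \<in> ?L"
      then obtain S i k where "c = (S, \<lambda>x. (\<rho> i x, k))" "i \<in> I" "open S" "S \<subseteq> D i" "inj_on (\<rho> i)
          S" "k \<in> K"
        by (auto simp: sheets_def etale_atlas_def)
      then show "c \<in> ?R"
        unfolding etale_atlas_def using inj by (auto intro!: exI[of _ i] exI[of _ k])
    qed
    show "?R \<subseteq> ?L"
    proof
      fix c assume "c \<in> ?R"
      then obtain S i k where "c = (S, \<lambda>x. (\<rho> i x, k))" "i \<in> I" "open S" "S \<subseteq> D i" "inj_on (\<rho> i)
          S" "k \<in> K"
        by (auto simp: etale_atlas_def inj)
      then show "c \<in> ?L"
        unfolding etale_atlas_def sheets_def by blast
    qed
  qed
qed

context etale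
begin

lemma etale_sheets: "etale (I \<times> K) (sheet_dom D) (sheet_map \<rho>)"
proof
  fix i x assume i: "i \<in> I \<times> K" and x: "x \<in> sheet_dom D i"
  obtain j k where ij: "i = (j, k)" "j \<in> I" using i by auto
  then obtain S where "open S" "x \<in> S" "S \<subseteq> D j" "inj_on (\<rho> j) S" using x loc_inj[of j x] by auto
  then show "\<exists>S. open S \<and> x \<in> S \<and> S \<subseteq> sheet_dom D i \<and> inj_on (sheet_map \<rho> i) S"
    unfolding ij by (intro exI[of _ S]) (auto simp: inj_on_def)
next
  fix i j x y assume *: "i \<in> I \<times> K" "j \<in> I \<times> K" "x \<in> sheet_dom D i" "y \<in> sheet_dom D j"
    "sheet_map \<rho> i x = sheet_map \<rho> j y"
  obtain i' k j' where ij: "i = (i', k)" "j = (j', k)" "i' \<in> I" "j' \<in> I" using * by auto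
  then have "x \<in> D i'" "y \<in> D j'" "\<rho> i' x = \<rho> j' y" using * by auto
  then show "\<exists>W h. open W \<and> x \<in> W \<and> W \<subseteq> sheet_dom D i \<and> smooth_on W h \<and> h x = y \<and> h ` W \<subseteq>
      sheet_dom D j \<and>
      (\<forall>w\<in>W. sheet_map \<rho> j (h w) = sheet_map \<rho> i w)"
    using transition[OF ij(3,4), of x y] unfolding ij by simp
qed (auto intro: open_dom)

lemma smooth_near_sheet:
  assumes "smooth_near I D \<rho> g x" "k \<in> K"
  shows "smooth_near (I \<times> K) (sheet_dom D) (sheet_map \<rho>) (\<lambda>w. (g w, k)) x"
proof -
  obtain W h j where W: "open W" "x \<in> W" "j \<in> I" "smooth_on W h" "h ` W \<subseteq> D j" "\<forall>w\<in>W. g w = \<rho> j (h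
      w)"
    using assms(1) by (auto simp: smooth_near_def)
  then show ?thesis
    using assms(2) by (intro smooth_nearI[of W x "(j, k)" _ h]) auto
qed

lemma openin_sheet:
  assumes "openin (atlas_topology A) U" "k \<in> K"
  shows "openin (atlas_topology (sheets A K)) (U \<times> {k})"
proof -
  have "open {x \<in> sheet_dom D i. sheet_map \<rho> i x \<in> U \<times> {k}}" if "i \<in> I \<times> K" for i
    using assms that by (cases "snd i = k") (auto simp: openin_iff case_prod_beta)
  then show ?thesis
    unfolding sheets_etale_atlas etale.openin_iff[OF etale_sheets]
    unfolding sheets_etale_atlas[symmetric] carrier_of_sheets
    using assms by (auto simp: openin_iff)
qed

lemma Hausdorff_sheets:
  assumes "Hausdorff_space (atlas_topology A)"
  shows "Hausdorff_space (atlas_topology (sheets A K))"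
proof -
  have top: "topspace (atlas_topology (sheets A K)) = carrier_of A \<times> K"
    using etale.topspace[OF etale_sheets] by (metis sheets_etale_atlas carrier_of_sheets)
  have "\<exists>U V. openin (atlas_topology (sheets A K)) U \<and> openin (atlas_topology (sheets A K)) V \<and>
      (m, k) \<in> U \<and> (m', k') \<in> V \<and> disjnt U V"
    if m: "m \<in> carrier_of A" "m' \<in> carrier_of A" "k \<in> K" "k' \<in> K" "(m, k) \<noteq> (m', k')" for m m' k k'
  proof (cases "k = k'")
    case True
    then obtain U V where "openin (atlas_topology A) U" "openin (atlas_topology A) V" "m \<in> U" "m'
        \<in> V" "disjnt U V"
      using assms m unfolding Hausdorff_space_def topspace by blast
    then show ?thesis
      using m by (intro exI[of _ "U \<times> {k}"] exI[of _ "V \<times> {k'}"]) (auto intro: openin_sheet simp: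
          disjnt_def)
  next
    case False
    have "openin (atlas_topology A) (carrier_of A)"
      using openin_topspace topspace by metis
    then show ?thesis
      using m False by (intro exI[of _ "carrier_of A \<times> {k}"] exI[of _ "carrier_of A \<times> {k'}"])
        (auto intro: openin_sheet simp: disjnt_def)
  qed
  then show ?thesis
    unfolding Hausdorff_space_def top by (metis mem_Sigma_iff prod.exhaust)
qed

lemma smooth_manifold_sheets:
  assumes "Hausdorff_space (atlas_topology A)" "countable I"
  shows "smooth_manifold (sheets A K)"
proof -
  have "countable (I \<times> K)" using assms(2) by auto
  then show ?thesis
    using Hausdorff_sheets[OF assms(1), of K] etale.smooth_atlas[OF etale_sheets, of K]
      etale.second_countable[OF etale_sheets, of K]
    by (simp add: smooth_manifold_def sheets_etale_atlas)
qed

lemma smooth_map_sheets: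
  assumes "\<And>k. k \<in> K \<Longrightarrow> \<kappa> k \<in> L"
  shows "smooth_map (sheets A K) (sheets A L) (\<lambda>(m, k). (m, \<kappa> k))"
  unfolding sheets_etale_atlas
proof (rule smooth_map_etale[OF etale_sheets etale_sheets])
  fix m assume "m \<in> carrier_of (etale_atlas (I \<times> K) (sheet_dom D) (sheet_map \<rho>))"
  then obtain i x k where i: "i \<in> I" "x \<in> D i" "k \<in> K" "m = (\<rho> i x, k)"
    unfolding etale.carrier[OF etale_sheets] by auto
  then show "\<exists>i x. i \<in> I \<times> K \<and> x \<in> sheet_dom D i \<and> sheet_map \<rho> i x = m \<and>
      smooth_near (I \<times> L) (sheet_dom D) (sheet_map \<rho>) (\<lambda>w. case sheet_map \<rho> i w of (m, k) \<Rightarrow> (m, \<kappa>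
          k)) x"
    using smooth_near_sheet[OF smooth_near_param[OF i(1,2)], of "\<kappa> k" L] assms[of k]
    by (intro exI[of _ "(i, k)"] exI[of _ x]) auto
qed

lemma smooth_map_fst: "smooth_map (sheets A K) A fst"
  unfolding sheets_etale_atlas
proof (rule smooth_map_etale[OF etale_sheets etale_axioms])
  fix m assume "m \<in> carrier_of (etale_atlas (I \<times> K) (sheet_dom D) (sheet_map \<rho>))"
  then obtain i x k where i: "i \<in> I" "x \<in> D i" "k \<in> K" "m = (\<rho> i x, k)"
    unfolding etale.carrier[OF etale_sheets] by auto
  then show "\<exists>i x. i \<in> I \<times> K \<and> x \<in> sheet_dom D i \<and> sheet_map \<rho> i x = m \<and>
      smooth_near I D \<rho> (\<lambda>w. fst (sheet_map \<rho> i w)) x"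
    using smooth_near_param[OF i(1,2)]
    by (intro exI[of _ "(i, k)"] exI[of _ x]) auto
qed

end

lemma restrict_atlas_carrier: "restrict_atlas A (carrier_of A) = A"
proof -
  have "{x \<in> S. \<sigma> x \<in> carrier_of A} = S" if "(S, \<sigma>) \<in> A" for S \<sigma>
    using that by (auto simp: carrier_of_def)
  then have "(\<lambda>(S, \<sigma>). ({x \<in> S. \<sigma> x \<in> carrier_of A}, \<sigma>)) c = c" if "c \<in> A" for c
    using that by (cases c) auto
  then show ?thesis
    by (simp add: restrict_atlas_def)
qed

context etale
begin

lemma diffeo_sheet:
  assumes k: "k \<in> K"
  shows "diffeo (restrict_atlas (sheets A K) (carrier_of A \<times> {k})) A fst"
proof -
  interpret S: etale "I \<times> K" "sheet_dom D" "sheet_map \<rho>" by (rule etale_sheets)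
  let ?U = "carrier_of A \<times> {k}"
  have "openin (atlas_topology A) (carrier_of A)"
    using openin_topspace topspace by metis
  then have U: "openin (atlas_topology S.A) ?U"
    using openin_sheet[OF _ k] by (simp add: sheets_etale_atlas)
  have car: "carrier_of (restrict_atlas S.A ?U) = ?U"
    by (rule S.carrier_of_restrict[OF U])
  have "smooth_map (restrict_atlas S.A ?U) A fst"
    unfolding S.restrict_atlas_eq[OF U]
  proof (rule smooth_map_etale[OF S.etale_restrict[OF U] etale_axioms], unfold
      S.restrict_atlas_eq[OF U, symmetric] car)
    fix m assume "m \<in> ?U"
    then obtain i x where i: "i \<in> I" "x \<in> D i" "m = (\<rho> i x, k)" by (auto simp: carrier)
    then show "\<exists>i x. i \<in> I \<times> K \<and> x \<in> {x \<in> sheet_dom D i. sheet_map \<rho> i x \<in> ?U} \<and> sheet_map \<rho> i x =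
        m \<and>
        smooth_near I D \<rho> (\<lambda>w. fst (sheet_map \<rho> i w)) x"
      using k smooth_near_param[OF i(1,2)]
        by (intro exI[of _ "(i, k)"] exI[of _ x]) (auto simp: carrier)
  qed
  moreover have "smooth_map A (restrict_atlas S.A ?U) (inv_into ?U fst)"
    unfolding S.restrict_atlas_eq[OF U]
  proof (rule smooth_map_etale[OF etale_axioms S.etale_restrict[OF U]])
    fix m assume "m \<in> carrier_of A"
    then obtain i x where i: "i \<in> I" "x \<in> D i" "m = \<rho> i x" by (auto simp: carrier)
    have inv: "inv_into ?U fst (\<rho> i w) = (\<rho> i w, k)" if "w \<in> D i" for w
      using that i by (intro inv_into_f_eq) (auto simp: inj_on_def carrier)
    have "smooth_near (I \<times> K) (\<lambda>i. {x \<in> sheet_dom D i. sheet_map \<rho> i x \<in> ?U}) (sheet_map \<rho>) (\<lambda>w.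
        (\<rho> i w, k)) x"
      using i k smooth_near_param
        by (intro smooth_near_restrict[OF _ open_dom[OF i(1)] i(2)] smooth_near_sheet)
         (auto simp: carrier)
    then have "smooth_near (I \<times> K) (\<lambda>i. {x \<in> sheet_dom D i. sheet_map \<rho> i x \<in> ?U}) (sheet_map \<rho>)
        (\<lambda>w. inv_into ?U fst (\<rho> i w)) x"
      by (rule smooth_near_cong[OF _ open_dom[OF i(1)] i(2)]) (rule inv)
    with i show "\<exists>i x. i \<in> I \<and> x \<in> D i \<and> \<rho> i x = m \<and>
        smooth_near (I \<times> K) (\<lambda>i. {x \<in> sheet_dom D i. sheet_map \<rho> i x \<in> ?U}) (sheet_map \<rho>)
        (\<lambda>w. inv_into ?U fst (\<rho> i w)) x"
      by blast
  qed
  moreover have "bij_betw fst ?U (carrier_of A)"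
    by (auto simp: bij_betw_def inj_on_def image_def)
  ultimately show ?thesis
    unfolding diffeo_def sheets_etale_atlas car by simp
qed

lemma diffeo_sheets:
  assumes bij: "bij_betw \<kappa> K K"
  shows "diffeo (sheets A K) (sheets A K) (restrict (\<lambda>(m, k). (m, \<kappa> k)) (carrier_of A \<times> K))"
    (is "diffeo ?C ?C ?f")
proof -
  let ?U = "carrier_of A \<times> K"
  have \<kappa>: "inj_on \<kappa> K" "\<kappa> ` K = K"
    using bij by (auto simp: bij_betw_def)
  have "?f ` ?U = carrier_of A \<times> \<kappa> ` K" by force
  with \<kappa> have b: "bij_betw ?f ?U ?U"
    by (auto simp: bij_betw_def inj_on_def)
  have congr: "smooth_map ?C ?C g" if "smooth_map ?C ?C f" "\<And>p. p \<in> ?U \<Longrightarrow> f p = g p" for f g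
    using smooth_map_cong[OF that(1), of g] that(2) by (simp add: carrier_of_sheets)
  have "smooth_map ?C ?C ?f"
    by (rule congr[OF smooth_map_sheets[of K \<kappa> K]]) (use bij in \<open>auto simp: bij_betw_def\<close>)
  moreover have "smooth_map ?C ?C (inv_into ?U ?f)"
  proof (rule congr[OF smooth_map_sheets[of K "inv_into K \<kappa>" K]])
    show "inv_into K \<kappa> k \<in> K" if "k \<in> K" for k
      using bij that by (metis bij_betw_def inv_into_into)
    show "(case p of (m, k) \<Rightarrow> (m, inv_into K \<kappa> k)) = inv_into ?U ?f p" if p: "p \<in> ?U" for p
    proof -
      obtain m k where p: "p = (m, k)" "m \<in> carrier_of A" "k \<in> K" using p by auto
      then have k: "inv_into K \<kappa> k \<in> K" "\<kappa> (inv_into K \<kappa> k) = k"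
        using bij by (metis bij_betw_def inv_into_into, metis bij_betw_inv_into_right)
      have "?f (m, inv_into K \<kappa> k) = p" using k p by auto
      then have "inv_into ?U ?f p = (m, inv_into K \<kappa> k)"
        using b k p by (intro inv_into_f_eq) (auto simp: bij_betw_def)
      then show ?thesis using p by simp
    qed
  qed
  ultimately show ?thesis
    using b by (simp add: diffeo_def carrier_of_sheets)
qed

text \<open>The covering is globally trivial, so the whole base is evenly covered. Any permutation
  of the labels is a deck transformation, and the transposition of two labels moves one point of a
  fibre to another.\<close>

lemma finite_galois_covering_sheets:
  assumes "finite K" "K \<noteq> {}"
  shows "finite_galois_covering (sheets A K) A fst"
  unfolding finite_galois_covering_def smooth_covering_def carrier_of_sheets
proof (intro conjI ballI impI)
  show "smooth_map (sheets A K) A fst" by (rule smooth_map_fst)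
  show "fst ` (carrier_of A \<times> K) = carrier_of A" using assms(2) by auto
  fix y assume y: "y \<in> carrier_of A"
  have car: "openin (atlas_topology A) (carrier_of A)"
    using openin_topspace topspace by metis
  show "\<exists>V \<W>. openin (atlas_topology A) V \<and> y \<in> V \<and> \<Union> \<W> = {x \<in> carrier_of A \<times> K. fst x \<in> V} \<and>
      pairwise disjnt \<W> \<and> (\<forall>W\<in>\<W>. openin (atlas_topology (sheets A K)) W \<and>
      diffeo (restrict_atlas (sheets A K) W) (restrict_atlas A V) fst)"
    using y car openin_sheet[OF car] diffeo_sheet
    by (intro exI[of _ "carrier_of A"] exI[of _ "(\<lambda>k. carrier_of A \<times> {k}) ` K"])
       (auto simp: restrict_atlas_carrier pairwise_def disjnt_def)
  have "{x \<in> carrier_of A \<times> K. fst x = y} \<subseteq> {y} \<times> K" by auto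
  then show "finite {x \<in> carrier_of A \<times> K. fst x = y}"
    using assms(1) finite_subset by blast
next
  fix x x' assume x: "x \<in> carrier_of A \<times> K" "x' \<in> carrier_of A \<times> K" "fst x = fst x'"
  define \<kappa> where "\<kappa> = Transposition.transpose (snd x) (snd x')"
  have "bij_betw \<kappa> K K"
    using x unfolding \<kappa>_def by (intro bij_betw_transpose_iff) auto
  then have "diffeo (sheets A K) (sheets A K) (restrict (\<lambda>(m, k). (m, \<kappa> k)) (carrier_of A \<times> K))"
    by (rule diffeo_sheets)
  then show "\<exists>\<gamma>\<in>deck_group (sheets A K) fst. \<gamma> x = x'"
    using x unfolding deck_group_def carrier_of_sheets
    by (intro bexI[of _ "restrict (\<lambda>(m, k). (m, \<kappa> k)) (carrier_of A \<times> K)"]) (auto simp: \<kappa>_def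
        prod_eq_iff)
qed

end

section \<open>The orbifold group\<close>

lemma exhaust_6:
  fixes x :: 6
  shows "x = 1 \<or> x = 2 \<or> x = 3 \<or> x = 4 \<or> x = 5 \<or> x = 6"
proof (induct x)
  case (of_int z)
  then have "z = 0 \<or> z = 1 \<or> z = 2 \<or> z = 3 \<or> z = 4 \<or> z = 5" by simp arith
  then show ?case by auto
qed

lemma forall_6: "(\<forall>i::6. P i) \<longleftrightarrow> P 1 \<and> P 2 \<and> P 3 \<and> P 4 \<and> P 5 \<and> P 6"
  by (metis exhaust_6)

lemma vector_6 [simp]:
  "(vector [a, b, c, d, e, f] :: 'a::zero ^ 6) $ 1 = a"
  "(vector [a, b, c, d, e, f] :: 'a::zero ^ 6) $ 2 = b"
  "(vector [a, b, c, d, e, f] :: 'a::zero ^ 6) $ 3 = c"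
  "(vector [a, b, c, d, e, f] :: 'a::zero ^ 6) $ 4 = d"
  "(vector [a, b, c, d, e, f] :: 'a::zero ^ 6) $ 5 = e"
  "(vector [a, b, c, d, e, f] :: 'a::zero ^ 6) $ 6 = f"
  by (simp_all add: vector_def)

lemma Ints_small: "(k::real) \<in> \<int> \<Longrightarrow> \<bar>k\<bar> < 1 \<Longrightarrow> k = 0"
  using Ints_nonzero_abs_less1 by blast

lemma Ints_minus_iff: "- (k::real) \<in> \<int> \<longleftrightarrow> k \<in> \<int>"
  by (metis Ints_minus minus_minus)

text \<open>
  The lifts to \<open>\<real>\<^sup>6\<close> of the elements of the group generated by the two involutions are the maps
  \<open>x \<mapsto> e x + n\<close>, where \<open>e\<close> is a vector of signs: \<open>e\<^sub>3\<close> is the sign of \<open>inv_alpha\<close> and \<open>e\<^sub>5\<close> that of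
  \<open>inv_beta\<close>, whose translation part is half-integral in the first coordinate.
\<close>

definition crystal :: "real ^ 6 \<Rightarrow> real ^ 6 \<Rightarrow> bool" where
  "crystal e n \<longleftrightarrow>
     (\<forall>i. e $ i = 1 \<or> e $ i = - 1) \<and>
     e $ 2 = e $ 1 \<and> e $ 4 = e $ 3 \<and> e $ 6 = e $ 5 \<and> e $ 1 = e $ 3 * e $ 5 \<and>
     (\<forall>i. i \<noteq> 1 \<longrightarrow> n $ i \<in> \<int>) \<and> n $ 1 - (1 - e $ 5) / 4 \<in> \<int>"

definition orb_rel :: "real ^ 6 \<Rightarrow> real ^ 6 \<Rightarrow> bool" where
  "orb_rel x y \<longleftrightarrow> (\<exists>e n. crystal e n \<and> y = e * x + n)"

lemma crystal_signs: "crystal e n \<Longrightarrow> e $ i = 1 \<or> e $ i = - 1"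
  by (simp add: crystal_def)

lemma crystalE:
  assumes "crystal e n"
  obtains s t k where "s \<in> {1, - 1}" "t \<in> {1, - 1}"
    "e $ 1 = s * t" "e $ 2 = s * t" "e $ 3 = s" "e $ 4 = s" "e $ 5 = t" "e $ 6 = t"
    "k \<in> \<int>" "n $ 1 = k + (1 - t) / 4" "n $ 2 \<in> \<int>" "n $ 3 \<in> \<int>" "n $ 4 \<in> \<int>" "n $ 5 \<in> \<int>" "n $ 6 \<in> \<int>"
proof (rule that[of "e $ 3" "e $ 5" "n $ 1 - (1 - e $ 5) / 4"])
qed (use assms in \<open>auto simp: crystal_def\<close>)

lemma crystalI:
  assumes "s \<in> {1, - 1}" "t \<in> {1, - 1}"
    "e $ 1 = s * t" "e $ 2 = s * t" "e $ 3 = s" "e $ 4 = s" "e $ 5 = t" "e $ 6 = t"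
    "n $ 1 - (1 - t) / 4 \<in> \<int>" "n $ 2 \<in> \<int>" "n $ 3 \<in> \<int>" "n $ 4 \<in> \<int>" "n $ 5 \<in> \<int>" "n $ 6 \<in> \<int>"
  shows "crystal e n"
  using assms by (auto simp: crystal_def forall_6)

lemma crystal_translation: "(\<And>i. n $ i \<in> \<int>) \<Longrightarrow> crystal 1 n"
  by (simp add: crystal_def)

lemma crystal_comp:
  assumes "crystal e n" "crystal e' n'"
  shows "crystal (e * e') (e * n' + n)"
proof -
  obtain s t k where 1: "s \<in> {1, - 1}" "t \<in> {1, - 1}"
    "e $ 1 = s * t" "e $ 2 = s * t" "e $ 3 = s" "e $ 4 = s" "e $ 5 = t" "e $ 6 = t"
    "k \<in> \<int>" "n $ 1 = k + (1 - t) / 4" "n $ 2 \<in> \<int>" "n $ 3 \<in> \<int>" "n $ 4 \<in> \<int>" "n $ 5 \<in> \<int>" "n $ 6 \<in> \<int>"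
    using assms(1) by (rule crystalE)
  obtain s' t' k' where 2: "s' \<in> {1, - 1}" "t' \<in> {1, - 1}"
    "e' $ 1 = s' * t'" "e' $ 2 = s' * t'" "e' $ 3 = s'" "e' $ 4 = s'" "e' $ 5 = t'" "e' $ 6 = t'"
    "k' \<in> \<int>" "n' $ 1 = k' + (1 - t') / 4" "n' $ 2 \<in> \<int>" "n' $ 3 \<in> \<int>" "n' $ 4 \<in> \<int>" "n' $ 5 \<in> \<int>" "n'
        $ 6 \<in> \<int>"
    using assms(2) by (rule crystalE)
  \<comment> \<open>Only the half-integral first coordinate needs an argument: modulo the integers
    (1 - t)/4 is a cocycle, that is, the last bracket is an integer for every choice of
    signs.\<close>
  have "(e * n' + n) $ 1 - (1 - t * t') / 4 =
      s * t * k' + k + (s * t * (1 - t') / 4 + (1 - t) / 4 - (1 - t * t') / 4)"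
    using 1 2 by (simp add: algebra_simps)
  also have "\<dots> \<in> \<int>"
  proof (intro Ints_add)
    show "s * t * k' \<in> \<int>" "k \<in> \<int>"
      using 1 2 by (auto intro!: Ints_mult)
    show "s * t * (1 - t') / 4 + (1 - t) / 4 - (1 - t * t') / 4 \<in> \<int>"
      using 1(1,2) 2(2) by auto
  qed
  finally have "(e * n' + n) $ 1 - (1 - t * t') / 4 \<in> \<int>" .
  then show ?thesis
    using 1 2 by (intro crystalI[of "s * s'" "t * t'"]) auto
qed

lemma crystal_inverse:
  assumes "crystal e n"
  shows "crystal e (- (e * n))" "e * (e * x + n) + - (e * n) = x"
proof -
  obtain s t k where 1: "s \<in> {1, - 1}" "t \<in> {1, - 1}"
    "e $ 1 = s * t" "e $ 2 = s * t" "e $ 3 = s" "e $ 4 = s" "e $ 5 = t" "e $ 6 = t"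
    "k \<in> \<int>" "n $ 1 = k + (1 - t) / 4" "n $ 2 \<in> \<int>" "n $ 3 \<in> \<int>" "n $ 4 \<in> \<int>" "n $ 5 \<in> \<int>" "n $ 6 \<in> \<int>"
    using assms(1) by (rule crystalE)
  have "(- (e * n)) $ 1 - (1 - t) / 4 = - (s * t) * k - (s * t * (1 - t) / 4 + (1 - t) / 4)"
    using 1 by (simp add: algebra_simps)
  also have "\<dots> \<in> \<int>"
  proof (intro Ints_diff)
    show "- (s * t) * k \<in> \<int>"
      using 1 by (auto intro!: Ints_mult)
    show "s * t * (1 - t) / 4 + (1 - t) / 4 \<in> \<int>"
      using 1(1,2) by auto
  qed
  finally have "(- (e * n)) $ 1 - (1 - t) / 4 \<in> \<int>" .
  then show "crystal e (- (e * n))"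
    using 1 by (intro crystalI[of s t]) auto
  have "e $ i * e $ i = 1" for i
    using crystal_signs[OF assms, of i] by auto
  then show "e * (e * x + n) + - (e * n) = x"
    by (simp add: vec_eq_iff distrib_left mult.assoc[symmetric])
qed

lemma crystal_dist:
  assumes "crystal e n"
  shows "dist (e * x + n) (e * y + n) = dist x y"
proof -
  have "\<bar>e $ i\<bar> = 1" for i using crystal_signs[OF assms, of i] by auto
  then have "norm (e * (x - y)) = norm (x - y)"
    by (simp add: norm_vec_def abs_mult)
  then show ?thesis by (simp add: dist_norm algebra_simps)
qed

lemma orb_rel_refl: "orb_rel x x"
  unfolding orb_rel_def using crystal_translation[of 0] by (intro exI[of _ 1] exI[of _ 0]) auto

lemma orb_rel_sym: "orb_rel x y \<Longrightarrow> orb_rel y x"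
  unfolding orb_rel_def using crystal_inverse by metis

lemma orb_rel_trans: "orb_rel x y \<Longrightarrow> orb_rel y z \<Longrightarrow> orb_rel x z"
  unfolding orb_rel_def
proof clarify
  fix e n e' n' assume "crystal e n" "crystal e' n'"
  moreover have "e' * (e * x + n) + n' = (e' * e) * x + (e' * n + n')"
    by (simp add: algebra_simps)
  ultimately show "\<exists>f m. crystal f m \<and> e' * (e * x + n) + n' = f * x + m"
    using crystal_comp by blast
qed

lemma orb_rel_translate:
  assumes "\<And>i. y $ i - x $ i \<in> \<int>"
  shows "orb_rel x y"
  unfolding orb_rel_def
  using crystal_translation[of "y - x"] assms by (intro exI[of _ 1] exI[of _ "y - x"]) auto

lemma T6_eq_iff: "T6 x = T6 y \<longleftrightarrow> (\<forall>i. x $ i - y $ i \<in> \<int>)"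
proof
  assume "T6 x = T6 y"
  moreover have "x \<in> T6 x" by (simp add: T6_def)
  ultimately show "\<forall>i. x $ i - y $ i \<in> \<int>" by (auto simp: T6_def)
next
  assume xy: "\<forall>i. x $ i - y $ i \<in> \<int>"
  have "z $ i - x $ i \<in> \<int> \<longleftrightarrow> z $ i - y $ i \<in> \<int>" for z i
    using Ints_add[of "z $ i - x $ i" "x $ i - y $ i"] Ints_diff[of "z $ i - y $ i" "x $ i - y $
        i"] xy
    by auto
  then show "T6 x = T6 y" by (auto simp: T6_def)
qed

lemma Gam_cases:
  assumes "g \<in> Gam"
  obtains e n where "crystal e n" "\<And>x. g x = e * x + n"
proof -
  consider "g = id" | "g = inv_alpha" | "g = inv_beta" | "g = inv_alpha \<circ> inv_beta"
    using assms by (auto simp: Gam_def)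
  then show ?thesis
  proof cases
    case 1
    then show ?thesis using that[of 1 0] crystal_translation[of 0] by auto
  next
    case 2
    then show ?thesis
      by (intro that[of "vector [-1, -1, -1, -1, 1, 1]" 0] crystalI[of "-1" 1])
         (auto simp: vec_eq_iff forall_6 inv_alpha_def)
  next
    case 3
    then show ?thesis
      by (intro that[of "vector [-1, -1, 1, 1, -1, -1]" "vector [1/2, 0, 0, 0, 0, 0]"] crystalI[of
          1 "-1"])
         (auto simp: vec_eq_iff forall_6 inv_beta_def)
  next
    case 4
    then show ?thesis
      by (intro that[of "vector [1, 1, -1, -1, -1, -1]" "vector [-1/2, 0, 0, 0, 0, 0]"]
          crystalI[of "-1" "-1"])
         (auto simp: vec_eq_iff forall_6 inv_alpha_def inv_beta_def)
  qed
qed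

lemma crystal_Gam:
  assumes "crystal e n"
  shows "\<exists>g\<in>Gam. T6 (e * x + n) = T6 (g x)"
proof -
  obtain s t k where st: "s \<in> {1, - 1}" "t \<in> {1, - 1}"
    "e $ 1 = s * t" "e $ 2 = s * t" "e $ 3 = s" "e $ 4 = s" "e $ 5 = t" "e $ 6 = t"
    "k \<in> \<int>" "n $ 1 = k + (1 - t) / 4" "n $ 2 \<in> \<int>" "n $ 3 \<in> \<int>" "n $ 4 \<in> \<int>" "n $ 5 \<in> \<int>" "n $ 6 \<in> \<int>"
    using assms(1) by (rule crystalE)
  consider "s = 1" "t = 1" | "s = -1" "t = 1" | "s = 1" "t = -1" | "s = -1" "t = -1" using st(1,2)
    by auto
  then show ?thesis
  proof cases
    case 1
    then show ?thesis using st(3-15)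
      by (intro bexI[of _ id]) (auto simp: T6_eq_iff forall_6 Gam_def)
  next
    case 2
    then show ?thesis using st(3-15)
      by (intro bexI[of _ inv_alpha]) (auto simp: T6_eq_iff forall_6 Gam_def inv_alpha_def)
  next
    case 3
    then show ?thesis using st(3-15)
      by (intro bexI[of _ inv_beta]) (auto simp: T6_eq_iff forall_6 Gam_def inv_beta_def)
  next
    case 4
    \<comment> \<open>\<open>inv_alpha \<circ> inv_beta\<close> translates x_1 by -1/2, while the
      normal form of \<open>crystal\<close> has k + 1/2; the difference is k + 1.\<close>
    have "k + 1 \<in> \<int>" using \<open>k \<in> \<int>\<close> by simp
    then show ?thesis using 4 st(3-8,10-15)
      by (intro bexI[of _ "inv_alpha \<circ> inv_beta"])
         (auto simp: T6_eq_iff forall_6 Gam_def inv_alpha_def inv_beta_def)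
  qed
qed

text \<open>Representatives in the finite group \<open>Gam\<close> together with the integer lattice
  amount to the affine maps of \<open>crystal\<close>. From here on every question about the
  orbifold is a question about one relation on R^6.\<close>

lemma orb_eq_iff: "orb x = orb y \<longleftrightarrow> orb_rel x y"
proof -
  have orb: "orb x = T6 ` {y. orb_rel x y}" for x
  proof
    show "orb x \<subseteq> T6 ` {y. orb_rel x y}"
    proof
      fix c assume "c \<in> orb x"
      then obtain g where "g \<in> Gam" "c = T6 (g x)" by (auto simp: orb_def)
      then show "c \<in> T6 ` {y. orb_rel x y}"
        using Gam_cases[of g] by (metis (mono_tags) image_eqI mem_Collect_eq orb_rel_def)
    qed
    show "T6 ` {y. orb_rel x y} \<subseteq> orb x"
    proof clarify
      fix y assume "orb_rel x y"
      then obtain e n where "crystal e n" "y = e * x + n" by (auto simp: orb_rel_def)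
      then show "T6 y \<in> orb x"
        using crystal_Gam[of e n x] by (auto simp: orb_def)
    qed
  qed
  show ?thesis
  proof
    assume "orb x = orb y"
    then have "T6 y \<in> T6 ` {z. orb_rel x z}"
      using orb orb_rel_refl[of y] by blast
    then obtain z where z: "orb_rel x z" "T6 y = T6 z" by auto
    then have "orb_rel z y"
      by (intro orb_rel_translate) (auto simp: T6_eq_iff)
    with z show "orb_rel x y" using orb_rel_trans by blast
  next
    assume "orb_rel x y"
    then have "orb_rel x z \<longleftrightarrow> orb_rel y z" for z
      using orb_rel_trans orb_rel_sym by blast
    then show "orb x = orb y" by (simp add: orb)
  qed
qed

text \<open>The product of the two involutions moves x_1 by a half modulo 1, so it has no fixed
  points. The two alternatives are the fixed points of \<open>inv_alpha\<close> and of
  \<open>inv_beta\<close>.\<close>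

lemma singular_iff:
  "singular x \<longleftrightarrow>
     2 * x $ 1 \<in> \<int> \<and> 2 * x $ 2 \<in> \<int> \<and> 2 * x $ 3 \<in> \<int> \<and> 2 * x $ 4 \<in> \<int> \<or>
     2 * x $ 1 - 1 / 2 \<in> \<int> \<and> 2 * x $ 2 \<in> \<int> \<and> 2 * x $ 5 \<in> \<int> \<and> 2 * x $ 6 \<in> \<int>"
proof -
  have "inv_alpha 1 \<noteq> 1" "inv_beta 1 \<noteq> 1" "inv_alpha (inv_beta 1) \<noteq> 1"
    by (auto simp: vec_eq_iff forall_6 inv_alpha_def inv_beta_def)
  then have ne: "inv_alpha \<noteq> id" "inv_beta \<noteq> id" "inv_alpha \<circ> inv_beta \<noteq> id"
    by (metis id_apply comp_apply)+
  then have "Gam - {id} = {inv_alpha, inv_beta, inv_alpha \<circ> inv_beta}"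
    by (auto simp: Gam_def)
  then have "singular x \<longleftrightarrow> T6 (inv_alpha x) = T6 x \<or> T6 (inv_beta x) = T6 x \<or> T6 (inv_alpha
      (inv_beta x)) = T6 x"
    by (simp add: singular_def)
  moreover have "- (y::real) - y \<in> \<int> \<longleftrightarrow> 2 * y \<in> \<int>" for y
    using Ints_minus_iff[of "2 * y"] by simp
  moreover have "1 / 2 - (y::real) - y \<in> \<int> \<longleftrightarrow> 2 * y - 1 / 2 \<in> \<int>" for y
    using Ints_minus_iff[of "2 * y - 1 / 2"] by (simp add: algebra_simps)
  moreover have "- (1 / 2 - (y::real)) - y \<notin> \<int>" for y
    using Ints_small[of "- (1 / 2)"] by auto
  ultimately show ?thesis
    by (auto simp: T6_eq_iff forall_6 inv_alpha_def inv_beta_def)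
qed

text \<open>Half-integrality survives changes of sign and integral translations, and the extra shift
  (1 - t)/4 of x_1 changes 2 x_1 by 0 or 1. The converse implication comes from the inverse
  element.\<close>

lemma singular_crystal:
  assumes "crystal e n"
  shows "singular (e * x + n) \<longleftrightarrow> singular x"
proof -
  have *: "singular (e * x + n)" if c: "crystal e n" and x: "singular x" for e n x
  proof -
    obtain s t k where 1: "s \<in> {1, - 1}" "t \<in> {1, - 1}"
      "e $ 1 = s * t" "e $ 2 = s * t" "e $ 3 = s" "e $ 4 = s" "e $ 5 = t" "e $ 6 = t"
      "k \<in> \<int>" "n $ 1 = k + (1 - t) / 4" "n $ 2 \<in> \<int>" "n $ 3 \<in> \<int>" "n $ 4 \<in> \<int>" "n $ 5 \<in> \<int>" "n $ 6 \<in> \<int>"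
      using c by (rule crystalE)
    have i: "2 * (r * y + m) \<in> \<int>" if "r \<in> {1, -1}" "2 * y \<in> \<int>" "m \<in> \<int>" for r y m :: real
      using that Ints_add[of "r * (2 * y)" "2 * m"] by (auto simp: algebra_simps)
    have st: "s * t \<in> \<int>" "2 * k \<in> \<int>" "(1 - t) / 2 \<in> \<int>" "(s * t - 1) / 2 \<in> \<int>"
      using 1(1,2,9) by auto
    have a: "2 * (s * t * y + (k + (1 - t) / 4)) \<in> \<int>" if "2 * y \<in> \<int>" for y
    proof -
      have "s * t * (2 * y) + (2 * k + (1 - t) / 2) \<in> \<int>"
        by (intro Ints_add Ints_mult[OF st(1) that] st)
      moreover have "s * t * (2 * y) + (2 * k + (1 - t) / 2) = 2 * (s * t * y + (k + (1 - t) / 4))"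
        by (simp add: field_simps)
      ultimately show ?thesis by simp
    qed
    have b: "2 * (s * t * y + (k + (1 - t) / 4)) - 1 / 2 \<in> \<int>" if "2 * y - 1 / 2 \<in> \<int>" for y
    proof -
      have "s * t * (2 * y - 1 / 2) + (2 * k + (1 - t) / 2) + (s * t - 1) / 2 \<in> \<int>"
        by (intro Ints_add Ints_mult[OF st(1) that] st)
      moreover have "s * t * (2 * y - 1 / 2) + (2 * k + (1 - t) / 2) + (s * t - 1) / 2 =
          2 * (s * t * y + (k + (1 - t) / 4)) - 1 / 2"
        by (simp add: field_simps)
      ultimately show ?thesis by simp
    qed
    have st': "s * t \<in> {1, -1}" using 1(1,2) by auto
    have c: "(e * x + n) $ 1 = s * t * x $ 1 + (k + (1 - t) / 4)" "(e * x + n) $ 2 = s * t * x $ 2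
        + n $ 2"
      "(e * x + n) $ 3 = s * x $ 3 + n $ 3" "(e * x + n) $ 4 = s * x $ 4 + n $ 4"
      "(e * x + n) $ 5 = t * x $ 5 + n $ 5" "(e * x + n) $ 6 = t * x $ 6 + n $ 6"
      using 1 by auto
    from x show ?thesis
      unfolding singular_iff c
    proof (elim disjE conjE)
      assume "2 * x $ 1 \<in> \<int>" "2 * x $ 2 \<in> \<int>" "2 * x $ 3 \<in> \<int>" "2 * x $ 4 \<in> \<int>"
      then show "2 * (s * t * x $ 1 + (k + (1 - t) / 4)) \<in> \<int> \<and> 2 * (s * t * x $ 2 + n $ 2) \<in> \<int> \<and>
          2 * (s * x $ 3 + n $ 3) \<in> \<int> \<and> 2 * (s * x $ 4 + n $ 4) \<in> \<int> \<or>
          2 * (s * t * x $ 1 + (k + (1 - t) / 4)) - 1 / 2 \<in> \<int> \<and> 2 * (s * t * x $ 2 + n $ 2) \<in> \<int> \<and>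
          2 * (t * x $ 5 + n $ 5) \<in> \<int> \<and> 2 * (t * x $ 6 + n $ 6) \<in> \<int>"
        by (intro disjI1 conjI a i st' 1)
    next
      assume "2 * x $ 1 - 1 / 2 \<in> \<int>" "2 * x $ 2 \<in> \<int>" "2 * x $ 5 \<in> \<int>" "2 * x $ 6 \<in> \<int>"
      then show "2 * (s * t * x $ 1 + (k + (1 - t) / 4)) \<in> \<int> \<and> 2 * (s * t * x $ 2 + n $ 2) \<in> \<int> \<and>
          2 * (s * x $ 3 + n $ 3) \<in> \<int> \<and> 2 * (s * x $ 4 + n $ 4) \<in> \<int> \<or>
          2 * (s * t * x $ 1 + (k + (1 - t) / 4)) - 1 / 2 \<in> \<int> \<and> 2 * (s * t * x $ 2 + n $ 2) \<in> \<int> \<and>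
          2 * (t * x $ 5 + n $ 5) \<in> \<int> \<and> 2 * (t * x $ 6 + n $ 6) \<in> \<int>"
        by (intro disjI2 conjI b i st' 1)
    qed
  qed
  show ?thesis
    using *[OF assms, of x] *[OF crystal_inverse(1)[OF assms], of "e * x + n"]
        crystal_inverse(2)[OF assms]
    by auto
qed

lemma singular_orb_rel: "orb_rel x y \<Longrightarrow> singular x \<longleftrightarrow> singular y"
  by (auto simp: orb_rel_def singular_crystal)

lemma open_nonsingular: "open {x. \<not> singular x}"
proof -
  have *: "closed {x :: real ^ 6. a * x $ i - b \<in> \<int>}" for a b i
    using closed_vimage[OF closed_Ints, of "\<lambda>x :: real ^ 6. a * x $ i - b"]
    by (simp add: vimage_def continuous_intros)
  have "closed {x. singular x}"
    unfolding singular_iff using *[of 2 _ 0] *[of 2 _ "1 / 2"]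
    by (intro closed_Collect_disj closed_Collect_conj) auto
  then show ?thesis
    by (simp add: open_closed Collect_neg_eq)
qed

text \<open>The coset c + Z/2 is discrete: its nonzero elements have modulus at least 1/2 if c
  itself lies in Z/2, and otherwise at least half the distance from 2c to the integers.\<close>

lemma coset_gap:
  fixes c :: real
  obtains r where "0 < r" "\<And>z. 2 * z \<in> \<int> \<Longrightarrow> \<bar>c + z\<bar> < r \<Longrightarrow> c + z = 0"
proof (cases "2 * c \<in> \<int>")
  case True
  show ?thesis
  proof (rule that[of "1 / 2"])
    fix z :: real assume "2 * z \<in> \<int>" "\<bar>c + z\<bar> < 1 / 2"
    moreover have "\<bar>2 * c + 2 * z\<bar> < 1" using \<open>\<bar>c + z\<bar> < 1 / 2\<close> by arith
    ultimately have "2 * c + 2 * z = 0"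
      using True by (intro Ints_small Ints_add) auto
    then show "c + z = 0" by simp
  qed simp
next
  case False
  obtain r where r: "0 < r" "\<And>y. y \<in> \<int> \<Longrightarrow> dist y (2 * c) \<ge> r"
  proof -
    have "open (- \<int> :: real set)" using closed_Ints by (simp add: open_closed)
    then obtain r where "0 < r" "ball (2 * c) r \<subseteq> - \<int>"
      using False by (metis ComplI open_contains_ball)
    then show ?thesis
      by (intro that[of r]) (force simp: dist_commute)+
  qed
  show ?thesis
  proof (rule that[of "r / 2"])
    fix z assume "2 * z \<in> \<int>" "\<bar>c + z\<bar> < r / 2"
    then have "dist (- (2 * z)) (2 * c) < r" unfolding dist_real_def by arith
    with r(2)[of "- (2 * z)"] \<open>2 * z \<in> \<int>\<close> show "c + z = 0" by (simp add: Ints_minus_iff)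
  qed (use r in auto)
qed

lemma crystal_half_Ints: "crystal e n \<Longrightarrow> 2 * n $ i \<in> \<int>"
proof (erule crystalE)
  fix s t k assume *: "s \<in> {1, - 1}" "t \<in> {1, - 1}"
      "k \<in> \<int>" "n $ 1 = k + (1 - t) / 4" "n $ 2 \<in> \<int>" "n $ 3 \<in> \<int>" "n $ 4 \<in> \<int>" "n $ 5 \<in> \<int>" "n $ 6 \<in> \<int>"
  have "2 * k + (1 - t) / 2 \<in> \<int>" using * by (intro Ints_add) auto
  moreover have "2 * n $ 1 = 2 * k + (1 - t) / 2" using * by (simp add: field_simps)
  ultimately have "2 * n $ 1 \<in> \<int>" by simp
  then show "2 * n $ i \<in> \<int>"
    using exhaust_6[of i] * by auto
qed

text \<open>Each component of a translation vector lies in Z/2 and each sign is 1 or -1, so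
  \<open>coset_gap\<close> is applied to finitely many constants s x_i - y_i, and the minimum serves
  all group elements at once. The conclusion holds coordinate by coordinate; the slices along the
  orbits control only some of the coordinates and depend on this form.\<close>

lemma crystal_gap:
  obtains r where "0 < r"
    "\<And>e n i. crystal e n \<Longrightarrow> \<bar>(e * x + n) $ i - y $ i\<bar> < r \<Longrightarrow> (e * x + n) $ i = y $ i"
proof -
  have "\<exists>r>0. \<forall>z. 2 * z \<in> \<int> \<longrightarrow> \<bar>c + z\<bar> < r \<longrightarrow> c + z = 0" for c :: real
    by (rule coset_gap[of c]) blast
  then obtain R where R: "\<And>c::real. 0 < R c" "\<And>c z. 2 * z \<in> \<int> \<Longrightarrow> \<bar>c + z\<bar> < R c \<Longrightarrow> c + z = 0"
    by metis
  let ?C = "(\<lambda>(s, i). s * x $ i - y $ i) ` ({1, - 1} \<times> UNIV)"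
  have fin: "finite (R ` ?C)" "R ` ?C \<noteq> {}" by auto
  show thesis
  proof (rule that[of "Min (R ` ?C)"])
    show "0 < Min (R ` ?C)" using fin R(1) by (subst Min_gr_iff) auto
    fix e n i assume c: "crystal e n" and *: "\<bar>(e * x + n) $ i - y $ i\<bar> < Min (R ` ?C)"
    have "e $ i \<in> {1, -1}" using crystal_signs[OF c, of i] by auto
    then have "e $ i * x $ i - y $ i \<in> ?C" by (intro image_eqI[of _ _ "(e $ i, i)"]) auto
    then have "Min (R ` ?C) \<le> R (e $ i * x $ i - y $ i)" using fin by auto
    then have "(e $ i * x $ i - y $ i) + n $ i = 0"
      using crystal_half_Ints[OF c, of i] order.strict_trans2[OF *]
      by (intro R(2)) (simp_all add: algebra_simps)
    then show "(e * x + n) $ i = y $ i" by simp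
  qed
qed

lemma orb_rel_gap:
  obtains r where "0 < r" "\<And>z. orb_rel x z \<Longrightarrow> dist z y < r \<Longrightarrow> z = y"
proof -
  obtain r where r: "0 < r"
    "\<And>e n i. crystal e n \<Longrightarrow> \<bar>(e * x + n) $ i - y $ i\<bar> < r \<Longrightarrow> (e * x + n) $ i = y $ i"
    using crystal_gap[of x y] by blast
  show thesis
  proof (rule that[OF r(1)])
    fix z assume "orb_rel x z" "dist z y < r"
    then obtain e n where z: "crystal e n" "z = e * x + n" by (auto simp: orb_rel_def)
    have "\<bar>z $ i - y $ i\<bar> < r" for i
      using component_le_norm_cart[of "z - y" i] \<open>dist z y < r\<close> by (simp add: dist_norm)
    then show "z = y" using r(2)[OF z(1)] unfolding z(2) vec_eq_iff by blast
  qed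
qed

section \<open>Neighbourhoods of the singular tori\<close>

definition centres :: "(real ^ 6) set" where
  "centres = alpha_centres \<union> beta_centres"

lemma beta_not_alpha: "p \<in> beta_centres \<Longrightarrow> p \<notin> alpha_centres"
  by (auto simp: alpha_centres_def beta_centres_def)

lemma finite_centres: "finite centres"
proof -
  let ?F = "{0, 1/2, 1/4 :: real}"
  have "finite ((\<lambda>f. \<chi> i::6. f i) ` (\<Pi>\<^sub>E i\<in>UNIV. ?F))"
    by (intro finite_imageI finite_PiE) auto
  moreover have "centres \<subseteq> (\<lambda>f. \<chi> i::6. f i) ` (\<Pi>\<^sub>E i\<in>UNIV. ?F)"
  proof
    fix p assume "p \<in> centres"
    then have "\<forall>i. p $ i \<in> ?F"
      by (auto simp: centres_def alpha_centres_def beta_centres_def forall_6)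
    then show "p \<in> (\<lambda>f. \<chi> i::6. f i) ` (\<Pi>\<^sub>E i\<in>UNIV. ?F)"
      by (intro image_eqI[of _ _ "\<lambda>i. p $ i"]) auto
  qed
  ultimately show ?thesis by (rule finite_subset[rotated])
qed

definition mk :: "real \<times> real \<Rightarrow> complex \<Rightarrow> complex \<Rightarrow> real ^ 6" where
  "mk ab z w = vector [fst ab, snd ab, Re z, Im z, Re w, Im w]"

definition zeta :: "real ^ 6 \<Rightarrow> complex" where "zeta y = Complex (y $ 3) (y $ 4)"
definition slope :: "real ^ 6 \<Rightarrow> complex" where "slope y = Complex (y $ 5) (y $ 6)"

lemma y_C2_eq: "y_C2 y = (zeta y, slope y)"
  by (simp add: y_C2_def zeta_def slope_def)

lemma mk_simps [simp]: "y_T2 (mk ab z w) = ab" "zeta (mk ab z w) = z" "slope (mk ab z w) = w"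
  by (simp_all add: mk_def y_T2_def zeta_def slope_def complex_eq_iff)

lemma mk_cases: "y = mk (y_T2 y) (zeta y) (slope y)"
  by (simp add: mk_def y_T2_def zeta_def slope_def vec_eq_iff forall_6)

lemma mk_eqI: "y_T2 y = y_T2 y' \<Longrightarrow> zeta y = zeta y' \<Longrightarrow> slope y = slope y' \<Longrightarrow> y = y'"
  by (metis mk_cases)

text \<open>Permutation from the order of the resolution charts, torus directions first, to that of
  R^6. \<open>True\<close> belongs to \<open>inv_alpha\<close>, whose tori run along x_5 and x_6,
  and \<open>False\<close> to \<open>inv_beta\<close>, with x_3 and x_4.\<close>

definition pos :: "bool \<Rightarrow> real ^ 6 \<Rightarrow> real ^ 6" where
  "pos k y = (if k then vector [y$3, y$4, y$5, y$6, y$1, y$2] else vector [y$3, y$4, y$1, y$2,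
      y$5, y$6])"

definition unpos :: "bool \<Rightarrow> real ^ 6 \<Rightarrow> real ^ 6" where
  "unpos k x = (if k then vector [x$5, x$6, x$1, x$2, x$3, x$4] else vector [x$3, x$4, x$1, x$2,
      x$5, x$6])"

lemma pos_unpos [simp]: "pos k (unpos k x) = x"
  by (simp add: pos_def unpos_def vec_eq_iff forall_6)

lemma unpos_pos [simp]: "unpos k (pos k x) = x"
  by (simp add: pos_def unpos_def vec_eq_iff forall_6)

lemma bounded_linear_pos: "bounded_linear (pos k)" and bounded_linear_unpos: "bounded_linear
    (unpos k)"
  by (auto simp: linear_conv_bounded_linear[symmetric] pos_def unpos_def vec_eq_iff forall_6
      intro!: linearI)

lemma near_torus_eq: "near_torus p ab v = p + pos (p \<in> alpha_centres) (mk ab (fst v) (snd v))"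
  by (cases ab; cases v) (simp add: near_torus_def pos_def mk_def)

lemma near_torus_alpha:
  assumes "p \<in> alpha_centres"
  shows "near_torus p ab v $ 1 = Re (fst v)" "near_torus p ab v $ 2 = p $ 2 + Im (fst v)"
    "near_torus p ab v $ 3 = p $ 3 + Re (snd v)" "near_torus p ab v $ 4 = p $ 4 + Im (snd v)"
    "near_torus p ab v $ 5 = fst ab" "near_torus p ab v $ 6 = snd ab"
  using assms by (simp_all add: near_torus_eq pos_def mk_def alpha_centres_def)

lemma near_torus_beta:
  assumes "p \<in> beta_centres"
  shows "near_torus p ab v $ 1 = 1 / 4 + Re (fst v)" "near_torus p ab v $ 2 = p $ 2 + Im (fst v)"
    "near_torus p ab v $ 3 = fst ab" "near_torus p ab v $ 4 = snd ab"
    "near_torus p ab v $ 5 = p $ 5 + Re (snd v)" "near_torus p ab v $ 6 = p $ 6 + Im (snd v)"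
  using assms beta_not_alpha[OF assms]
    by (simp_all add: near_torus_eq pos_def mk_def beta_centres_def)

lemma norm_components:
  assumes "norm (v :: complex \<times> complex) < r"
  shows "\<bar>Re (fst v)\<bar> < r" "\<bar>Im (fst v)\<bar> < r" "\<bar>Re (snd v)\<bar> < r" "\<bar>Im (snd v)\<bar> < r"
  using abs_Re_le_cmod[of "fst v"] abs_Im_le_cmod[of "fst v"] abs_Re_le_cmod[of "snd v"]
    abs_Im_le_cmod[of "snd v"] norm_fst_le[of "fst v" "snd v"] norm_snd_le[of "snd v" "fst v"] assms
  unfolding prod.collapse by linarith+

lemma T2_eq_iff: "T2 x = T2 y \<longleftrightarrow> fst x - fst y \<in> \<int> \<and> snd x - snd y \<in> \<int>"
proof
  assume "T2 x = T2 y"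
  moreover have "x \<in> T2 x" by (cases x) (simp add: T2_def)
  ultimately have "x \<in> T2 y" by simp
  then show "fst x - fst y \<in> \<int> \<and> snd x - snd y \<in> \<int>" by (auto simp: T2_def case_prod_beta)
next
  assume *: "fst x - fst y \<in> \<int> \<and> snd x - snd y \<in> \<int>"
  have "z - a \<in> \<int> \<longleftrightarrow> z - b \<in> \<int>" if "a - b \<in> \<int>" for z a b :: real
    using Ints_add[of "z - a" "a - b"] Ints_diff[of "z - b" "a - b"] that by auto
  from this[of "fst x" "fst y"] this[of "snd x" "snd y"] * show "T2 x = T2 y"
    by (auto simp: T2_def case_prod_beta)
qed

lemma half_Int: "q \<in> {0, 1/2 :: real} \<Longrightarrow> 2 * q \<in> \<int>"
proof -
  assume "q \<in> {0, 1/2}"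
  then have "2 * q = 0 \<or> 2 * q = 1" by auto
  then show ?thesis by (metis Ints_0 Ints_1)
qed

text \<open>The number p' - s p - n is half-integral and, by the bounds 1/8 on the deviations,
  smaller than 1/4; hence it vanishes. Integrality of n then leaves no room for p and p' to differ
  by 1/2.\<close>

lemma half_centre:
  fixes p p' v v' s n :: real
  assumes "p \<in> {0, 1/2}" "p' \<in> {0, 1/2}" "s \<in> {1, -1}" "n \<in> \<int>" "p' + v' = s * (p + v) + n"
    "\<bar>v\<bar> < 1/8" "\<bar>v'\<bar> < 1/8"
  shows "p' = p \<and> v' = s * v"
proof -
  have "\<bar>s * v\<bar> = \<bar>v\<bar>" using assms(3) by (auto simp: abs_mult)
  then have "\<bar>v' - s * v\<bar> < 1/4" using assms(6,7) by arith
  moreover have "p' - s * p - n = s * v - v'" using assms(5) by (simp add: algebra_simps)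
  ultimately have *: "\<bar>p' - s * p - n\<bar> < 1/4" by (metis abs_minus_commute)
  have "2 * p' - s * (2 * p) - 2 * n \<in> \<int>"
  proof (intro Ints_diff)
    show "s * (2 * p) \<in> \<int>"
      by (rule Ints_mult[OF _ half_Int[OF assms(1)]]) (use assms(3) in auto)
    show "2 * n \<in> \<int>"
      by (rule Ints_mult[OF _ assms(4)]) simp
  qed (rule half_Int[OF assms(2)])
  moreover have eq: "2 * p' - s * (2 * p) - 2 * n = 2 * (p' - s * p - n)"
    by (simp add: algebra_simps)
  moreover have "\<bar>2 * (p' - s * p - n)\<bar> < 1" using * by (simp only: abs_mult) simp
  ultimately have "2 * (p' - s * p - n) = 0"
    using Ints_small by metis
  then have n: "n = p' - s * p" by simp
  have "p' = p"
  proof (rule ccontr)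
    assume "p' \<noteq> p"
    then have "n = 1/2 \<or> n = -1/2" using n assms(1-3) by auto
    then show False using assms(4) Ints_small[of n] by auto
  qed
  with n assms(5) show ?thesis by (simp add: algebra_simps)
qed

text \<open>The first coordinate decides which group elements can occur: near a fixed torus only
  those whose signs belong to its stabilizer. The other normal coordinates are compared by
  \<open>half_centre\<close>, and tori of different kinds are kept apart by x_1.\<close>

lemma near_torus_inj:
  assumes p: "p \<in> centres" "p' \<in> centres" and v: "norm v < 1/8" "norm v' < 1/8"
    and orb: "orb_rel (near_torus p ab v) (near_torus p' ab' v')"
  shows "p' = p \<and> T2 ab' = T2 ab \<and> (v' = v \<or> v' = - v)"
proof -
  obtain e n where c: "crystal e n" and eq: "near_torus p' ab' v' = e * near_torus p ab v + n"
    using orb by (auto simp: orb_rel_def)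
  obtain s t k where st: "s \<in> {1, - 1}" "t \<in> {1, - 1}"
    "e $ 1 = s * t" "e $ 2 = s * t" "e $ 3 = s" "e $ 4 = s" "e $ 5 = t" "e $ 6 = t"
    and k: "k \<in> \<int>" "n $ 1 = k + (1 - t) / 4"
    and n: "n $ 2 \<in> \<int>" "n $ 3 \<in> \<int>" "n $ 4 \<in> \<int>" "n $ 5 \<in> \<int>" "n $ 6 \<in> \<int>"
    using c by (rule crystalE)
  have st': "s * t \<in> {1, -1}" using st by auto
  have eqs: "near_torus p' ab' v' $ 1 = s * t * near_torus p ab v $ 1 + (k + (1 - t) / 4)"
    "near_torus p' ab' v' $ 2 = s * t * near_torus p ab v $ 2 + n $ 2"
    "near_torus p' ab' v' $ 3 = s * near_torus p ab v $ 3 + n $ 3"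
    "near_torus p' ab' v' $ 4 = s * near_torus p ab v $ 4 + n $ 4"
    "near_torus p' ab' v' $ 5 = t * near_torus p ab v $ 5 + n $ 5"
    "near_torus p' ab' v' $ 6 = t * near_torus p ab v $ 6 + n $ 6"
    unfolding eq using st k by auto
  note b = norm_components[OF v(1)] and b' = norm_components[OF v(2)]
  have veq: "v' = v \<or> v' = - v"
    if "r \<in> {1, -1}" "Re (fst v') = r * Re (fst v)" "Im (fst v') = r * Im (fst v)"
      "Re (snd v') = r * Re (snd v)" "Im (snd v') = r * Im (snd v)" for r
    using that by (auto simp: prod_eq_iff complex_eq_iff)
  consider "p \<in> alpha_centres" "p' \<in> alpha_centres" | "p \<in> beta_centres" "p' \<in> beta_centres" |
    "p \<in> alpha_centres" "p' \<in> beta_centres" | "p \<in> beta_centres" "p' \<in> alpha_centres"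
    using p by (auto simp: centres_def)
  then show ?thesis
  proof cases
    case 1
    note eqs' = eqs[unfolded near_torus_alpha[OF 1(1)] near_torus_alpha[OF 1(2)]]
    have c: "\<And>i. i \<in> {2, 3, 4} \<Longrightarrow> p $ i \<in> {0, 1/2} \<and> p' $ i \<in> {0, 1/2}"
      using 1 by (auto simp: alpha_centres_def)
    \<comment> \<open>The sign -1 would come with a shift of x_1 by a half, which deviations below
      1/8 cannot make up for.\<close>
    have "t = 1"
    proof (rule ccontr)
      assume "t \<noteq> 1"
      then have "t = -1" using st by auto
      then have k': "k = Re (fst v') - (s * t) * Re (fst v) - 1/2" using eqs'(1) by simp
      with b(1) b'(1) st' have "k = 0" by (intro Ints_small k) auto
      with k' b(1) b'(1) st' show False by auto
    qed
    have k': "k = Re (fst v') - s * Re (fst v)" using eqs'(1) \<open>t = 1\<close> by simp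
    with b(1) b'(1) st(1) have "k = 0" by (intro Ints_small k) auto
    then have v1: "Re (fst v') = s * Re (fst v)" using k' by simp
    have v2: "p' $ 2 = p $ 2 \<and> Im (fst v') = s * t * Im (fst v)"
      by (rule half_centre[OF _ _ st' n(1) eqs'(2) b(2) b'(2)]) (use c[of 2] in auto)
    have v3: "p' $ 3 = p $ 3 \<and> Re (snd v') = s * Re (snd v)"
      by (rule half_centre[OF _ _ st(1) n(2) eqs'(3) b(3) b'(3)]) (use c[of 3] in auto)
    have v4: "p' $ 4 = p $ 4 \<and> Im (snd v') = s * Im (snd v)"
      by (rule half_centre[OF _ _ st(1) n(3) eqs'(4) b(4) b'(4)]) (use c[of 4] in auto)
    have "p' = p" using v2 v3 v4 1 by (auto simp: vec_eq_iff forall_6 alpha_centres_def)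
    moreover have "T2 ab' = T2 ab" using eqs'(5,6) n \<open>t = 1\<close> by (auto simp: T2_eq_iff)
    ultimately show ?thesis using veq[OF st(1)] v1 v2 v3 v4 \<open>t = 1\<close> by auto
  next
    case 2
    note eqs' = eqs[unfolded near_torus_beta[OF 2(1)] near_torus_beta[OF 2(2)]]
    have c: "\<And>i. i \<in> {2, 5, 6} \<Longrightarrow> p $ i \<in> {0, 1/2} \<and> p' $ i \<in> {0, 1/2}"
      using 2 by (auto simp: beta_centres_def)
    have *: "s = 1 \<and> Re (fst v') = t * Re (fst v)"
    proof (cases "s * t = 1")
      case True
      then have k': "k = Re (fst v') - Re (fst v) - (1 - t) / 4" using eqs'(1) by simp
      with b(1) b'(1) st(2) have "k = 0" by (intro Ints_small k) auto
      with k' b(1) b'(1) st(2) have "t = 1" by auto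
      with True k' \<open>k = 0\<close> show ?thesis by auto
    next
      case False
      then have r: "s * t = -1" using st' by auto
      then have k': "k = Re (fst v') + Re (fst v) + (1 + t) / 4" using eqs'(1)
        by (simp add: field_simps)
      with b(1) b'(1) st(2) have "k = 0" by (intro Ints_small k) auto
      with k' b(1) b'(1) st(2) have "t = -1" by auto
      with r k' \<open>k = 0\<close> show ?thesis by auto
    qed
    have v2: "p' $ 2 = p $ 2 \<and> Im (fst v') = s * t * Im (fst v)"
      by (rule half_centre[OF _ _ st' n(1) eqs'(2) b(2) b'(2)]) (use c[of 2] in auto)
    have v5: "p' $ 5 = p $ 5 \<and> Re (snd v') = t * Re (snd v)"
      by (rule half_centre[OF _ _ st(2) n(4) eqs'(5) b(3) b'(3)]) (use c[of 5] in auto)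
    have v6: "p' $ 6 = p $ 6 \<and> Im (snd v') = t * Im (snd v)"
      by (rule half_centre[OF _ _ st(2) n(5) eqs'(6) b(4) b'(4)]) (use c[of 6] in auto)
    have "p' = p" using v2 v5 v6 2 by (auto simp: vec_eq_iff forall_6 beta_centres_def)
    moreover have "T2 ab' = T2 ab" using eqs'(3,4) n * by (auto simp: T2_eq_iff)
    ultimately show ?thesis using veq[OF st(2)] * v2 v5 v6 by auto
  next
    case 3
    \<comment> \<open>Doubling clears the quarter shift: the left side is an integer, while the
      right side lies strictly between 0 and 1.\<close>
    have "2 * k + (1 - t) / 2 = 1 / 2 + 2 * Re (fst v') - 2 * (s * t * Re (fst v))"
      using eqs(1)[unfolded near_torus_alpha[OF 3(1)] near_torus_beta[OF 3(2)]]
        by (simp add: field_simps)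
    moreover have "2 * k + (1 - t) / 2 \<in> \<int>"
      using k st(2) by (intro Ints_add) auto
    moreover have "\<bar>s * t * Re (fst v)\<bar> = \<bar>Re (fst v)\<bar>"
    proof -
      have "s * t = 1 \<or> s * t = -1" using st' by auto
      then show ?thesis by (elim disjE) simp_all
    qed
    then have "\<bar>1 / 2 + 2 * Re (fst v') - 2 * (s * t * Re (fst v))\<bar> < 1"
      "1 / 2 + 2 * Re (fst v') - 2 * (s * t * Re (fst v)) \<noteq> 0"
      using b(1) b'(1) by arith+
    ultimately show ?thesis
      using Ints_small by metis
  next
    case 4
    have "2 * k + (1 - t) / 2 = 2 * Re (fst v') - 2 * (s * t * (1 / 4 + Re (fst v)))"
      using eqs(1)[unfolded near_torus_beta[OF 4(1)] near_torus_alpha[OF 4(2)]]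
        by (simp add: field_simps)
    moreover have "2 * k + (1 - t) / 2 \<in> \<int>"
      using k st(2) by (intro Ints_add) auto
    moreover have "\<bar>s * t * (1 / 4 + Re (fst v))\<bar> = \<bar>1 / 4 + Re (fst v)\<bar>"
    proof -
      have "s * t = 1 \<or> s * t = -1" using st' by auto
      then show ?thesis by (elim disjE) simp_all
    qed
    then have "\<bar>2 * Re (fst v') - 2 * (s * t * (1 / 4 + Re (fst v)))\<bar> < 1"
      "2 * Re (fst v') - 2 * (s * t * (1 / 4 + Re (fst v))) \<noteq> 0"
      using b(1) b'(1) by arith+
    ultimately show ?thesis
      using Ints_small by metis
  qed
qed

text \<open>The involution fixing the torus, followed by the translation by twice the centre in the
  normal coordinates, acts as -1 on the normal directions. That translation is integral because the
  centres are half-integral; for \<open>inv_beta\<close> the coordinate x_1 = 1/4 is already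
  fixed.\<close>

lemma near_torus_minus:
  assumes "p \<in> centres"
  shows "orb (near_torus p ab (- v)) = orb (near_torus p ab v)"
proof -
  have "orb_rel (near_torus p ab v) (near_torus p ab (- v))"
  proof (cases "p \<in> alpha_centres")
    case True
    have c: "2 * p $ 2 \<in> \<int>" "2 * p $ 3 \<in> \<int>" "2 * p $ 4 \<in> \<int>"
      by (rule half_Int, use True in \<open>simp add: alpha_centres_def\<close>)+
    have "crystal (vector [-1, -1, -1, -1, 1, 1]) (vector [0, p$2 + p$2, p$3 + p$3, p$4 + p$4, 0,
        0])"
      by (intro crystalI[of "-1" 1]) (simp_all add: c)
    moreover have "near_torus p ab (- v) = vector [-1, -1, -1, -1, 1, 1] * near_torus p ab v +
        vector [0, p$2 + p$2, p$3 + p$3, p$4 + p$4, 0, 0]"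
      by (simp add: vec_eq_iff forall_6 near_torus_alpha[OF True])
    ultimately show ?thesis unfolding orb_rel_def by blast
  next
    case False
    then have b: "p \<in> beta_centres" using assms by (auto simp: centres_def)
    have c: "2 * p $ 2 \<in> \<int>" "2 * p $ 5 \<in> \<int>" "2 * p $ 6 \<in> \<int>"
      by (rule half_Int, use b in \<open>simp add: beta_centres_def\<close>)+
    have "crystal (vector [-1, -1, 1, 1, -1, -1]) (vector [1/2, p$2 + p$2, 0, 0, p$5 + p$5, p$6 +
        p$6])"
      by (intro crystalI[of 1 "-1"]) (simp_all add: c)
    moreover have "near_torus p ab (- v) = vector [-1, -1, 1, 1, -1, -1] * near_torus p ab v +
        vector [1/2, p$2 + p$2, 0, 0, p$5 + p$5, p$6 + p$6]"
      by (simp add: vec_eq_iff forall_6 near_torus_beta[OF b])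
    ultimately show ?thesis unfolding orb_rel_def by blast
  qed
  then show ?thesis by (metis orb_eq_iff)
qed

lemma near_torus_T2:
  assumes "T2 ab = T2 ab'"
  shows "orb_rel (near_torus p ab v) (near_torus p ab' v)"
proof (rule orb_rel_translate)
  have "fst ab' - fst ab \<in> \<int>" "snd ab' - snd ab \<in> \<int>"
    using assms by (metis T2_eq_iff)+
  then show "near_torus p ab' v $ i - near_torus p ab v $ i \<in> \<int>" for i
    using exhaust_6[of i] by (auto simp: near_torus_eq pos_def mk_def)
qed

text \<open>Singularity of the kind of \<open>p\<close> would make every normal coordinate
  half-integral, hence every deviation from the centre zero. The other kind is excluded by the value
  of x_1.\<close>

lemma near_torus_nonsingular:
  assumes "p \<in> centres" "v \<noteq> 0" "norm v < 1/8"
  shows "\<not> singular (near_torus p ab v)"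
proof
  assume s: "singular (near_torus p ab v)"
  note b = norm_components[OF assms(3)]
  have h: "x = 0" if "2 * (q + x) \<in> \<int>" "q \<in> {0, 1/2}" "\<bar>x\<bar> < 1/8" for q x :: real
  proof -
    have "2 * (q + x) - 2 * q \<in> \<int>" using that half_Int by (intro Ints_diff)
    then have "2 * (q + x) - 2 * q = 0" using that(3) by (intro Ints_small) auto
    then show ?thesis by simp
  qed
  have nz: "Re (fst v) \<noteq> 0 \<or> Im (fst v) \<noteq> 0 \<or> Re (snd v) \<noteq> 0 \<or> Im (snd v) \<noteq> 0"
    using assms(2) by (auto simp: prod_eq_iff complex_eq_iff)
  show False
  proof (cases "p \<in> alpha_centres")
    case True
    have c: "\<And>i. i \<in> {2, 3, 4} \<Longrightarrow> p $ i \<in> {0, 1/2}" using True by (auto simp: alpha_centres_def)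
    have "\<bar>2 * Re (fst v) - 1 / 2\<bar> < 1" "2 * Re (fst v) - 1 / 2 \<noteq> 0" using b(1) by arith+
    then have "2 * Re (fst v) - 1 / 2 \<notin> \<int>" using Ints_small by blast
    with s have "2 * (0 + Re (fst v)) \<in> \<int>" "2 * (p $ 2 + Im (fst v)) \<in> \<int>"
      "2 * (p $ 3 + Re (snd v)) \<in> \<int>" "2 * (p $ 4 + Im (snd v)) \<in> \<int>"
      unfolding singular_iff near_torus_alpha[OF True] by simp_all
    from h[OF this(1) _ b(1)] h[OF this(2) _ b(2)] h[OF this(3) _ b(3)] h[OF this(4) _ b(4)] c nz
    show False by auto
  next
    case False
    then have p: "p \<in> beta_centres" using assms by (auto simp: centres_def)
    have c: "\<And>i. i \<in> {2, 5, 6} \<Longrightarrow> p $ i \<in> {0, 1/2}" using p by (auto simp: beta_centres_def)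
    have "\<bar>1 / 2 + 2 * Re (fst v)\<bar> < 1" "1 / 2 + 2 * Re (fst v) \<noteq> 0" using b(1) by arith+
    then have "1 / 2 + 2 * Re (fst v) \<notin> \<int>" using Ints_small by blast
    then have "2 * (1 / 4 + Re (fst v)) \<notin> \<int>" by simp
    with s have "2 * (0 + Re (fst v)) \<in> \<int>" "2 * (p $ 2 + Im (fst v)) \<in> \<int>"
      "2 * (p $ 5 + Re (snd v)) \<in> \<int>" "2 * (p $ 6 + Im (snd v)) \<in> \<int>"
      unfolding singular_iff near_torus_beta[OF p] by simp_all
    from h[OF this(1) _ b(1)] h[OF this(2) _ b(2)] h[OF this(3) _ b(3)] h[OF this(4) _ b(4)] c nz
    show False by auto
  qed
qed

lemma singular_near_torus_0: "p \<in> centres \<Longrightarrow> singular (near_torus p ab 0)"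
proof -
  assume "p \<in> centres"
  then consider "p \<in> alpha_centres" | "p \<in> beta_centres" by (auto simp: centres_def)
  then show ?thesis
    by cases (auto simp: singular_iff near_torus_alpha near_torus_beta,
        auto simp: alpha_centres_def beta_centres_def intro!: half_Int)
qed

lemma half_Ints_cases:
  assumes "2 * (x::real) \<in> \<int>"
  obtains q where "q \<in> {0, 1/2}" "x - q \<in> \<int>"
proof -
  obtain m :: int where m: "2 * x = of_int m" using assms by (auto elim: Ints_cases)
  show thesis
  proof (cases "even m")
    case True
    then obtain j where "m = 2 * j" by auto
    then have "x = of_int j" using m by simp
    then show ?thesis by (intro that[of 0]) auto
  next
    case False
    then obtain j where "m = 2 * j + 1" by (auto elim: oddE)
    then have "x - 1/2 = of_int j" using m by simp
    then show ?thesis by (intro that[of "1/2"]) auto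
  qed
qed

text \<open>The centres list only the tori at x_1 = 0 and x_1 = 1/4. A singular point with x_1 equal
  to 1/2 or 3/4 modulo 1 is first moved by the involution of the other kind, which exchanges the two
  families of tori.\<close>

lemma singular_near_torus:
  assumes "singular x"
  obtains p ab where "p \<in> centres" "orb_rel x (near_torus p ab 0)"
proof -
  have step: "\<exists>p\<in>centres. \<exists>ab. orb_rel x (near_torus p ab 0)"
    if x: "x $ 1 \<in> \<int>" "2 * x $ 2 \<in> \<int>" "2 * x $ 3 \<in> \<int>" "2 * x $ 4 \<in> \<int>" for x
  proof -
    obtain q2 where q2: "q2 \<in> {0, 1/2}" "x $ 2 - q2 \<in> \<int>" by (rule half_Ints_cases[OF x(2)])
    obtain q3 where q3: "q3 \<in> {0, 1/2}" "x $ 3 - q3 \<in> \<int>" by (rule half_Ints_cases[OF x(3)])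
    obtain q4 where q4: "q4 \<in> {0, 1/2}" "x $ 4 - q4 \<in> \<int>" by (rule half_Ints_cases[OF x(4)])
    note q = q2 q3 q4
    let ?p = "vector [0, q2, q3, q4, 0, 0] :: real ^ 6"
    have p: "?p \<in> alpha_centres" using q by (auto simp: alpha_centres_def)
    have "orb_rel (near_torus ?p (x $ 5, x $ 6) 0) x"
    proof (rule orb_rel_translate)
      have "\<forall>i. (x - near_torus ?p (x $ 5, x $ 6) 0) $ i \<in> \<int>"
        unfolding forall_6 using q x(1) by (simp add: near_torus_alpha[OF p])
      then show "x $ i - near_torus ?p (x $ 5, x $ 6) 0 $ i \<in> \<int>" for i by simp
    qed
    then show ?thesis using p orb_rel_sym unfolding centres_def by blast
  qed
  have step': "\<exists>p\<in>centres. \<exists>ab. orb_rel x (near_torus p ab 0)"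
    if x: "x $ 1 - 1/4 \<in> \<int>" "2 * x $ 2 \<in> \<int>" "2 * x $ 5 \<in> \<int>" "2 * x $ 6 \<in> \<int>" for x
  proof -
    obtain q2 where q2: "q2 \<in> {0, 1/2}" "x $ 2 - q2 \<in> \<int>" by (rule half_Ints_cases[OF x(2)])
    obtain q5 where q5: "q5 \<in> {0, 1/2}" "x $ 5 - q5 \<in> \<int>" by (rule half_Ints_cases[OF x(3)])
    obtain q6 where q6: "q6 \<in> {0, 1/2}" "x $ 6 - q6 \<in> \<int>" by (rule half_Ints_cases[OF x(4)])
    note q = q2 q5 q6
    let ?p = "vector [1/4, q2, 0, 0, q5, q6] :: real ^ 6"
    have p: "?p \<in> beta_centres" using q by (auto simp: beta_centres_def)
    have "orb_rel (near_torus ?p (x $ 3, x $ 4) 0) x"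
    proof (rule orb_rel_translate)
      have "\<forall>i. (x - near_torus ?p (x $ 3, x $ 4) 0) $ i \<in> \<int>"
        unfolding forall_6 using q x(1) by (simp add: near_torus_beta[OF p])
      then show "x $ i - near_torus ?p (x $ 3, x $ 4) 0 $ i \<in> \<int>" for i by simp
    qed
    then show ?thesis using p orb_rel_sym unfolding centres_def by blast
  qed
  have alpha: "crystal (vector [-1, -1, -1, -1, 1, 1]) 0"
    by (intro crystalI[of "-1" 1]) auto
  have beta: "crystal (vector [-1, -1, 1, 1, -1, -1]) (vector [1/2, 0, 0, 0, 0, 0])"
    by (intro crystalI[of 1 "-1"]) auto
  have "\<exists>p\<in>centres. \<exists>ab. orb_rel x (near_torus p ab 0)"
    using assms unfolding singular_iff
  proof (elim disjE conjE)
    assume *: "2 * x $ 1 \<in> \<int>" "2 * x $ 2 \<in> \<int>" "2 * x $ 3 \<in> \<int>" "2 * x $ 4 \<in> \<int>"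
    obtain q where q: "q \<in> {0, 1/2}" "x $ 1 - q \<in> \<int>" using half_Ints_cases[OF *(1)] .
    show ?thesis
    proof (cases "q = 0")
      case True
      with q * show ?thesis by (intro step) auto
    next
      case False
      let ?x = "vector [-1, -1, 1, 1, -1, -1] * x + vector [1/2, 0, 0, 0, 0, 0]"
      have "q = 1/2" using q False by auto
      then have "- (x $ 1 - 1/2) \<in> \<int>" using q(2) Ints_minus by blast
      then have "\<exists>p\<in>centres. \<exists>ab. orb_rel ?x (near_torus p ab 0)"
        using q * by (intro step) auto
      moreover have "orb_rel x ?x" using beta unfolding orb_rel_def by blast
      ultimately show ?thesis using orb_rel_trans by blast
    qed
  next
    assume *: "2 * x $ 1 - 1/2 \<in> \<int>" "2 * x $ 2 \<in> \<int>" "2 * x $ 5 \<in> \<int>" "2 * x $ 6 \<in> \<int>"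
    have "2 * (x $ 1 - 1/4) \<in> \<int>" using *(1) by simp
    then obtain q where q: "q \<in> {0, 1/2}" "x $ 1 - 1/4 - q \<in> \<int>" using half_Ints_cases by blast
    show ?thesis
    proof (cases "q = 0")
      case True
      with q * show ?thesis by (intro step') auto
    next
      case False
      let ?x = "vector [-1, -1, -1, -1, 1, 1] * x + 0"
      have "q = 1/2" using q False by auto
      have "x $ 1 - 1/4 - 1/2 \<in> \<int>" using q(2) unfolding \<open>q = 1/2\<close> .
      from Ints_minus[OF this] have "- (x $ 1 - 1/4 - 1/2) - 1 \<in> \<int>" by (rule Ints_diff) simp
      moreover have "- (x $ 1 - 1/4 - 1/2) - 1 = ?x $ 1 - 1/4" by simp
      ultimately have "?x $ 1 - 1/4 \<in> \<int>" by (simp only:)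
      then have "\<exists>p\<in>centres. \<exists>ab. orb_rel ?x (near_torus p ab 0)"
        using * by (intro step') auto
      moreover have "orb_rel x ?x" using alpha unfolding orb_rel_def by blast
      ultimately show ?thesis using orb_rel_trans by blast
    qed
  qed
  then show ?thesis using that by blast
qed

section \<open>The Eguchi--Hanson space in coordinates\<close>

text \<open>A vector on the line of slope \<open>u\<close> whose distinguished coordinate is
  \<open>s\<close>. The chart coordinate of the blow-up is the square of \<open>s\<close>, so
  \<open>s\<close> and \<open>- s\<close> describe the same point.\<close>

definition eh_vec :: "bool \<Rightarrow> complex \<Rightarrow> complex \<Rightarrow> complex \<times> complex" where
  "eh_vec b s u = (if b then (s, s * u) else (s * u, s))"

definition eh_chart :: "bool \<Rightarrow> complex \<times> complex \<Rightarrow> eh_point" where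
  "eh_chart b = (if b then eh_chart0 else eh_chart1)"

lemma eh_vec_minus: "eh_vec b (- s) u = - eh_vec b s u"
  by (simp add: eh_vec_def)

lemma eh_vec_eq_0: "eh_vec b s u = 0 \<longleftrightarrow> s = 0"
  by (auto simp: eh_vec_def zero_prod_def)

lemma eh_vec_0 [simp]: "eh_vec b 0 u = 0"
  by (simp add: eh_vec_eq_0)

text \<open>Expressed by the square of \<open>s\<close> alone, the norm condition on a tube involves
  no root.\<close>

lemma norm_eh_vec: "(norm (eh_vec b s u))\<^sup>2 = cmod (s\<^sup>2) * (1 + (cmod u)\<^sup>2)"
  by (simp add: eh_vec_def norm_Pair norm_mult norm_power power_mult_distrib algebra_simps)

lemma eh_vec_flip: "u \<noteq> 0 \<Longrightarrow> eh_vec (\<not> b) (s * u) (1 / u) = eh_vec b s u"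
  by (simp add: eh_vec_def)

lemma eh_vec_surj:
  assumes "(if b then fst v else snd v) \<noteq> 0"
  shows "eh_vec b (if b then fst v else snd v) (if b then snd v / fst v else fst v / snd v) = v"
  using assms by (cases b) (auto simp: eh_vec_def prod_eq_iff)

lemma pm_eq_iff: "pm v = pm v' \<longleftrightarrow> v' = v \<or> v' = - v"
  by (auto simp: pm_def doubleton_eq_iff)

lemma csqrt_cases: "s\<^sup>2 = z \<Longrightarrow> csqrt z = s \<or> csqrt z = - s"
  by (metis power2_csqrt power2_eq_iff)

text \<open>Any square root of \<open>z\<close> may stand in for \<open>csqrt z\<close>, the sign
  being lost in \<open>pm\<close>. This freedom makes local holomorphic branches usable.\<close>

lemma eh_chart_eq:
  assumes "s\<^sup>2 = z"
  shows "eh_chart b (z, u) = (pm (eh_vec b s u), cline (eh_vec b 1 u))"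
proof -
  have "pm (eh_vec b (csqrt z) u) = pm (eh_vec b s u)"
    using csqrt_cases[OF assms] by (auto simp: pm_eq_iff eh_vec_minus)
  then show ?thesis
    by (auto simp: eh_chart_def eh_chart0_def eh_chart1_def eh_vec_def)
qed

lemma cline_eh_vec:
  assumes "s \<noteq> 0"
  shows "cline (eh_vec b s u) = cline (eh_vec b 1 u)"
proof -
  have "range (\<lambda>c. (c * fst (eh_vec b s u), c * snd (eh_vec b s u))) =
      (\<lambda>c. (c * fst (eh_vec b 1 u), c * snd (eh_vec b 1 u))) ` range (\<lambda>c. c * s)"
    by (simp add: image_image eh_vec_def mult.assoc)
  moreover have "range (\<lambda>c. c * s) = UNIV"
    using assms by (intro surjI[of _ "\<lambda>c. c / s"]) simp
  ultimately show ?thesis by (simp add: cline_def)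
qed

lemma cline_eq_imp:
  assumes "cline v = cline v'"
  obtains c where "v = (c * fst v', c * snd v')"
proof -
  have "v \<in> cline v" by (auto simp: cline_def image_iff intro!: exI[of _ 1])
  then show thesis using assms that by (auto simp: cline_def)
qed

lemma cline_eq_iff:
  "cline (eh_vec b 1 u) = cline (eh_vec b' 1 u') \<longleftrightarrow> (if b = b' then u = u' else u * u' = 1)"
proof
  assume "cline (eh_vec b 1 u) = cline (eh_vec b' 1 u')"
  then obtain c where "eh_vec b 1 u = (c * fst (eh_vec b' 1 u'), c * snd (eh_vec b' 1 u'))"
    by (rule cline_eq_imp)
  then show "if b = b' then u = u' else u * u' = 1"
    by (auto simp: eh_vec_def split: if_splits)
next
  assume *: "if b = b' then u = u' else u * u' = 1"
  show "cline (eh_vec b 1 u) = cline (eh_vec b' 1 u')"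
  proof (cases "b = b'")
    case False
    then have "u * u' = 1" "b' = (\<not> b)" using * by auto
    moreover from this have "u \<noteq> 0" by auto
    ultimately have "u \<noteq> 0" "u' = 1 / u" "b' = (\<not> b)"
      by (auto simp: nonzero_eq_divide_eq mult.commute)
    then show ?thesis
      using eh_vec_flip[of u b 1] cline_eh_vec[of u b' u'] by simp
  qed (use * in simp)
qed

text \<open>For different charts this is the transition rule of the line bundle O(-2) over the
  projective line, whose total space is the blow-up of the cone.\<close>

lemma eh_chart_eq_iff:
  "eh_chart b (z, u) = eh_chart b' (z', u') \<longleftrightarrow>
     (if b = b' then z = z' \<and> u = u' else u * u' = 1 \<and> z' = z * u\<^sup>2)"
proof -
  let ?s = "csqrt z" and ?s' = "csqrt z'"
  have *: "eh_chart b (z, u) = (pm (eh_vec b ?s u), cline (eh_vec b 1 u))"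
    "eh_chart b' (z', u') = (pm (eh_vec b' ?s' u'), cline (eh_vec b' 1 u'))"
    by (simp_all add: eh_chart_eq)
  show ?thesis
  proof (cases "b = b'")
    case True
    have "eh_vec b ?s' u = eh_vec b ?s u \<or> eh_vec b ?s' u = - eh_vec b ?s u \<longleftrightarrow> z = z'"
    proof -
      have "eh_vec b ?s' u = eh_vec b ?s u \<or> eh_vec b ?s' u = - eh_vec b ?s u \<longleftrightarrow> ?s' = ?s \<or> ?s' = -
          ?s"
        by (auto simp: eh_vec_def)
      also have "\<dots> \<longleftrightarrow> ?s'\<^sup>2 = ?s\<^sup>2" by (rule power2_eq_iff[symmetric])
      finally show ?thesis by auto
    qed
    then show ?thesis
      using True unfolding * by (auto simp: cline_eq_iff pm_eq_iff)
  next
    case False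
    have "eh_vec b' ?s' u' = eh_vec b ?s u \<or> eh_vec b' ?s' u' = - eh_vec b ?s u \<longleftrightarrow> z' = z * u\<^sup>2"
      if "u * u' = 1"
    proof -
      have "u \<noteq> 0" using that by auto
      then have u: "u \<noteq> 0" "u' = 1 / u" "b' = (\<not> b)"
        using that False by (auto simp: nonzero_eq_divide_eq mult.commute)
      have "eh_vec b' ?s' u' = eh_vec b' (?s * u) u' \<or> eh_vec b' ?s' u' = - eh_vec b' (?s * u) u' \<longleftrightarrow>
          ?s' = ?s * u \<or> ?s' = - (?s * u)"
        by (auto simp: eh_vec_def)
      also have "\<dots> \<longleftrightarrow> ?s'\<^sup>2 = (?s * u)\<^sup>2" by (rule power2_eq_iff[symmetric])
      finally show ?thesis
        using eh_vec_flip[OF u(1), of b ?s] u by (simp add: power_mult_distrib)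
    qed
    then show ?thesis
      using False unfolding * by (auto simp: cline_eq_iff pm_eq_iff)
  qed
qed

section \<open>The parametrizations of the resolved manifold\<close>

type_synonym pindex = "((real ^ 6) \<times> bool) option"

definition pindices :: "pindex set" where
  "pindices = insert None (Some ` (centres \<times> UNIV))"

definition par :: "pindex \<Rightarrow> real ^ 6 \<Rightarrow> m_point" where
  "par i y = (case i of None \<Rightarrow> Regular (orb y) | Some (p, b) \<Rightarrow> glue p (y_T2 y) (eh_chart b (y_C2
      y)))"

text \<open>By \<open>norm_eh_vec\<close> the inequality bounds the norm of the corresponding vector
  by \<epsilon>. Written without roots it is visibly an open condition, also where
  \<open>zeta y\<close> vanishes.\<close>

definition pdom :: "real \<Rightarrow> pindex \<Rightarrow> (real ^ 6) set" where
  "pdom \<epsilon> i = (case i of None \<Rightarrow> {x. \<not> singular x} |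
     Some _ \<Rightarrow> {y. cmod (zeta y) * (1 + (cmod (slope y))\<^sup>2) < \<epsilon>\<^sup>2})"

lemma mk_nth: "mk ab z w $ 1 = fst ab" "mk ab z w $ 2 = snd ab"
  by (simp_all add: mk_def)

lemma smooth_on_nth: "open S \<Longrightarrow> smooth_on S f \<Longrightarrow> smooth_on S (\<lambda>x. f x $ i)"
  for f :: "'a::real_normed_vector \<Rightarrow> real ^ 'n"
  by (rule smooth_on_linear_compose[OF _ bounded_linear_vec_nth])

lemma smooth_on_zeta: "open S \<Longrightarrow> smooth_on S f \<Longrightarrow> smooth_on S (\<lambda>x. zeta (f x))"
  and smooth_on_slope: "open S \<Longrightarrow> smooth_on S f \<Longrightarrow> smooth_on S (\<lambda>x. slope (f x))"
  unfolding zeta_def slope_def by (intro smooth_on_Complex smooth_on_nth; assumption)+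

lemma smooth_on_mk:
  assumes "open S" "smooth_on S a" "smooth_on S b" "smooth_on S z" "smooth_on S w"
  shows "smooth_on S (\<lambda>x. mk (a x, b x) (z x) (w x))"
proof (rule smooth_on_vec[OF assms(1)])
  have "smooth_on S (\<lambda>x. Re (z x))" "smooth_on S (\<lambda>x. Im (z x))"
    "smooth_on S (\<lambda>x. Re (w x))" "smooth_on S (\<lambda>x. Im (w x))"
    using assms by (auto intro: smooth_on_linear_compose bounded_linear_Re bounded_linear_Im)
  then show "smooth_on S (\<lambda>x. mk (a x, b x) (z x) (w x) $ i)" for i
    using exhaust_6[of i] assms by (elim disjE) (simp_all add: mk_def)
qed

lemma smooth_on_affine: "open S \<Longrightarrow> smooth_on S (\<lambda>w :: real ^ 6. e * w + n)"
  by (rule smooth_on_vec) (simp_all, intro smooth_on_add smooth_on_mult smooth_on_nth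
      smooth_on_const smooth_on_id)

lemma continuous_on_zeta: "continuous_on S zeta" and continuous_on_slope: "continuous_on S slope"
  using smooth_on_continuous[OF smooth_on_zeta[OF open_UNIV smooth_on_id]]
    smooth_on_continuous[OF smooth_on_slope[OF open_UNIV smooth_on_id]]
  by (auto intro: continuous_on_subset)

lemma open_pdom: "open (pdom \<epsilon> i)"
proof (cases i)
  case None
  then show ?thesis by (simp add: pdom_def open_nonsingular)
next
  case (Some a)
  then show ?thesis
    by (auto simp: pdom_def intro!: open_Collect_less continuous_intros continuous_on_zeta
        continuous_on_slope)
qed

text \<open>Dividing by \<open>z0\<close> moves the base point to 1. The half-plane where z / z0 has
  positive real part avoids the cut of \<open>csqrt\<close>, and the factor \<open>s0\<close>
  selects the branch.\<close>

lemma local_sqrt: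
  assumes "s0\<^sup>2 = z0" "z0 \<noteq> 0"
  obtains Z s where "open Z" "z0 \<in> Z" "s holomorphic_on Z" "s z0 = s0"
    "\<And>z. z \<in> Z \<Longrightarrow> (s z)\<^sup>2 = z \<and> z \<noteq> 0"
proof (rule that[of "{z. 0 < Re (z / z0)}" "\<lambda>z. s0 * csqrt (z / z0)"])
  show "open {z. 0 < Re (z / z0)}"
    using assms(2) by (intro open_Collect_less continuous_intros) auto
  show "z0 \<in> {z. 0 < Re (z / z0)}" "s0 * csqrt (z0 / z0) = s0" using assms(2) by auto
  have "z / z0 \<notin> \<real>\<^sub>\<le>\<^sub>0" if "z \<in> {z. 0 < Re (z / z0)}" for z
    using that by (auto simp: complex_nonpos_Reals_iff)
  then show "(\<lambda>z. s0 * csqrt (z / z0)) holomorphic_on {z. 0 < Re (z / z0)}"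
    using assms(2) by (intro holomorphic_intros) auto
  show "(s0 * csqrt (z / z0))\<^sup>2 = z \<and> z \<noteq> 0" if "z \<in> {z. 0 < Re (z / z0)}" for z
    using that assms by (auto simp: power_mult_distrib)
qed

lemma blow_down_eh_chart: "s\<^sup>2 = z \<Longrightarrow> blow_down (eh_chart b (z, u)) = {eh_vec b s u, - eh_vec b s u}"
  by (simp add: blow_down_def eh_chart_eq pm_def)

text \<open>The choice made in \<open>glue\<close> yields one of two opposite vectors, and
  \<open>near_torus_minus\<close> makes the orbit independent of which.\<close>

lemma par_regular:
  assumes "p \<in> centres" "s\<^sup>2 = zeta y" "zeta y \<noteq> 0"
  shows "par (Some (p, b)) y = Regular (orb (near_torus p (y_T2 y) (eh_vec b s (slope y))))"
proof -
  let ?v = "eh_vec b s (slope y)"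
  have bd: "blow_down (eh_chart b (y_C2 y)) = {?v, - ?v}"
    unfolding y_C2_eq by (rule blow_down_eh_chart[OF assms(2)])
  have "s \<noteq> 0" using assms by auto
  then have "?v \<noteq> 0" by (simp add: eh_vec_eq_0)
  have "(SOME v. v \<in> {?v, - ?v}) \<in> {?v, - ?v}"
    by (rule someI[of _ ?v]) simp
  then have "orb (near_torus p (y_T2 y) (SOME v. v \<in> {?v, - ?v})) = orb (near_torus p (y_T2 y) ?v)"
    using near_torus_minus[OF assms(1), of "y_T2 y" ?v] by (elim insertE emptyE) simp_all
  with \<open>?v \<noteq> 0\<close> show ?thesis
    by (simp add: par_def glue_def bd doubleton_eq_iff)
qed

lemma par_exceptional:
  assumes "zeta y = 0"
  shows "par (Some (p, b)) y = Exceptional p (T2 (y_T2 y)) (eh_chart b (0, slope y))"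
  using blow_down_eh_chart[of 0 0 b "slope y"] assms by (simp add: par_def glue_def y_C2_eq)

lemma glue_T2:
  assumes "T2 ab = T2 ab'"
  shows "glue p ab x = glue p ab' x"
proof -
  have "orb (near_torus p ab v) = orb (near_torus p ab' v)" for v
    using near_torus_T2[OF assms] by (simp add: orb_eq_iff)
  then show ?thesis using assms by (simp add: glue_def)
qed

lemma par_Some_eq:
  assumes "T2 (y_T2 y) = T2 (y_T2 y')" "eh_chart b (zeta y, slope y) = eh_chart b' (zeta y', slope
      y')"
  shows "par (Some (p, b)) y = par (Some (p, b')) y'"
  using glue_T2[OF assms(1)] assms(2) by (simp add: par_def y_C2_eq)

text \<open>Lifts of \<open>inv_alpha\<close> and \<open>inv_beta\<close> fix only singular points.
  Lifts of their product send x_1 to x_1 + k + 1/2 and fix nothing.\<close>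

lemma crystal_fixed:
  assumes "crystal e n" "e * x + n = x"
  shows "e = 1 \<or> singular x"
proof -
  obtain s t k where st: "s \<in> {1, - 1}" "t \<in> {1, - 1}"
    "e $ 1 = s * t" "e $ 2 = s * t" "e $ 3 = s" "e $ 4 = s" "e $ 5 = t" "e $ 6 = t"
    and k: "k \<in> \<int>" "n $ 1 = k + (1 - t) / 4"
    and n: "n $ 2 \<in> \<int>" "n $ 3 \<in> \<int>" "n $ 4 \<in> \<int>" "n $ 5 \<in> \<int>" "n $ 6 \<in> \<int>"
    using assms(1) by (rule crystalE)
  have eqs: "x $ 1 = s * t * x $ 1 + (k + (1 - t) / 4)" "x $ 2 = s * t * x $ 2 + n $ 2"
    "x $ 3 = s * x $ 3 + n $ 3" "x $ 4 = s * x $ 4 + n $ 4"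
    "x $ 5 = t * x $ 5 + n $ 5" "x $ 6 = t * x $ 6 + n $ 6"
    using arg_cong[OF assms(2), of "\<lambda>y. y $ 1"] arg_cong[OF assms(2), of "\<lambda>y. y $ 2"]
      arg_cong[OF assms(2), of "\<lambda>y. y $ 3"] arg_cong[OF assms(2), of "\<lambda>y. y $ 4"]
      arg_cong[OF assms(2), of "\<lambda>y. y $ 5"] arg_cong[OF assms(2), of "\<lambda>y. y $ 6"] st k by auto
  consider "s = 1" "t = 1" | "s = -1" "t = 1" | "s = 1" "t = -1" | "s = -1" "t = -1" using st
    by auto
  then show ?thesis
  proof cases
    case 1
    then show ?thesis using st by (auto simp: vec_eq_iff forall_6)
  next
    case 2
    then have "2 * x $ 1 = k" "2 * x $ 2 = n $ 2" "2 * x $ 3 = n $ 3" "2 * x $ 4 = n $ 4" using eqs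
      by auto
    then show ?thesis using k n by (simp add: singular_iff)
  next
    case 3
    then have "2 * x $ 1 - 1 / 2 = k" "2 * x $ 2 = n $ 2" "2 * x $ 5 = n $ 5" "2 * x $ 6 = n $ 6"
        using eqs by auto
    then show ?thesis using k n by (simp add: singular_iff)
  next
    case 4
    then have "k = - (1 / 2)" using eqs(1) by auto
    then show ?thesis using Ints_small[OF k(1)] by simp
  qed
qed

text \<open>A group element relating two points near \<open>x\<close> is an isometry, so it moves
  \<open>x\<close> by less than \<open>r\<close>. By discreteness it fixes \<open>x\<close>, and at
  a nonsingular point only the identity does.\<close>

lemma orb_locally_injective:
  assumes "\<not> singular x"
  obtains r where "0 < r" "inj_on orb (ball x r)"
proof -
  obtain r where r: "0 < r" "\<And>z. orb_rel x z \<Longrightarrow> dist z x < r \<Longrightarrow> z = x"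
    by (rule orb_rel_gap[of x x]) blast
  show thesis
  proof (rule that[of "min (r / 2) (1 / 2)"])
    show "inj_on orb (ball x (min (r / 2) (1 / 2)))"
    proof (rule inj_onI)
      fix y y' assume y: "y \<in> ball x (min (r / 2) (1 / 2))" "y' \<in> ball x (min (r / 2) (1 / 2))"
          "orb y = orb y'"
      then obtain e n where en: "crystal e n" "y' = e * y + n"
        by (auto simp: orb_eq_iff orb_rel_def)
      have "dist (e * x + n) x \<le> dist (e * x + n) y' + dist y' x" by (rule dist_triangle)
      also have "\<dots> = dist x y + dist x y'"
        unfolding en(2) crystal_dist[OF en(1)] by (simp add: dist_commute)
      also have "\<dots> < r" using y by simp
      finally have "e * x + n = x" using en by (intro r(2)) (auto simp: orb_rel_def)
      moreover from this have "e = 1" using crystal_fixed[OF en(1)] assms by blast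
      ultimately show "y = y'" using en by simp
    qed
  qed (use r in auto)
qed

section \<open>Transition maps between the parametrizations\<close>

locale resolution =
  fixes eps :: real
  assumes eps: "0 < eps" "eps \<le> 1/8"
begin

abbreviation "P i \<equiv> pdom eps i"

lemma norm_eh_vec_less:
  assumes "s\<^sup>2 = zeta y"
  shows "norm (eh_vec b s (slope y)) < eps \<longleftrightarrow> y \<in> P (Some q)"
proof -
  have "norm (eh_vec b s (slope y)) < eps \<longleftrightarrow> (norm (eh_vec b s (slope y)))\<^sup>2 < eps\<^sup>2"
    using power_strict_mono[of "norm (eh_vec b s (slope y))" eps 2]
      power2_less_imp_less[of "norm (eh_vec b s (slope y))" eps] eps(1) by auto
  then show ?thesis
    unfolding norm_eh_vec assms by (simp add: pdom_def)
qed

text \<open>The transition axiom of \<open>etale\<close> at a given pair of points, named so that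
  transitions between tube charts can be composed through the orbifold chart.\<close>

definition lifts :: "pindex \<Rightarrow> real ^ 6 \<Rightarrow> pindex \<Rightarrow> real ^ 6 \<Rightarrow> bool" where
  "lifts i x j y \<longleftrightarrow> (\<exists>W h. open W \<and> x \<in> W \<and> W \<subseteq> P i \<and> smooth_on W h \<and> h x = y \<and> h ` W \<subseteq> P j \<and>
     (\<forall>w\<in>W. par j (h w) = par i w))"

lemma liftsI:
  assumes "open V" "x \<in> V" "V \<subseteq> P i" "smooth_on V h" "h x = y" "y \<in> P j"
    "\<And>w. w \<in> V \<Longrightarrow> par j (h w) = par i w"
  shows "lifts i x j y"
proof -
  have "open (V \<inter> h -` P j)"
    using assms(1,4) by (auto intro: continuous_open_preimage smooth_on_continuous open_pdom)
  moreover have "smooth_on (V \<inter> h -` P j) h"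
    using assms(4) by (rule smooth_on_subset) auto
  ultimately show ?thesis
    unfolding lifts_def using assms by (intro exI[of _ "V \<inter> h -` P j"] exI[of _ h]) auto
qed

lemma lifts_trans:
  assumes "lifts i x j y" "lifts j y k z"
  shows "lifts i x k z"
proof -
  obtain W h where W: "open W" "x \<in> W" "W \<subseteq> P i" "smooth_on W h" "h x = y" "h ` W \<subseteq> P j"
      "\<forall>w\<in>W. par j (h w) = par i w"
    using assms(1) by (auto simp: lifts_def)
  obtain W' h' where W': "open W'" "y \<in> W'" "W' \<subseteq> P j" "smooth_on W' h'" "h' y = z" "h' ` W' \<subseteq> P k"
      "\<forall>w\<in>W'. par k (h' w) = par j w"
    using assms(2) by (auto simp: lifts_def)
  have V: "open (W \<inter> h -` W')"
    using W W' by (auto intro: continuous_open_preimage smooth_on_continuous)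
  have sm: "smooth_on (W \<inter> h -` W') h"
    using W(4) by (rule smooth_on_subset) auto
  show ?thesis
  proof (rule liftsI[OF V])
    show "smooth_on (W \<inter> h -` W') (\<lambda>w. h' (h w))"
      by (rule smooth_on_compose[OF V W'(1) _ sm W'(4)]) auto
  qed (use W W' in auto)
qed

text \<open>A branch of the square root of \<open>zeta\<close> through the prescribed value
  \<open>s0\<close> turns chart coordinates into a vector of C^2 and hence into a point of R^6 near
  the torus. The bound 1/8 on \<open>eps\<close> ensures that this point is nonsingular.\<close>

lemma regular_lift:
  assumes p: "p \<in> centres" and y: "y \<in> P (Some (p, b))" "zeta y \<noteq> 0" and s0: "s0\<^sup>2 = zeta y"
  obtains W k where "open W" "y \<in> W" "W \<subseteq> P (Some (p, b))" "smooth_on W k"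
    "k y = near_torus p (y_T2 y) (eh_vec b s0 (slope y))"
    "\<And>w. w \<in> W \<Longrightarrow> zeta w \<noteq> 0 \<and> k w \<in> P None \<and> par None (k w) = par (Some (p, b)) w"
proof -
  obtain Z s where Z: "open Z" "zeta y \<in> Z" "s holomorphic_on Z" "s (zeta y) = s0"
      "\<And>z. z \<in> Z \<Longrightarrow> (s z)\<^sup>2 = z \<and> z \<noteq> 0"
    using local_sqrt[OF s0 y(2)] by metis
  define W where "W = P (Some (p, b)) \<inter> zeta -` Z"
  define k where "k = (\<lambda>w. near_torus p (y_T2 w) (eh_vec b (s (zeta w)) (slope w)))"
  have W: "open W"
    unfolding W_def by (rule continuous_open_preimage[OF continuous_on_zeta open_pdom Z(1)])
  note [simp] = W
  have sz: "smooth_on W zeta" "smooth_on W slope"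
    using smooth_on_zeta[OF W smooth_on_id] smooth_on_slope[OF W smooth_on_id] by auto
  have ss: "smooth_on W (\<lambda>w. s (zeta w))"
    by (rule smooth_on_holomorphic_compose[OF W Z(1) _ sz(1) Z(3)]) (auto simp: W_def)
  have sv: "smooth_on W (\<lambda>w. fst (eh_vec b (s (zeta w)) (slope w)))"
    "smooth_on W (\<lambda>w. snd (eh_vec b (s (zeta w)) (slope w)))"
    using ss smooth_on_mult[OF W ss sz(2)] by (cases b; simp add: eh_vec_def)+
  have "smooth_on W (\<lambda>w. p + pos (p \<in> alpha_centres) (mk (w $ 1, w $ 2)
      (fst (eh_vec b (s (zeta w)) (slope w))) (snd (eh_vec b (s (zeta w)) (slope w)))))"
    by (intro smooth_on_add[OF W] smooth_on_const smooth_on_linear_compose[OF W bounded_linear_pos]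
        smooth_on_mk[OF W] sv smooth_on_nth[OF W] smooth_on_id)
  then have k: "smooth_on W k" by (simp add: k_def near_torus_eq y_T2_def)
  show thesis
  proof (rule that[OF W _ _ k])
    show "y \<in> W" "W \<subseteq> P (Some (p, b))" using y Z by (auto simp: W_def)
    show "k y = near_torus p (y_T2 y) (eh_vec b s0 (slope y))" by (simp add: k_def Z(4))
    fix w assume "w \<in> W"
    then have w: "w \<in> P (Some (p, b))" "(s (zeta w))\<^sup>2 = zeta w" "zeta w \<noteq> 0"
      using Z(5) by (auto simp: W_def)
    have "norm (eh_vec b (s (zeta w)) (slope w)) < 1/8"
      using norm_eh_vec_less[OF w(2), of b] w(1) eps(2) by fastforce
    moreover have "eh_vec b (s (zeta w)) (slope w) \<noteq> 0"
      using w by (auto simp: eh_vec_eq_0)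
    ultimately have "\<not> singular (k w)"
      unfolding k_def using near_torus_nonsingular[OF p] by blast
    then show "zeta w \<noteq> 0 \<and> k w \<in> P None \<and> par None (k w) = par (Some (p, b)) w"
      using par_regular[OF p w(2,3)] w(3) by (simp add: pdom_def k_def par_def)
  qed
qed

lemma lifts_RR:
  assumes "x \<in> P None" "y \<in> P None" "par None x = par None y"
  shows "lifts None x None y"
proof -
  obtain e n where en: "crystal e n" "y = e * x + n"
    using assms(3) by (auto simp: par_def orb_eq_iff orb_rel_def)
  show ?thesis
  proof (rule liftsI[OF open_pdom assms(1) order_refl smooth_on_affine[OF open_pdom]])
    show "e * x + n = y" "y \<in> P None" using en assms by auto
    fix w
    have "orb_rel w (e * w + n)" using en by (auto simp: orb_rel_def)
    then show "par None (e * w + n) = par None w" by (metis par_def orb_eq_iff option.simps(4))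
  qed
qed

lemma par_Some_regular_iff:
  assumes "p \<in> centres"
  shows "(\<exists>o'. par (Some (p, b)) y = Regular o') \<longleftrightarrow> zeta y \<noteq> 0"
  using par_regular[OF assms power2_csqrt] par_exceptional[of y p b] by (cases "zeta y = 0") auto

lemma lifts_GR:
  assumes "p \<in> centres" "y \<in> P (Some (p, b))" "x \<in> P None" "par (Some (p, b)) y = par None x"
  shows "lifts (Some (p, b)) y None x"
proof -
  have z: "zeta y \<noteq> 0"
    using par_Some_regular_iff[OF assms(1), of b y] assms(4) by (simp add: par_def)
  obtain W k where W: "open W" "y \<in> W" "W \<subseteq> P (Some (p, b))" "smooth_on W k"
    "k y = near_torus p (y_T2 y) (eh_vec b (csqrt (zeta y)) (slope y))"
    "\<And>w. w \<in> W \<Longrightarrow> zeta w \<noteq> 0 \<and> k w \<in> P None \<and> par None (k w) = par (Some (p, b)) w"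
    using regular_lift[OF assms(1,2) z power2_csqrt] by metis
  have "lifts (Some (p, b)) y None (k y)"
    by (rule liftsI[OF W(1-4)]) (use W(2,6) in auto)
  moreover have "lifts None (k y) None x"
    using W(2,6) assms(3,4) by (intro lifts_RR) auto
  ultimately show ?thesis by (rule lifts_trans)
qed

text \<open>In this direction no root has to be taken: a vector with distinguished coordinate r and
  other coordinate r' has chart coordinates r^2 and r' / r. The group element that takes
  \<open>x\<close> to the vector determined by \<open>y\<close> is kept for all nearby
  points.\<close>

lemma lifts_RG:
  assumes p: "p \<in> centres" and y: "y \<in> P (Some (p, b))" and x: "x \<in> P None"
    and xy: "par None x = par (Some (p, b)) y"
  shows "lifts None x (Some (p, b)) y"
proof -
  have z: "zeta y \<noteq> 0"
    using par_Some_regular_iff[OF p, of b y] xy[symmetric] by (simp add: par_def)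
  define s0 where "s0 = csqrt (zeta y)"
  define v0 where "v0 = eh_vec b s0 (slope y)"
  have s0: "s0\<^sup>2 = zeta y" "s0 \<noteq> 0" using z by (auto simp: s0_def)
  let ?k = "p \<in> alpha_centres"
  obtain e n where en: "crystal e n" "near_torus p (y_T2 y) v0 = e * x + n"
    using xy unfolding par_regular[OF p s0(1) z] v0_def
    by (auto simp: par_def orb_eq_iff orb_rel_def)
  define q where "q = (\<lambda>w. unpos ?k (e * w + n + - p))"
  \<comment> \<open>The torus and normal coordinates of the moved point are read off by undoing the
    coordinate permutation around \<open>p\<close>.\<close>
  have q: "near_torus p (y_T2 (q w)) (zeta (q w), slope (q w)) = e * w + n" for w
    using mk_cases[of "q w"] by (simp add: near_torus_eq q_def)
  have qx: "q x = mk (y_T2 y) (fst v0) (snd v0)"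
    unfolding q_def en(2)[symmetric] near_torus_eq by simp
  define r where "r = (\<lambda>w. if b then zeta (q w) else slope (q w))"
  define r' where "r' = (\<lambda>w. if b then slope (q w) else zeta (q w))"
  define h where "h = (\<lambda>w. mk (y_T2 (q w)) ((r w)\<^sup>2) (r' w * inverse (r w)))"
  have sq: "smooth_on S q" if "open S" for S
    unfolding q_def
    by (intro smooth_on_linear_compose[OF that bounded_linear_unpos] smooth_on_add that
        smooth_on_const smooth_on_affine)
  have sr: "smooth_on S r" "smooth_on S r'" if "open S" for S
    unfolding r_def r'_def using smooth_on_zeta[OF that sq[OF that]] smooth_on_slope[OF that sq[OF
        that]]
    by (cases b; simp)+
  define V where "V = P None \<inter> r -` (- {0})"
  have V: "open V"
    unfolding V_def
      by (rule continuous_open_preimage[OF smooth_on_continuous[OF sr(1)[OF open_pdom]] open_pdom]) auto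
  have sinv: "smooth_on V (\<lambda>w. inverse (r w))"
    by (rule smooth_on_holomorphic_compose[of V "- {0}"])
       (use V sr in \<open>auto simp: V_def intro!: holomorphic_intros\<close>)
  have "smooth_on V (\<lambda>w. mk (q w $ 1, q w $ 2) (r w * r w) (r' w * inverse (r w)))"
    by (intro smooth_on_mk smooth_on_mult sinv sr smooth_on_nth sq V)
  then have h: "smooth_on V h" by (simp add: h_def y_T2_def power2_eq_square)
  have rx: "r x = s0" "r' x = s0 * slope y" using qx by (auto simp: r_def r'_def v0_def eh_vec_def)
  show ?thesis
  proof (rule liftsI[OF V _ _ h _ y])
    show "x \<in> V" "V \<subseteq> P None" using x rx s0 by (auto simp: V_def)
    show "h x = y"
      using rx s0 qx by (intro mk_eqI) (auto simp: h_def)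
    fix w assume w: "w \<in> V"
    then have r0: "r w \<noteq> 0" by (simp add: V_def)
    have "eh_vec b (r w) (slope (h w)) = (zeta (q w), slope (q w))"
      using eh_vec_surj[of b "(zeta (q w), slope (q w))"] r0
      by (cases b) (auto simp: h_def r_def r'_def divide_inverse)
    then have "par (Some (p, b)) (h w) = Regular (orb (e * w + n))"
      using par_regular[OF p, of "r w" "h w" b] q[of w] r0 by (simp add: h_def)
    moreover have "orb_rel w (e * w + n)" using en by (auto simp: orb_rel_def)
    ultimately show "par (Some (p, b)) (h w) = par None w"
      by (metis par_def orb_eq_iff option.simps(4))
  qed
qed

text \<open>An exceptional point has no preimage in the orbifold chart, so the transition cannot be
  factored through it. Both charts then belong to the same torus, and \<open>h\<close> combines the
  transition of the blow-up charts with a lattice translation of the torus coordinates.\<close>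

lemma lifts_GG_exceptional:
  assumes p: "p \<in> centres" "p' \<in> centres" and y: "y \<in> P (Some (p, b))" "y' \<in> P (Some (p', b'))"
      and z: "zeta y = 0"
    and eq: "par (Some (p, b)) y = par (Some (p', b')) y'"
  shows "lifts (Some (p, b)) y (Some (p', b')) y'"
proof -
  have z': "zeta y' = 0"
    using par_Some_regular_iff[OF p(1), of b y] par_Some_regular_iff[OF p(2), of b' y'] z eq by simp
  have *: "p' = p" "T2 (y_T2 y) = T2 (y_T2 y')" "eh_chart b (0, slope y) = eh_chart b' (0, slope
      y')"
    using eq by (auto simp: par_exceptional z z')
  have sl: "if b = b' then slope y = slope y' else slope y * slope y' = 1"
    using *(3) by (auto simp: eh_chart_eq_iff split: if_splits)
  \<comment> \<open>Both points have the same image in the torus, so this vector is integral and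
    adding it is invisible in M.\<close>
  define d where "d = (fst (y_T2 y') - fst (y_T2 y), snd (y_T2 y') - snd (y_T2 y))"
  define h where "h = (\<lambda>w. mk (w $ 1 + fst d, w $ 2 + snd d)
      (if b = b' then zeta w else zeta w * (slope w * slope w)) (if b = b' then slope w else
          inverse (slope w)))"
  define V where "V = P (Some (p, b)) \<inter> slope -` (if b = b' then UNIV else - {0})"
  have V: "open V"
    unfolding V_def by (rule continuous_open_preimage[OF continuous_on_slope open_pdom]) auto
  have sz: "smooth_on V zeta" "smooth_on V slope"
    using smooth_on_zeta[OF V smooth_on_id] smooth_on_slope[OF V smooth_on_id] by auto
  have sinv: "smooth_on V (\<lambda>w. inverse (slope w))" if "b \<noteq> b'"
    by (rule smooth_on_holomorphic_compose[of V "- {0}"])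
       (use V sz that in \<open>auto simp: V_def intro!: holomorphic_intros\<close>)
  have "smooth_on V (\<lambda>w. if b = b' then zeta w else zeta w * (slope w * slope w))"
    using sz smooth_on_mult[OF V sz(1) smooth_on_mult[OF V sz(2,2)]] by (cases "b = b'") simp_all
  moreover have "smooth_on V (\<lambda>w. if b = b' then slope w else inverse (slope w))"
    using sz sinv by (cases "b = b'") simp_all
  ultimately have h: "smooth_on V h"
    unfolding h_def
      by (intro smooth_on_mk smooth_on_add smooth_on_nth smooth_on_const smooth_on_id V)
  show ?thesis
  proof (rule liftsI[OF V _ _ h _ y(2)])
    show "y \<in> V" "V \<subseteq> P (Some (p, b))" using y sl by (auto simp: V_def split: if_splits)
    have "inverse (slope y) = slope y'" if "b \<noteq> b'"
      using sl that by (intro inverse_unique) auto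
    then show "h y = y'"
      using z z' sl by (intro mk_eqI) (auto simp: h_def d_def y_T2_def mk_nth)
    fix w assume w: "w \<in> V"
    have "T2 (y_T2 w) = T2 (y_T2 (h w))"
      using *(2) by (simp add: T2_eq_iff h_def d_def y_T2_def mk_nth)
    moreover have "eh_chart b (zeta w, slope w) = eh_chart b' (zeta (h w), slope (h w))"
      using w by (auto simp: eh_chart_eq_iff h_def V_def power2_eq_square split: if_splits)
    ultimately show "par (Some (p', b')) (h w) = par (Some (p, b)) w"
      unfolding *(1) by (rule par_Some_eq[symmetric])
  qed
qed

lemma lifts_par:
  assumes "i \<in> pindices" "j \<in> pindices" "x \<in> P i" "y \<in> P j" "par i x = par j y"
  shows "lifts i x j y"
proof (cases i)
  case None
  then show ?thesis
    using assms lifts_RR lifts_RG by (cases j) (auto simp: pindices_def)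
next
  case (Some a)
  then obtain p b where i: "i = Some (p, b)" "p \<in> centres" using assms(1)
    by (auto simp: pindices_def)
  show ?thesis
  proof (cases j)
    case None
    then show ?thesis using assms i lifts_GR by auto
  next
    case (Some a')
    then obtain p' b' where j: "j = Some (p', b')" "p' \<in> centres" using assms(2)
      by (auto simp: pindices_def)
    show ?thesis
    proof (cases "zeta x = 0")
      case True
      then show ?thesis using assms i j lifts_GG_exceptional by auto
    next
      case False
      obtain W k where W: "x \<in> W"
        "\<And>w. w \<in> W \<Longrightarrow> zeta w \<noteq> 0 \<and> k w \<in> P None \<and> par None (k w) = par (Some (p, b)) w"
        using regular_lift[OF i(2) _ False power2_csqrt, of b] assms(3) i(1) by metis
      then have kx: "k x \<in> P None" "par None (k x) = par i x" using i by auto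
      show ?thesis
        unfolding i(1) j(1)
      proof (rule lifts_trans)
        show "lifts (Some (p, b)) x None (k x)"
          using kx assms i by (intro lifts_GR) auto
        show "lifts None (k x) (Some (p', b')) y"
          using kx assms j by (intro lifts_RG) auto
      qed
    qed
  qed
qed

text \<open>Off the exceptional set \<open>near_torus_inj\<close> recovers the normal vector up to
  sign, and the line in the blow-up is spanned by it. On the exceptional set all the data are part
  of the point itself.\<close>

lemma par_Some_inj:
  assumes p: "p \<in> centres" "p' \<in> centres" and y: "y \<in> P (Some (p, b))" "y' \<in> P (Some (p', b'))"
    and eq: "par (Some (p, b)) y = par (Some (p', b')) y'"
  shows "p' = p \<and> T2 (y_T2 y') = T2 (y_T2 y) \<and>
     eh_chart b' (zeta y', slope y') = eh_chart b (zeta y, slope y)"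
proof (cases "zeta y = 0")
  case True
  then have z': "zeta y' = 0"
    using par_Some_regular_iff[OF p(1), of b y] par_Some_regular_iff[OF p(2), of b' y'] eq by simp
  show ?thesis using eq by (auto simp: par_exceptional True z')
next
  case False
  then have z': "zeta y' \<noteq> 0"
    using par_Some_regular_iff[OF p(1), of b y] par_Some_regular_iff[OF p(2), of b' y'] eq by simp
  let ?s = "csqrt (zeta y)" and ?s' = "csqrt (zeta y')"
  let ?v = "eh_vec b ?s (slope y)" and ?v' = "eh_vec b' ?s' (slope y')"
  have "norm ?v < 1/8" "norm ?v' < 1/8"
    using norm_eh_vec_less[OF power2_csqrt, of b y] norm_eh_vec_less[OF power2_csqrt, of b' y'] y
        eps(2)
    by fastforce+
  then have *: "p' = p" "T2 (y_T2 y') = T2 (y_T2 y)" "?v' = ?v \<or> ?v' = - ?v"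
    using near_torus_inj[OF p, of ?v ?v' "y_T2 y" "y_T2 y'"] eq
    unfolding par_regular[OF p(1) power2_csqrt False] par_regular[OF p(2) power2_csqrt z']
    by (auto simp: orb_eq_iff)
  have s: "?s \<noteq> 0" "?s' \<noteq> 0" using False z' by auto
  have "cline ?v' = cline ?v"
  proof -
    have "cline (- ?v) = cline ?v"
      using cline_eh_vec[of "- ?s" b "slope y"] cline_eh_vec[of ?s b "slope y"] s
        by (simp add: eh_vec_minus)
    then show ?thesis using *(3) by metis
  qed
  moreover have "pm ?v = pm ?v'" using *(3) pm_eq_iff by blast
  ultimately have "eh_chart b' (zeta y', slope y') = eh_chart b (zeta y, slope y)"
    using cline_eh_vec[OF s(1), of b "slope y"] cline_eh_vec[OF s(2), of b' "slope y'"]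
    unfolding eh_chart_eq[OF power2_csqrt] by metis
  with * show ?thesis by simp
qed

sublocale M: etale pindices "pdom eps" par
proof
  fix i x assume i: "i \<in> pindices" and x: "x \<in> P i"
  show "\<exists>S. open S \<and> x \<in> S \<and> S \<subseteq> P i \<and> inj_on (par i) S"
  proof (cases i)
    case None
    then obtain r where r: "0 < r" "inj_on orb (ball x r)"
      using x orb_locally_injective[of x] by (auto simp: pdom_def)
    then have "inj_on (par i) (ball x r \<inter> P i)"
      using None by (auto simp: inj_on_def par_def)
    with r x show ?thesis by (intro exI[of _ "ball x r \<inter> P i"]) (auto intro: open_pdom)
  next
    case (Some a)
    then obtain p b where i: "i = Some (p, b)" "p \<in> centres" using i by (auto simp: pindices_def)
    \<comment> \<open>Torus coordinates of two points of a ball of radius 1/2 differ by less than 1,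
      so an integral difference vanishes.\<close>
    have "inj_on (par i) (ball x (1/2) \<inter> P i)"
    proof (rule inj_onI)
      fix y y' assume y: "y \<in> ball x (1/2) \<inter> P i" "y' \<in> ball x (1/2) \<inter> P i" "par i y = par i y'"
      then have eq: "T2 (y_T2 y') = T2 (y_T2 y)" "zeta y' = zeta y" "slope y' = slope y"
        using par_Some_inj[OF i(2,2), of y b y' b] i(1) by (auto simp: eh_chart_eq_iff)
      have "dist y' y < 1" using y dist_triangle[of y' y x] by (simp add: dist_commute)
      then have "\<bar>y' $ j - y $ j\<bar> < 1" for j
        using component_le_norm_cart[of "y' - y" j] by (simp add: dist_norm)
      then have "y_T2 y' = y_T2 y"
        using eq(1) Ints_small[of "y' $ 1 - y $ 1"] Ints_small[of "y' $ 2 - y $ 2"]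
        by (simp add: T2_eq_iff y_T2_def)
      with eq show "y = y'" by (intro mk_eqI) auto
    qed
    then show ?thesis using x by (intro exI[of _ "ball x (1/2) \<inter> P i"]) (auto intro: open_pdom)
  qed
next
  fix i j x y assume "i \<in> pindices" "j \<in> pindices" "x \<in> P i" "y \<in> P j" "par i x = par j y"
  then show "\<exists>W h. open W \<and> x \<in> W \<and> W \<subseteq> P i \<and> smooth_on W h \<and> h x = y \<and> h ` W \<subseteq> P j \<and>
      (\<forall>w\<in>W. par j (h w) = par i w)"
    using lifts_par by (simp add: lifts_def)
qed (rule open_pdom)

text \<open>The definition of the charts asks for injectivity into the torus times the blow-up, the
  etale atlas for injectivity into M. The two agree because, by \<open>par_Some_inj\<close>, gluing
  a tube of radius \<open>eps\<close> into M identifies no further points.\<close>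

lemma resolved_M_eq: "resolved_M eps = M.A"
proof -
  have reg: "regular_charts = {(S, par None) | S. open S \<and> S \<subseteq> P None \<and> inj_on (par None) S}"
  proof -
    have "par None = (\<lambda>x. Regular (orb x))" by (simp add: par_def fun_eq_iff)
    moreover have "inj_on (\<lambda>x. Regular (orb x)) S \<longleftrightarrow> inj_on orb S" for S
      by (auto simp: inj_on_def)
    moreover have "S \<subseteq> P None \<longleftrightarrow> (\<forall>x\<in>S. \<not> singular x)" for S by (auto simp: pdom_def)
    ultimately show ?thesis by (simp add: regular_charts_def)
  qed
  have dom: "S \<subseteq> P (Some (p, b)) \<longleftrightarrow> (\<forall>y\<in>S. \<forall>v\<in>blow_down (eh_chart b (y_C2 y)). norm v < eps)" for S
      p b
  proof -
    have "(\<forall>v\<in>blow_down (eh_chart b (y_C2 y)). norm v < eps) \<longleftrightarrow> y \<in> P (Some (p, b))" for y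
      unfolding y_C2_eq blow_down_eh_chart[OF power2_csqrt]
      using norm_eh_vec_less[OF power2_csqrt, of b y "(p, b)"] by simp
    then show ?thesis by auto
  qed
  have inj: "inj_on (\<lambda>y. (T2 (y_T2 y), eh_chart b (y_C2 y))) S \<longleftrightarrow> inj_on (par (Some (p, b))) S"
    if p: "p \<in> centres" and S: "S \<subseteq> P (Some (p, b))" for S p b
  proof -
    have "(T2 (y_T2 y), eh_chart b (y_C2 y)) = (T2 (y_T2 y'), eh_chart b (y_C2 y')) \<longleftrightarrow>
        par (Some (p, b)) y = par (Some (p, b)) y'" if "y \<in> S" "y' \<in> S" for y y'
    proof -
      have "y \<in> P (Some (p, b))" "y' \<in> P (Some (p, b))" using S that by auto
      then show ?thesis
        using par_Some_inj[OF p p, of y b y' b] par_Some_eq[of y y' b b p] by (auto simp: y_C2_eq)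
    qed
    then show ?thesis unfolding inj_on_def by blast
  qed
  have res: "resolution_charts eps = {(S, par (Some (p, b))) | S p b. p \<in> centres \<and> open S \<and>
      S \<subseteq> P (Some (p, b)) \<and> inj_on (par (Some (p, b))) S}" (is "_ = ?R")
  proof
    show "resolution_charts eps \<subseteq> ?R"
    proof
      fix x assume "x \<in> resolution_charts eps"
      then obtain S p c where x: "x = (S, \<lambda>y. glue p (y_T2 y) (c (y_C2 y)))" "p \<in> centres"
          "c \<in> {eh_chart0, eh_chart1}" "open S" "inj_on (\<lambda>y. (T2 (y_T2 y), c (y_C2 y))) S"
          "\<forall>y\<in>S. \<forall>v\<in>blow_down (c (y_C2 y)). norm v < eps"
        by (auto simp: resolution_charts_def centres_def)
      obtain b where c: "c = eh_chart b" using x(3) by (metis eh_chart_def insertE singletonD)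
      have S: "S \<subseteq> P (Some (p, b))" using x(6) c dom[of S p b] by simp
      have "x = (S, par (Some (p, b)))" using x(1) c by (simp add: par_def fun_eq_iff)
      then show "x \<in> ?R"
        using x(2,4,5) S inj[OF x(2) S] c by blast
    qed
    show "?R \<subseteq> resolution_charts eps"
    proof
      fix x assume "x \<in> ?R"
      then obtain S p b where x: "x = (S, par (Some (p, b)))" "p \<in> centres" "open S"
          "S \<subseteq> P (Some (p, b))" "inj_on (par (Some (p, b))) S" by blast
      moreover have "par (Some (p, b)) = (\<lambda>y. glue p (y_T2 y) (eh_chart b (y_C2 y)))"
        by (simp add: par_def fun_eq_iff)
      moreover have "eh_chart b \<in> {eh_chart0, eh_chart1}" by (simp add: eh_chart_def)
      ultimately show "x \<in> resolution_charts eps"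
        unfolding resolution_charts_def using dom[of S p b] inj[OF x(2,4)]
        by (auto simp: centres_def)
    qed
  qed
  have "M.A = {(S, par None) | S. open S \<and> S \<subseteq> P None \<and> inj_on (par None) S} \<union>
      {(S, par (Some (p, b))) | S p b. p \<in> centres \<and> open S \<and>
      S \<subseteq> P (Some (p, b)) \<and> inj_on (par (Some (p, b))) S}"
    unfolding etale_atlas_def pindices_def by blast
  then show ?thesis by (simp add: resolved_M_def reg res)
qed

end

section \<open>The resolved manifold is closed\<close>

text \<open>The blow-down of a point to the orbifold, recorded as an orbit in R^6, so that open sets
  and functions on R^6 can be pulled back to M.\<close>

definition base_points :: "m_point \<Rightarrow> (real ^ 6) set" where
  "base_points m = (case m of Regular q \<Rightarrow> {x. orb x = q} |
     Exceptional p t e \<Rightarrow> {x. \<exists>ab. T2 ab = t \<and> orb_rel (near_torus p ab 0) x})"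

lemma base_points_None: "base_points (par None x) = {z. orb_rel x z}"
  using orb_rel_sym by (auto simp: base_points_def par_def orb_eq_iff)

lemma base_points_exceptional:
  assumes "zeta y = 0"
  shows "base_points (par (Some (p, b)) y) = {z. orb_rel (near_torus p (y_T2 y) 0) z}"
proof -
  have "(\<exists>ab. T2 ab = T2 (y_T2 y) \<and> orb_rel (near_torus p ab 0) x) \<longleftrightarrow> orb_rel (near_torus p (y_T2
      y) 0) x" for x
    using near_torus_T2[of _ _ p 0] orb_rel_trans by metis
  then show ?thesis by (simp add: par_exceptional[OF assms] base_points_def)
qed

lemma isCont_near_torus:
  assumes "isCont a y" "isCont v y"
  shows "isCont (\<lambda>w. near_torus p (a w) (v w)) y"
proof -
  have "linear (\<lambda>(ab, z, w). mk ab z w)"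
    by (rule linearI) (auto simp: mk_def vec_eq_iff forall_6)
  then have bl: "bounded_linear (\<lambda>(ab, z, w). mk ab z w)"
    by (simp only: linear_conv_bounded_linear)
  have "isCont (\<lambda>w. (a w, fst (v w), snd (v w))) y"
    using assms by (intro continuous_Pair continuous_fst continuous_snd)
  from bounded_linear.isCont[OF bounded_linear_pos bounded_linear.isCont[OF bl this]]
  have "isCont (\<lambda>w. p + pos (p \<in> alpha_centres) (mk (a w) (fst (v w)) (snd (v w)))) y"
    by (intro continuous_add continuous_const) (simp add: case_prod_beta)
  then show ?thesis by (simp add: near_torus_eq)
qed

text \<open>The principal root jumps across its cut, but its modulus is the root of the modulus and
  tends to 0 at the origin.\<close>

lemma isCont_csqrt_0: "isCont csqrt 0"
proof -
  have "isCont (\<lambda>z::complex. sqrt (norm z)) 0"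
    by (intro continuous_intros)
  then have "((\<lambda>z. norm (csqrt z)) \<longlongrightarrow> 0) (at 0)" by (simp add: isCont_def)
  then have "(csqrt \<longlongrightarrow> 0) (at 0)" by (rule tendsto_norm_zero_cancel)
  then show ?thesis by (simp add: isCont_def)
qed

text \<open>Normal coordinates relative to the torus through \<open>p\<close>, extended affinely to
  the whole of R^6 so that distance conditions on them define closed sets.\<close>

definition tube :: "real ^ 6 \<Rightarrow> real ^ 6 \<Rightarrow> complex \<times> complex" where
  "tube p x = (let q = unpos (p \<in> alpha_centres) (x + - p) in (zeta q, slope q))"

lemma near_torus_tube: "near_torus p (y_T2 (unpos (p \<in> alpha_centres) (x + - p))) (tube p x) = x"
  using mk_cases[of "unpos (p \<in> alpha_centres) (x + - p)"]
    by (simp add: near_torus_eq tube_def Let_def)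

lemma tube_near_torus: "tube p (near_torus p ab v) = v"
  by (simp add: near_torus_eq tube_def)

lemma continuous_on_tube: "continuous_on S (tube p)"
proof -
  have "smooth_on UNIV (\<lambda>x. unpos (p \<in> alpha_centres) (x + - p))"
    by (intro smooth_on_linear_compose[OF _ bounded_linear_unpos] smooth_on_add) auto
  then have "continuous_on UNIV (\<lambda>x. (zeta (unpos (p \<in> alpha_centres) (x + - p)), slope (unpos (p
      \<in> alpha_centres) (x + - p))))"
    by (intro continuous_on_Pair smooth_on_continuous smooth_on_zeta smooth_on_slope) auto
  then show ?thesis
    unfolding tube_def Let_def by (rule continuous_on_subset) simp
qed

lemma crystal_translate_into_cube:
  obtains n where "crystal 1 n" "x + n \<in> cbox 0 1"
proof (rule that[of "- (\<chi> i. of_int \<lfloor>x $ i\<rfloor>)"])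
  show "crystal 1 (- (\<chi> i. of_int \<lfloor>x $ i\<rfloor>))"
    by (rule crystal_translation) (simp add: Ints_minus_iff)
  show "x + - (\<chi> i. of_int \<lfloor>x $ i\<rfloor>) \<in> cbox 0 1"
    by (auto simp: mem_box_cart) linarith
qed

section \<open>The blow-down map, separation and compactness\<close>

context resolution
begin

lemma carrier_cases:
  assumes "m \<in> carrier_of M.A"
  obtains (regular) x where "x \<in> P None" "m = par None x"
  | (exceptional) p b y where "p \<in> centres" "y \<in> P (Some (p, b))" "zeta y = 0" "m = par (Some (p,
      b)) y"
proof -
  obtain i x where ix: "i \<in> pindices" "x \<in> P i" "m = par i x"
    using assms by (auto simp: M.carrier)
  show thesis
  proof (cases i)
    case None
    then show ?thesis using ix regular by auto
  next
    case (Some a)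
    then obtain p b where i: "i = Some (p, b)" "p \<in> centres" using ix by (auto simp: pindices_def)
    show ?thesis
    proof (cases "zeta x = 0")
      case True
      then show ?thesis using ix i exceptional by auto
    next
      case False
      obtain W k where W: "x \<in> W"
        "\<And>w. w \<in> W \<Longrightarrow> zeta w \<noteq> 0 \<and> k w \<in> P None \<and> par None (k w) = par (Some (p, b)) w"
        using regular_lift[OF i(2) _ False power2_csqrt, of b] ix i by metis
      then show ?thesis using regular[of "k x"] ix i by auto
    qed
  qed
qed

lemma par_in_carrier: "i \<in> pindices \<Longrightarrow> x \<in> P i \<Longrightarrow> par i x \<in> carrier_of M.A"
  by (auto simp: M.carrier)

lemma None_pindices: "None \<in> pindices" and Some_pindices: "p \<in> centres \<Longrightarrow> Some (p, b) \<in> pindices"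
  by (auto simp: pindices_def)

lemma base_points_orbit:
  assumes "m \<in> carrier_of M.A"
  obtains x where "base_points m = {z. orb_rel x z}"
  using assms by (cases rule: carrier_cases) (auto simp: base_points_None base_points_exceptional)

text \<open>This is continuity of the blow-down in terms of preimages. At a regular point a group
  element gives a continuous choice of base point; at an exceptional point the base point depends on
  a root of \<open>zeta\<close>.\<close>

lemma openin_base_points:
  assumes B: "open B"
  shows "openin (atlas_topology M.A) {m \<in> carrier_of M.A. base_points m \<inter> B \<noteq> {}}" (is "openin _
      ?W")
proof (rule M.openin_local)
  fix m assume m: "m \<in> ?W"
  then have "m \<in> carrier_of M.A" by simp
  then show "\<exists>i x N. i \<in> pindices \<and> x \<in> P i \<and> par i x = m \<and> open N \<and> x \<in> N \<and> (\<forall>w\<in>N \<inter> P i. par i w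
      \<in> ?W)"
  proof (cases rule: carrier_cases)
    case (regular x)
    then obtain e n where en: "crystal e n" "e * x + n \<in> B"
      using m by (auto simp: base_points_None orb_rel_def)
    have "open ((\<lambda>w. e * w + n) -` B)"
      using continuous_open_preimage[OF smooth_on_continuous[OF smooth_on_affine[OF open_UNIV]]
          open_UNIV B]
      by simp
    moreover have "par None w \<in> ?W" if "e * w + n \<in> B" "w \<in> P None" for w
    proof -
      have "e * w + n \<in> base_points (par None w)" using en
        by (auto simp: base_points_None orb_rel_def)
      then show ?thesis using that par_in_carrier None_pindices by blast
    qed
    ultimately show ?thesis
      using regular en None_pindices
      by (intro exI[of _ None] exI[of _ x] exI[of _ "(\<lambda>w. e * w + n) -` B"]) auto
  next
    case (exceptional p b y)
    then obtain e n where en: "crystal e n" "e * near_torus p (y_T2 y) 0 + n \<in> B"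
      using m by (auto simp: base_points_exceptional orb_rel_def)
    \<comment> \<open>The root in \<open>f\<close> is discontinuous in general, but
      \<open>zeta\<close> vanishes at \<open>y\<close>, where it is continuous. Continuity at this
      single point is all that \<open>openin_local\<close> asks for.\<close>
    define f where "f = (\<lambda>w. near_torus p (y_T2 w) (eh_vec b (csqrt (zeta w)) (slope w)))"
    have "isCont (\<lambda>w. (w $ 1, w $ 2)) y"
      by (intro continuous_intros)
    moreover have "y_T2 = (\<lambda>w. (w $ 1, w $ 2))" by (simp add: fun_eq_iff y_T2_def)
    ultimately have c: "isCont zeta y" "isCont slope y" "isCont y_T2 y"
      using continuous_on_zeta[of UNIV] continuous_on_slope[of UNIV]
      by (simp_all add: continuous_on_eq_continuous_at)
    have "isCont (\<lambda>w. csqrt (zeta w)) y"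
      by (rule continuous_at_compose[OF c(1), of csqrt, unfolded comp_def]) (simp add: exceptional
          isCont_csqrt_0)
    then have "isCont (\<lambda>w. eh_vec b (csqrt (zeta w)) (slope w)) y"
      using c by (cases b) (auto simp: eh_vec_def intro!: continuous_intros)
    then have f: "isCont f y"
      unfolding f_def by (intro isCont_near_torus c)
    have "isCont (\<lambda>x. e * x + n) (f y)"
      using smooth_on_continuous[OF smooth_on_affine[OF open_UNIV]]
        by (simp add: continuous_on_eq_continuous_at)
    then have "isCont (\<lambda>w. e * f w + n) y"
      using continuous_at_compose[OF f, of "\<lambda>x. e * x + n"] by (simp add: comp_def)
    moreover have "e * f y + n \<in> B" using en exceptional by (simp add: f_def)
    ultimately obtain N where N: "open N" "y \<in> N" "\<forall>w\<in>N. e * f w + n \<in> B"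
      using B by (auto simp: continuous_at_open)
    have "par (Some (p, b)) w \<in> ?W" if w: "w \<in> N \<inter> P (Some (p, b))" for w
    proof -
      have "base_points (par (Some (p, b)) w) = {z. orb_rel (f w) z}"
      proof (cases "zeta w = 0")
        case True
        then show ?thesis by (simp add: base_points_exceptional f_def)
      next
        case False
        then show ?thesis
          using par_regular[OF exceptional(1) power2_csqrt False, of b] base_points_None[of "f w"]
          by (simp add: f_def par_def)
      qed
      moreover have "orb_rel (f w) (e * f w + n)" using en by (auto simp: orb_rel_def)
      ultimately show ?thesis
        using N w exceptional par_in_carrier Some_pindices by auto
    qed
    then show ?thesis
      using exceptional N Some_pindices
        by (intro exI[of _ "Some (p, b)"] exI[of _ y] exI[of _ N]) auto
  qed
qed

text \<open>Points over different orbits are separated by pulling back balls of half the gap between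
  the orbits, whose saturations are disjoint because the group acts by isometries. Distinct points
  over the same orbit lie over one point of a singular torus and are separated by their
  lines.\<close>

lemma Hausdorff: "Hausdorff_space (atlas_topology M.A)"
  unfolding Hausdorff_space_def M.topspace
proof (intro allI impI, elim conjE)
  fix m m' assume m: "m \<in> carrier_of M.A" "m' \<in> carrier_of M.A" "m \<noteq> m'"
  let ?T = "atlas_topology M.A"
  obtain x where x: "base_points m = {z. orb_rel x z}" using base_points_orbit[OF m(1)] .
  obtain x' where x': "base_points m' = {z. orb_rel x' z}" using base_points_orbit[OF m(2)] .
  show "\<exists>U V. openin ?T U \<and> openin ?T V \<and> m \<in> U \<and> m' \<in> V \<and> disjnt U V"
  proof (cases "orb_rel x x'")
    case False
    obtain r where r: "0 < r" "\<And>z. orb_rel x' z \<Longrightarrow> dist z x < r \<Longrightarrow> z = x"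
      by (rule orb_rel_gap[of x' x]) blast
    let ?U = "\<lambda>x. {m \<in> carrier_of M.A. base_points m \<inter> ball x (r / 2) \<noteq> {}}"
    have "m'' \<notin> ?U x'" if m'': "m'' \<in> ?U x" for m''
    proof
      assume m''2: "m'' \<in> ?U x'"
      obtain z0 where z0: "base_points m'' = {z. orb_rel z0 z}" using base_points_orbit m'' by blast
      obtain y y' where y: "orb_rel z0 y" "dist x y < r / 2" "orb_rel z0 y'" "dist x' y' < r / 2"
        using m'' m''2 z0 by auto
      have "orb_rel y' y" by (rule orb_rel_trans[OF orb_rel_sym[OF y(3)] y(1)])
      then obtain e n where en: "crystal e n" "y = e * y' + n"
        by (auto simp: orb_rel_def)
      have "dist (e * x' + n) x \<le> dist (e * x' + n) y + dist y x" by (rule dist_triangle)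
      also have "\<dots> < r" using y unfolding en(2) crystal_dist[OF en(1)] by (simp add: dist_commute)
      finally have "e * x' + n = x" using en by (intro r(2)) (auto simp: orb_rel_def)
      then have "orb_rel x' x" using en by (auto simp: orb_rel_def)
      then show False using False orb_rel_sym by blast
    qed
    moreover have "m \<in> ?U x" "m' \<in> ?U x'"
      using m x x' orb_rel_refl r(1) by (auto intro: exI[of _ x] exI[of _ x'] simp: disjoint_iff)
    ultimately show ?thesis
      using openin_base_points by (intro exI[of _ "?U x"] exI[of _ "?U x'"]) (auto simp: disjnt_iff)
  next
    case True
    then have base: "base_points m = base_points m'"
      using x x' orb_rel_trans orb_rel_sym by blast
    \<comment> \<open>Exceptional points lie over singular orbits and regular points over
      nonsingular ones, where the orbit determines the point. Two distinct points with the same base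
      are therefore both exceptional.\<close>
    have sing: "(\<forall>z\<in>base_points m. singular z) \<and> base_points m \<noteq> {} \<or> (\<exists>x. m = par None x)"
      if "m \<in> carrier_of M.A" for m
      using that
    proof (cases rule: carrier_cases)
      case (exceptional p b y)
      then have "near_torus p (y_T2 y) 0 \<in> base_points m"
        using orb_rel_refl by (simp add: base_points_exceptional)
      moreover have "\<forall>z\<in>base_points m. singular z"
      proof
        fix z assume "z \<in> base_points m"
        then have "orb_rel (near_torus p (y_T2 y) 0) z" using exceptional
          by (simp add: base_points_exceptional)
        then show "singular z" using singular_near_torus_0[OF exceptional(1)] singular_orb_rel
          by blast
      qed
      ultimately show ?thesis by blast
    qed auto
    have regular: "m1 = m2" if r: "m1 \<in> carrier_of M.A" "m2 \<in> carrier_of M.A" "base_points m1 =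
        base_points m2"
        "x \<in> P None" "m1 = par None x" for m1 m2 x
    proof -
      have "x \<in> base_points m2" using r orb_rel_refl base_points_None by blast
      then obtain x2 where "m2 = par None x2"
        using sing[OF r(2)] r(4) by (auto simp: pdom_def)
      moreover from this have "orb_rel x x2"
        using \<open>x \<in> base_points m2\<close> orb_rel_sym by (auto simp: base_points_None)
      ultimately show ?thesis using r(5) by (simp add: par_def orb_eq_iff)
    qed
    obtain p b y where y: "p \<in> centres" "y \<in> P (Some (p, b))" "zeta y = 0" "m = par (Some (p, b)) y"
      using m(1) by (cases rule: carrier_cases) (use regular[OF m(1,2) base] m(3) in auto)
    obtain p' b' y' where y': "p' \<in> centres" "y' \<in> P (Some (p', b'))" "zeta y' = 0" "m' = par
        (Some (p', b')) y'"
      using m(2) by (cases rule: carrier_cases) (use regular[OF m(2,1) base[symmetric]] m(3) in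
          auto)
    have "orb_rel (near_torus p (y_T2 y) 0) (near_torus p' (y_T2 y') 0)"
      using base y y' orb_rel_refl by (auto simp: base_points_exceptional)
    then have p: "p' = p" and T: "T2 (y_T2 y') = T2 (y_T2 y)"
      using near_torus_inj[OF y(1) y'(1), of 0 0] by auto
    \<comment> \<open>By \<open>cline_eq_iff\<close> these are the pairs of slopes of distinct
      lines; a product neighbourhood inside this open set yields the disjoint
      neighbourhoods.\<close>
    define Q where "Q = {q. \<not> (if b = b' then fst q = snd q else fst q * snd q = (1::complex))}"
    have "(slope y, slope y') \<in> Q"
      using m(3) y y' T by (auto simp: Q_def p par_exceptional eh_chart_eq_iff split: if_splits)
    moreover have "open Q"
    proof (cases "b = b'")
      case True
      have "open {p :: complex \<times> complex. fst p \<noteq> snd p}"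
        by (intro open_Collect_neq continuous_intros)
      then show ?thesis using True by (simp add: Q_def)
    next
      case False
      have "open {p :: complex \<times> complex. fst p * snd p \<noteq> 1}"
        by (intro open_Collect_neq continuous_intros)
      then show ?thesis using False by (simp add: Q_def)
    qed
    ultimately obtain A B where AB: "open A" "open B" "slope y \<in> A" "slope y' \<in> B" "A \<times> B \<subseteq> Q"
      by (auto elim!: open_prod_elim)
    let ?U = "\<lambda>b A. par (Some (p, b)) ` (P (Some (p, b)) \<inter> slope -` A)"
    have op: "openin ?T (?U b A)" if "open A" for b A
      by (rule M.open_image[OF Some_pindices[OF y(1)]])
         (auto intro: continuous_open_preimage[OF continuous_on_slope open_pdom that])
    have "disjnt (?U b A) (?U b' B)"
      unfolding disjnt_iff
    proof (intro allI notI, elim conjE imageE)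
      fix m0 w w' assume w: "m0 = par (Some (p, b)) w" "w \<in> P (Some (p, b)) \<inter> slope -` A"
        "m0 = par (Some (p, b')) w'" "w' \<in> P (Some (p, b')) \<inter> slope -` B"
      then have "eh_chart b' (zeta w', slope w') = eh_chart b (zeta w, slope w)"
        using par_Some_inj[OF y(1) y(1), of w b w' b'] by auto
      then have "(slope w, slope w') \<notin> Q"
        by (auto simp: Q_def eh_chart_eq_iff mult.commute split: if_splits)
      then show False using w AB by auto
    qed
    then show ?thesis
      using op AB y y' p by (intro exI[of _ "?U b A"] exI[of _ "?U b' B"]) auto
  qed
qed

text \<open>A fundamental cube of the lattice with the open tubes of radius \<open>eps / 2\<close>
  around all lifts of the singular tori removed. Removing the tubes for every group element makes
  the set an intersection of closed sets that avoids every singular point.\<close>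

definition compact_regular :: "(real ^ 6) set" where
  "compact_regular = cbox 0 1 \<inter>
     (\<Inter>(p, e, n) \<in> {(p, e, n). p \<in> centres \<and> crystal e n}. {x. eps / 2 \<le> norm (tube p (e * x +
         n))})"

text \<open>A fundamental square of the torus times the part of the closed tube of radius
  \<open>eps / 2\<close> with slope of modulus at most 1, the larger slopes being left to the other
  chart. Halving the radius keeps the set inside the open domain of the chart.\<close>

definition compact_exceptional :: "(real ^ 6) set" where
  "compact_exceptional = {y. 0 \<le> y $ 1 \<and> y $ 1 \<le> 1 \<and> 0 \<le> y $ 2 \<and> y $ 2 \<le> 1 \<and> cmod (slope y) \<le> 1 \<and>
     cmod (zeta y) * (1 + (cmod (slope y))\<^sup>2) \<le> (eps / 2)\<^sup>2}"

lemma compact_regular: "compact compact_regular" "compact_regular \<subseteq> P None"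
proof -
  have "closed {x. eps / 2 \<le> norm (tube p (e * x + n))}" for p e n
  proof -
    have "continuous_on UNIV (\<lambda>x. tube p (e * x + n))"
      by (rule continuous_on_compose2[OF continuous_on_tube[of UNIV]])
         (auto intro: smooth_on_continuous smooth_on_affine)
    then show ?thesis by (intro closed_Collect_le continuous_intros)
  qed
  then show "compact compact_regular"
    unfolding compact_regular_def by (intro compact_Int_closed compact_cbox closed_INT) auto
  show "compact_regular \<subseteq> P None"
  proof
    fix x assume x: "x \<in> compact_regular"
    have "\<not> singular x"
    proof
      assume "singular x"
      then obtain p ab where p: "p \<in> centres" "orb_rel x (near_torus p ab 0)"
        by (rule singular_near_torus)
      then obtain e n where "crystal e n" "near_torus p ab 0 = e * x + n"
        by (auto simp: orb_rel_def)
      with x p have "eps / 2 \<le> norm (tube p (near_torus p ab 0))"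
        by (auto simp: compact_regular_def)
      then show False using eps by (simp add: tube_near_torus)
    qed
    then show "x \<in> P None" by (simp add: pdom_def)
  qed
qed

lemma compact_exceptional: "compact compact_exceptional" "compact_exceptional \<subseteq> P (Some q)"
proof -
  have "closed compact_exceptional"
    unfolding compact_exceptional_def
    by (intro closed_Collect_conj closed_Collect_le continuous_intros continuous_on_zeta
        continuous_on_slope)
  moreover have "compact_exceptional \<subseteq> cbox (- 1) 1"
  proof
    fix y assume y: "y \<in> compact_exceptional"
    have "cmod (zeta y) \<le> cmod (zeta y) * (1 + (cmod (slope y))\<^sup>2)"
      by (simp add: distrib_left)
    also have "\<dots> \<le> (eps / 2)\<^sup>2" using y by (simp add: compact_exceptional_def)
    also have "\<dots> \<le> 1\<^sup>2" using eps by (intro power_mono) auto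
    finally have "cmod (zeta y) \<le> 1" by simp
    moreover have "cmod (slope y) \<le> 1" using y by (simp add: compact_exceptional_def)
    ultimately have "\<bar>y $ 3\<bar> \<le> 1" "\<bar>y $ 4\<bar> \<le> 1" "\<bar>y $ 5\<bar> \<le> 1" "\<bar>y $ 6\<bar> \<le> 1"
      using abs_Re_le_cmod[of "zeta y"] abs_Im_le_cmod[of "zeta y"] abs_Re_le_cmod[of "slope y"]
          abs_Im_le_cmod[of "slope y"]
      by (auto simp: zeta_def slope_def)
    then show "y \<in> cbox (- 1) 1"
      using y by (auto simp: mem_box_cart forall_6 compact_exceptional_def abs_le_iff)
  qed
  ultimately show "compact compact_exceptional"
    using compact_Int_closed[OF compact_cbox, of compact_exceptional] by (metis inf.absorb_iff2)
  have "(eps / 2)\<^sup>2 < eps\<^sup>2" using eps by (intro power_strict_mono) auto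
  then show "compact_exceptional \<subseteq> P (Some q)"
    by (auto simp: compact_exceptional_def pdom_def)
qed

text \<open>If the slope exceeds 1 in modulus, changing the blow-up chart inverts it and leaves the
  squared norm unchanged. Fractional parts bring the torus coordinates into the unit square.\<close>

lemma exceptional_covered:
  assumes "cmod (zeta y) * (1 + (cmod (slope y))\<^sup>2) \<le> (eps / 2)\<^sup>2"
  shows "\<exists>b'. par (Some (p, b)) y \<in> par (Some (p, b')) ` compact_exceptional"
proof -
  define ab where "ab = (frac (y $ 1), frac (y $ 2))"
  have "0 \<le> fst ab" "fst ab \<le> 1" "0 \<le> snd ab" "snd ab \<le> 1"
    using frac_lt_1[of "y $ 1"] frac_lt_1[of "y $ 2"] by (auto simp: ab_def)
  note ab = this
  have T: "T2 (y_T2 y) = T2 ab"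
    by (simp add: T2_eq_iff y_T2_def ab_def frac_def)
  show ?thesis
  proof (cases "cmod (slope y) \<le> 1")
    case True
    have "mk ab (zeta y) (slope y) \<in> compact_exceptional"
      using ab assms True by (simp add: compact_exceptional_def mk_nth)
    moreover have "par (Some (p, b)) y = par (Some (p, b)) (mk ab (zeta y) (slope y))"
      by (rule par_Some_eq) (simp_all add: T)
    ultimately show ?thesis by (intro exI[of _ b]) auto
  next
    case False
    then have s: "slope y \<noteq> 0" by auto
    let ?y = "mk ab (zeta y * (slope y)\<^sup>2) (1 / slope y)"
    have "cmod (zeta y * (slope y)\<^sup>2) * (1 + (cmod (1 / slope y))\<^sup>2) = cmod (zeta y) * (1 + (cmod
        (slope y))\<^sup>2)"
      using s by (simp add: norm_mult norm_power norm_divide power_divide field_simps)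
    then have "?y \<in> compact_exceptional"
      using ab assms False s by (simp add: compact_exceptional_def mk_nth norm_divide divide_simps)
    moreover have "par (Some (p, b)) y = par (Some (p, \<not> b)) ?y"
      by (rule par_Some_eq) (use s in \<open>simp_all add: T eh_chart_eq_iff\<close>)
    ultimately show ?thesis by (intro exI[of _ "\<not> b"]) auto
  qed
qed

text \<open>A regular point is first translated into the unit cube. If it misses
  \<open>compact_regular\<close> there, some group element brings it within \<open>eps / 2\<close>
  of a chosen torus, and it is rewritten in a tube chart.\<close>

lemma carrier_covered:
  "carrier_of M.A \<subseteq> par None ` compact_regular \<union> (\<Union>(p, b)\<in>centres \<times> UNIV. par (Some (p, b)) `
      compact_exceptional)"
    (is "_ \<subseteq> _ \<union> ?E")
proof
  have E: "m \<in> ?E" if "p \<in> centres" "\<exists>b'. m \<in> par (Some (p, b')) ` compact_exceptional" for m p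
    using that by auto
  fix m assume "m \<in> carrier_of M.A"
  then show "m \<in> par None ` compact_regular \<union> ?E"
  proof (cases rule: carrier_cases)
    case (exceptional p b y)
    then show ?thesis
      using E[OF exceptional(1), of m] exceptional_covered[of y p b] by simp
  next
    case (regular x)
    obtain n where n: "crystal 1 n" "x + n \<in> cbox 0 1" by (rule crystal_translate_into_cube)
    have x': "orb_rel x (x + n)" unfolding orb_rel_def
      by (rule exI[of _ 1], rule exI[of _ n]) (simp add: n)
    show ?thesis
    proof (cases "x + n \<in> compact_regular")
      case True
      have "m = par None (x + n)" using x' regular by (simp add: par_def orb_eq_iff)
      then show ?thesis using True by auto
    next
      case False
      then obtain p e n' where p: "p \<in> centres" "crystal e n'" "norm (tube p (e * (x + n) + n')) <
          eps / 2"
        using n by (auto simp: compact_regular_def)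
      define z where "z = e * (x + n) + n'"
      define q where "q = unpos (p \<in> alpha_centres) (z + - p)"
      define v where "v = tube p z"
      have "orb_rel (x + n) z" using p(2) unfolding orb_rel_def z_def by blast
      then have z: "orb_rel x z" by (rule orb_rel_trans[OF x'])
      have nt: "near_torus p (y_T2 q) v = z" unfolding q_def v_def by (rule near_torus_tube)
      have "\<not> singular z" using z regular singular_orb_rel by (auto simp: pdom_def)
      then have "v \<noteq> 0" using singular_near_torus_0[OF p(1)] nt by metis
      \<comment> \<open>The chart is selected by a nonvanishing coordinate of \<open>v\<close>,
        which makes the slope a genuine quotient.\<close>
      define b where "b = (fst v \<noteq> 0)"
      define s where "s = (if b then fst v else snd v)"
      define u where "u = (if b then snd v / fst v else fst v / snd v)"
      have s: "s \<noteq> 0" using \<open>v \<noteq> 0\<close> by (auto simp: s_def b_def prod_eq_iff)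
      have v: "eh_vec b s u = v" using eh_vec_surj[of b v] s by (simp add: s_def u_def)
      define y where "y = mk (y_T2 q) (s\<^sup>2) u"
      have "par (Some (p, b)) y = Regular (orb z)"
        using par_regular[OF p(1), of s y b] s v nt by (simp add: y_def)
      also have "\<dots> = m" using z regular by (simp add: par_def orb_eq_iff[symmetric])
      finally have m: "m = par (Some (p, b)) y" by simp
      have "cmod (zeta y) * (1 + (cmod (slope y))\<^sup>2) = (norm v)\<^sup>2"
        using norm_eh_vec[of b s u] v by (simp add: y_def)
      also have "\<dots> \<le> (eps / 2)\<^sup>2" using p(3) by (intro power_mono) (auto simp: v_def z_def)
      finally show ?thesis
        using E[OF p(1), of m] exceptional_covered[of y p b] m by simp
    qed
  qed
qed

lemma closed_manifold: "closed_manifold M.A"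
proof -
  have K: "compactin (atlas_topology M.A) (par i ` K)" if "i \<in> pindices" "compact K" "K \<subseteq> P i" for
      i K
    using that by (intro image_compactin[OF _ M.continuous_map_param])
      (auto simp: compactin_subtopology compactin_euclidean_iff)
  let ?F = "insert (par None ` compact_regular) ((\<lambda>(p, b). par (Some (p, b)) `
      compact_exceptional) ` (centres \<times> UNIV))"
  have "compactin (atlas_topology M.A) (\<Union> ?F)"
  proof (rule compactin_Union)
    show "finite ?F" using finite_centres by auto
    show "compactin (atlas_topology M.A) S" if S: "S \<in> ?F" for S
    proof (cases "S = par None ` compact_regular")
      case True
      then show ?thesis by (simp only:) (rule K[OF None_pindices compact_regular])
    next
      case False
      then obtain p b where p: "p \<in> centres" "S = par (Some (p, b)) ` compact_exceptional" using S
        by auto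
      show ?thesis unfolding p(2) by (rule K[OF Some_pindices[OF p(1)] compact_exceptional])
    qed
  qed
  moreover have "\<Union> ?F = carrier_of M.A"
  proof
    show "carrier_of M.A \<subseteq> \<Union> ?F" using carrier_covered by auto
    show "\<Union> ?F \<subseteq> carrier_of M.A"
      using par_in_carrier None_pindices Some_pindices compact_regular(2) compact_exceptional(2)
        by fastforce
  qed
  ultimately have "compact_space (atlas_topology M.A)" by (simp add: compact_space_def M.topspace)
  moreover have "countable pindices"
    using finite_centres by (simp add: pindices_def countable_finite)
  ultimately show ?thesis
    using Hausdorff M.smooth_atlas M.second_countable
    by (simp add: closed_manifold_def smooth_manifold_def)
qed

end

section \<open>Translations along the singular tori\<close>

text \<open>
  The function \<open>height True = cos (2 \<pi> x\<^sub>1)\<close> vanishes at the fixed tori of \<open>inv_beta\<close> and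
  \<open>height False = sin (2 \<pi> x\<^sub>1)\<close> at those of \<open>inv_alpha\<close>.  An element of the orbifold group changes
  the sign of \<open>height k\<close> exactly when it reverses the coordinates \<open>tdirs k\<close>, so that multiplying a
  translation in these directions by the sign of \<open>height k\<close> makes it descend to the quotient.
\<close>

definition tdirs :: "bool \<Rightarrow> 6 set" where
  "tdirs k = (if k then {5, 6} else {3, 4})"

definition height :: "bool \<Rightarrow> real ^ 6 \<Rightarrow> real" where
  "height k x = (if k then cos (2 * pi * x $ 1) else sin (2 * pi * x $ 1))"

definition tmask :: "bool \<Rightarrow> real ^ 6 \<Rightarrow> real ^ 6" where
  "tmask k \<theta> = (\<chi> j. if j \<in> tdirs k then \<theta> $ j else 0)"

definition fib :: "bool \<Rightarrow> real ^ 6 \<Rightarrow> real \<times> real" where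
  "fib k \<theta> = (if k then (\<theta> $ 5, \<theta> $ 6) else (\<theta> $ 3, \<theta> $ 4))"

text \<open>The choices of representatives are harmless where \<open>height k\<close> does not
  vanish identically on the orbit, by \<open>shift_None\<close> and \<open>shift_Some\<close>. At
  regular points of height 0 the convention \<open>sgn 0 = 0\<close> gives the identity; the
  geometrically relevant values are those on \<open>region k\<close>.\<close>

definition shift :: "bool \<Rightarrow> real ^ 6 \<Rightarrow> m_point \<Rightarrow> m_point" where
  "shift k \<theta> m = (case m of
     Regular q \<Rightarrow> (let x = SOME x. orb x = q in Regular (orb (x + sgn (height k x) *\<^sub>R tmask k \<theta>)))
   | Exceptional p t e \<Rightarrow> Exceptional p (T2 ((SOME ab. T2 ab = t) + fib k \<theta>)) e)"

lemma one_notin_tdirs: "1 \<notin> tdirs k" "2 \<notin> tdirs k"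
  by (auto simp: tdirs_def)

lemma tmask_nth [simp]: "tmask k \<theta> $ 1 = 0" "tmask k \<theta> $ 2 = 0"
  by (simp_all add: tmask_def one_notin_tdirs)

lemma tmask_add: "tmask k (\<theta> + \<theta>') = tmask k \<theta> + tmask k \<theta>'"
  and tmask_scale: "tmask k (c *\<^sub>R \<theta>) = c *\<^sub>R tmask k \<theta>"
  by (simp_all add: tmask_def vec_eq_iff)

lemma fib_add: "fib k (\<theta> + \<theta>') = fib k \<theta> + fib k \<theta>'"
  and fib_scale: "fib k (c *\<^sub>R \<theta>) = c *\<^sub>R fib k \<theta>"
  by (simp_all add: fib_def)

lemma height_cong: "x $ 1 = y $ 1 \<Longrightarrow> height k x = height k y"
  by (simp add: height_def)

text \<open>With the signs s and t of \<open>crystalE\<close>, the angle 2 pi x_1 becomes st (2 pi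
  x_1) + (1 - t) pi/2 modulo 2 pi. The cosine is even and acquires t from the phase; the sine
  acquires st by oddness and t from the phase, hence s. These are the signs on x_5, x_6 and on x_3,
  x_4.\<close>

lemma height_crystal:
  assumes "crystal e n" "j \<in> tdirs k"
  shows "height k (e * x + n) = e $ j * height k x"
proof -
  obtain s t r where st: "s \<in> {1, - 1}" "t \<in> {1, - 1}"
    "e $ 1 = s * t" "e $ 2 = s * t" "e $ 3 = s" "e $ 4 = s" "e $ 5 = t" "e $ 6 = t"
    and r: "r \<in> \<int>" "n $ 1 = r + (1 - t) / 4"
    using assms(1) by (rule crystalE)
  obtain m :: int where m: "r = of_int m" using r(1) by (auto elim: Ints_cases)
  have x1: "(e * x + n) $ 1 = s * t * x $ 1 + (of_int m + (1 - t) / 4)"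
    using st r m by simp
  have "2 * pi * (e * x + n) $ 1 = (s * t * (2 * pi * x $ 1) + (1 - t) * (pi / 2)) + 2 * pi *
      of_int m"
    unfolding x1 by (simp add: field_simps)
  then have h: "height k (e * x + n) = (if k then cos (s * t * (2 * pi * x $ 1) + (1 - t) * (pi /
      2))
      else sin (s * t * (2 * pi * x $ 1) + (1 - t) * (pi / 2)))"
    unfolding height_def
      by (simp only: cos_add[of _ "2 * pi * of_int m"] sin_add[of _ "2 * pi * of_int m"]
        cos_int_2pin sin_int_2pin) simp
  have "e $ j = (if k then t else s)"
    using assms(2) st by (auto simp: tdirs_def split: if_splits)
  then show ?thesis
    unfolding h using st(1,2) by (auto simp: height_def)
qed

lemma height_orb_rel: "orb_rel x y \<Longrightarrow> \<bar>height k y\<bar> = \<bar>height k x\<bar>"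
proof -
  assume "orb_rel x y"
  then obtain e n where en: "crystal e n" "y = e * x + n" by (auto simp: orb_rel_def)
  have "tdirs k \<noteq> {}" by (simp add: tdirs_def)
  then obtain j where j: "j \<in> tdirs k" by blast
  have "\<bar>e $ j\<bar> = 1" using crystal_signs[OF en(1), of j] by auto
  then show ?thesis unfolding en(2) height_crystal[OF en(1) j] by (simp add: abs_mult)
qed

lemma tmask_crystal:
  assumes "crystal e n"
  shows "sgn (height k (e * x + n)) *\<^sub>R tmask k \<theta> = e * (sgn (height k x) *\<^sub>R tmask k \<theta>)"
proof -
  have "sgn (height k (e * x + n)) * tmask k \<theta> $ j = e $ j * (sgn (height k x) * tmask k \<theta> $ j)"
      for j
  proof (cases "j \<in> tdirs k")
    case True
    then show ?thesis
      using crystal_signs[OF assms, of j] by (auto simp: height_crystal[OF assms True] sgn_mult)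
  qed (simp add: tmask_def)
  then show ?thesis
    unfolding vec_eq_iff vector_scaleR_component vector_mult_component real_scaleR_def by blast
qed

text \<open>By \<open>tmask_crystal\<close> the sign-corrected translation vector is transformed by
  the linear part of the group element, so another representative gives the same orbit.\<close>

lemma shift_None: "shift k \<theta> (par None x) = par None (x + sgn (height k x) *\<^sub>R tmask k \<theta>)"
proof -
  define y where "y = (SOME y. orb y = orb x)"
  have "orb y = orb x" unfolding y_def by (rule someI[of _ x]) simp
  then obtain e n where en: "crystal e n" "x = e * y + n" by (auto simp: orb_eq_iff orb_rel_def)
  have "e * (y + sgn (height k y) *\<^sub>R tmask k \<theta>) + n = x + sgn (height k x) *\<^sub>R tmask k \<theta>"
    using tmask_crystal[OF en(1), of k y \<theta>] en(2) by (simp add: distrib_left)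
  then have "orb_rel (y + sgn (height k y) *\<^sub>R tmask k \<theta>) (x + sgn (height k x) *\<^sub>R tmask k \<theta>)"
    using en(1) unfolding orb_rel_def by metis
  then show ?thesis
    by (simp add: shift_def par_def y_def[symmetric]) (simp add: orb_eq_iff)
qed

lemma mk_add: "y_T2 (y + mk ab 0 0) = y_T2 y + ab" "zeta (y + mk ab 0 0) = zeta y" "slope (y + mk
    ab 0 0) = slope y"
  by (simp_all add: mk_def y_T2_def zeta_def slope_def plus_prod_def)

lemma pdom_add: "y + mk ab 0 0 \<in> pdom \<epsilon> (Some q) \<longleftrightarrow> y \<in> pdom \<epsilon> (Some q)"
  by (simp add: pdom_def mk_add)

lemma near_torus_shift:
  assumes "k = (p \<in> alpha_centres)"
  shows "near_torus p (ab + fib k \<theta>) v = near_torus p ab v + tmask k \<theta>"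
  using assms
    by (simp add: near_torus_eq vec_eq_iff forall_6 pos_def mk_def tmask_def fib_def tdirs_def)

text \<open>On the tube 2 pi x_1 differs by less than pi/4 from 0 or from pi/2, where the cosine or
  the sine, respectively, equals 1. The normalization x_1 = 0 or x_1 = 1/4 of the centres is what
  makes the sign positive.\<close>

lemma height_near_torus_pos:
  assumes "p \<in> centres" "k = (p \<in> alpha_centres)" "norm v < 1/8"
  shows "0 < height k (near_torus p ab v)"
proof -
  have "\<bar>Re (fst v)\<bar> < 1/8" using norm_components[OF assms(3)] by simp
  then have "\<bar>2 * pi * Re (fst v)\<bar> < 2 * pi * (1/8)" by (simp add: abs_mult)
  then have "- (pi / 2) < 2 * pi * Re (fst v)" "2 * pi * Re (fst v) < pi / 2"
    using pi_gt_zero by linarith+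
  then have c: "0 < cos (2 * pi * Re (fst v))" by (rule cos_gt_zero_pi)
  show ?thesis
  proof (cases k)
    case True
    then show ?thesis using c assms near_torus_alpha(1)[of p ab v] by (simp add: height_def)
  next
    case False
    then have "p \<in> beta_centres" using assms by (auto simp: centres_def)
    then have "2 * pi * near_torus p ab v $ 1 = 2 * pi * Re (fst v) + pi / 2"
      by (simp add: near_torus_beta field_simps)
    then show ?thesis using c False by (simp add: height_def sin_add)
  qed
qed

lemma height_near_torus_0:
  assumes "p \<in> centres" "k \<noteq> (p \<in> alpha_centres)"
  shows "height k (near_torus p ab 0) = 0"
proof (cases k)
  case True
  then have "p \<in> beta_centres" using assms by (auto simp: centres_def)
  then have "2 * pi * near_torus p ab 0 $ 1 = pi / 2" by (simp add: near_torus_beta)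
  then show ?thesis using True by (simp only: height_def if_True cos_pi_half)
next
  case False
  then show ?thesis using assms near_torus_alpha(1)[of p ab 0] by (simp add: height_def)
qed

text \<open>Nonvanishing of \<open>height k\<close> excludes, by the value of x_1, the kind of
  singularity that involves the coordinates \<open>tdirs k\<close>. The other kind is a condition on
  coordinates that the translation leaves alone.\<close>

lemma nonsingular_tmask:
  assumes "\<not> singular x" "height k x \<noteq> 0"
  shows "\<not> singular (x + c *\<^sub>R tmask k \<theta>)"
proof
  assume s: "singular (x + c *\<^sub>R tmask k \<theta>)"
  show False
  proof (cases k)
    case True
    have "2 * x $ 1 - 1/2 \<notin> \<int>"
    proof
      assume "2 * x $ 1 - 1/2 \<in> \<int>"
      then obtain m :: int where "2 * x $ 1 - 1/2 = of_int m" by (auto elim: Ints_cases)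
      then have "2 * pi * x $ 1 = pi * of_int m + pi / 2" by (simp add: field_simps)
      then show False using assms(2) True by (simp add: height_def cos_add)
    qed
    then show False using s assms(1) True by (simp add: singular_iff tmask_def tdirs_def)
  next
    case False
    have "2 * x $ 1 \<notin> \<int>"
    proof
      assume "2 * x $ 1 \<in> \<int>"
      then obtain m :: int where "2 * x $ 1 = of_int m" by (auto elim: Ints_cases)
      then have "2 * pi * x $ 1 = pi * of_int m" by simp
      then have "sin (2 * pi * x $ 1) = 0" by (simp only: sin_npi_int)
      then show False using assms(2) False by (simp add: height_def)
    qed
    then show False using s assms(1) False by (simp add: singular_iff tmask_def tdirs_def)
  qed
qed

lemma continuous_on_height: "continuous_on S (height k)"
  unfolding height_def by (cases k) (auto intro!: continuous_intros)

section \<open>The translations on the resolved manifold\<close>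

context resolution
begin

text \<open>Since \<open>height k\<close> is positive on the tube, no sign appears, and the
  translation is that of the torus factor on and off the exceptional set. This is how the action
  extends smoothly over the exceptional set.\<close>

lemma shift_Some:
  assumes p: "p \<in> centres" "k = (p \<in> alpha_centres)" and y: "y \<in> P (Some (p, b))"
  shows "shift k \<theta> (par (Some (p, b)) y) = par (Some (p, b)) (y + mk (fib k \<theta>) 0 0)"
proof (cases "zeta y = 0")
  case True
  define ab where "ab = (SOME ab. T2 ab = T2 (y_T2 y))"
  have "T2 ab = T2 (y_T2 y)" unfolding ab_def by (rule someI[of _ "y_T2 y"]) simp
  then have "T2 (ab + fib k \<theta>) = T2 (y_T2 y + fib k \<theta>)" by (simp add: T2_eq_iff)
  then show ?thesis
    using True by (simp add: par_exceptional mk_add shift_def ab_def[symmetric])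
next
  case False
  let ?v = "eh_vec b (csqrt (zeta y)) (slope y)"
  have "norm ?v < 1/8"
    using norm_eh_vec_less[OF power2_csqrt, of b y] y eps(2) by fastforce
  then have "0 < height k (near_torus p (y_T2 y) ?v)"
    by (rule height_near_torus_pos[OF p])
  then have "shift k \<theta> (par None (near_torus p (y_T2 y) ?v)) = par None (near_torus p (y_T2 y +
      fib k \<theta>) ?v)"
    by (simp add: shift_None near_torus_shift[OF p(2)])
  then show ?thesis
    using False by (simp add: par_regular[OF p(1) power2_csqrt] mk_add par_def[of None])
qed

text \<open>Phrased through \<open>base_points\<close>, openness is an instance of the continuity of
  the blow-down. The absolute value of \<open>height k\<close> is constant on an orbit, so one base
  point of nonzero height means that all have it.\<close>

definition region :: "bool \<Rightarrow> m_point set" where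
  "region k = {m \<in> carrier_of M.A. base_points m \<inter> {x. height k x \<noteq> 0} \<noteq> {}}"

lemma openin_region: "openin (atlas_topology M.A) (region k)"
proof -
  have "open {x. height k x \<noteq> 0}"
    by (intro open_Collect_neq continuous_on_height continuous_intros)
  then show ?thesis unfolding region_def by (rule openin_base_points)
qed

lemma region_subset: "m \<in> region k \<Longrightarrow> m \<in> carrier_of M.A"
  by (simp add: region_def)

lemma region_None: "x \<in> P None \<Longrightarrow> par None x \<in> region k \<longleftrightarrow> height k x \<noteq> 0"
  using height_orb_rel[of x _ k] orb_rel_refl[of x] par_in_carrier[OF None_pindices, of x]
  by (auto simp: region_def base_points_None disjoint_iff)

lemma region_exceptional:
  assumes "p \<in> centres" "y \<in> P (Some (p, b))" "zeta y = 0"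
  shows "par (Some (p, b)) y \<in> region k \<longleftrightarrow> k = (p \<in> alpha_centres)"
proof -
  let ?x = "near_torus p (y_T2 y) 0"
  have "par (Some (p, b)) y \<in> region k \<longleftrightarrow> height k ?x \<noteq> 0"
    using height_orb_rel[of ?x _ k] orb_rel_refl[of ?x] par_in_carrier[OF Some_pindices[OF
        assms(1)] assms(2)]
    by (auto simp: region_def base_points_exceptional[OF assms(3)] disjoint_iff)
  moreover have "height k ?x \<noteq> 0 \<longleftrightarrow> k = (p \<in> alpha_centres)"
  proof (cases "k = (p \<in> alpha_centres)")
    case True
    then show ?thesis using height_near_torus_pos[OF assms(1) True, of 0 "y_T2 y"] by simp
  next
    case False
    then show ?thesis using height_near_torus_0[OF assms(1) False] by simp
  qed
  ultimately show ?thesis by simp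
qed

lemma region_Some:
  assumes "p \<in> centres" "k = (p \<in> alpha_centres)" "y \<in> P (Some (p, b))"
  shows "par (Some (p, b)) y \<in> region k"
proof (cases "zeta y = 0")
  case True
  then show ?thesis using region_exceptional assms by simp
next
  case False
  obtain W h where h: "y \<in> W" "h y = near_torus p (y_T2 y) (eh_vec b (csqrt (zeta y)) (slope y))"
    "\<And>w. w \<in> W \<Longrightarrow> zeta w \<noteq> 0 \<and> h w \<in> P None \<and> par None (h w) = par (Some (p, b)) w"
    using regular_lift[OF assms(1,3) False power2_csqrt] by metis
  have "norm (eh_vec b (csqrt (zeta y)) (slope y)) < 1/8"
    using norm_eh_vec_less[OF power2_csqrt, of b y] assms(3) eps(2) by fastforce
  then have "0 < height k (h y)"
    unfolding h(2) by (rule height_near_torus_pos[OF assms(1,2)])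
  then have "par None (h y) \<in> region k" using region_None[of "h y" k] h(1,3) by auto
  then show ?thesis using h(1,3) by auto
qed

lemma region_cases:
  assumes "m \<in> region k"
  obtains (regular) x where "x \<in> P None" "height k x \<noteq> 0" "m = par None x"
  | (exceptional) p b y where "p \<in> centres" "k = (p \<in> alpha_centres)" "y \<in> P (Some (p, b))" "zeta
      y = 0"
      "m = par (Some (p, b)) y"
  using region_subset[OF assms]
proof (cases rule: carrier_cases)
  case (regular x)
  then show ?thesis using that(1) assms region_None by auto
next
  case (exceptional p b y)
  then show ?thesis using that(2) assms region_exceptional by auto
qed

lemma shift_regular_in: "x \<in> P None \<Longrightarrow> height k x \<noteq> 0 \<Longrightarrow> x + c *\<^sub>R tmask k \<theta> \<in> P None"
  using nonsingular_tmask by (simp add: pdom_def)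

lemma region_shift:
  assumes "m \<in> region k"
  shows "shift k \<theta> m \<in> region k' \<longleftrightarrow> m \<in> region k'"
  using assms
proof (cases rule: region_cases)
  case (regular x)
  have "height k' (x + c *\<^sub>R tmask k \<theta>) = height k' x" for c by (rule height_cong) simp
  then show ?thesis
    using regular shift_regular_in by (simp add: shift_None region_None)
next
  case (exceptional p b y)
  then show ?thesis
    using region_exceptional[of p y b k'] region_exceptional[of p "y + mk (fib k \<theta>) 0 0" b k']
    by (simp add: shift_Some pdom_add mk_add)
qed

lemma shift_in_region: "m \<in> region k \<Longrightarrow> shift k \<theta> m \<in> region k"
  by (simp add: region_shift)

lemma shift_0:
  assumes "m \<in> region k"
  shows "shift k 0 m = m"
  using assms
proof (cases rule: region_cases)
  case (regular x)
  have "tmask k 0 = 0" by (simp add: tmask_def vec_eq_iff)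
  then show ?thesis using regular by (simp add: shift_None)
next
  case (exceptional p b y)
  have "mk (fib k 0) 0 0 = 0" by (simp add: mk_def fib_def vec_eq_iff forall_6)
  then show ?thesis using exceptional by (simp add: shift_Some)
qed

lemma shift_add:
  assumes "m \<in> region k"
  shows "shift k (\<theta> + \<theta>') m = shift k \<theta> (shift k \<theta>' m)"
  using assms
proof (cases rule: region_cases)
  case (regular x)
  have "height k (x + c *\<^sub>R tmask k \<theta>') = height k x" for c by (rule height_cong) simp
  then show ?thesis using regular by (simp add: shift_None tmask_add scaleR_right_distrib add_ac)
next
  case (exceptional p b y)
  have "y + mk (fib k (\<theta> + \<theta>')) 0 0 = (y + mk (fib k \<theta>') 0 0) + mk (fib k \<theta>) 0 0"
    by (simp add: vec_eq_iff forall_6 mk_def fib_add)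
  then show ?thesis using exceptional by (simp add: shift_Some pdom_add add.assoc)
qed

lemma shift_commute:
  assumes "m \<in> region k" "m \<in> region k'"
  shows "shift k \<theta> (shift k' \<theta>' m) = shift k' \<theta>' (shift k \<theta> m)"
proof (cases "k = k'")
  case True
  have "shift k \<theta> (shift k \<theta>' m) = shift k (\<theta> + \<theta>') m"
    by (rule shift_add[OF assms(1), symmetric])
  also have "\<dots> = shift k (\<theta>' + \<theta>) m" by (simp only: add.commute)
  also have "\<dots> = shift k \<theta>' (shift k \<theta> m)" by (rule shift_add[OF assms(1)])
  finally show ?thesis using True by simp
next
  case False
  from assms(1) show ?thesis
  proof (cases rule: region_cases)
    case (regular x)
    have "height k'' (x + c *\<^sub>R tmask l \<theta>'') = height k'' x" for c k'' l \<theta>''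
      by (rule height_cong) simp
    then show ?thesis using regular by (simp add: shift_None add_ac)
  next
    case (exceptional p b y)
    then show ?thesis using assms(2) False region_exceptional by auto
  qed
qed

lemma shift_periodic:
  assumes "m \<in> region k" "\<And>j. j \<in> tdirs k \<Longrightarrow> \<theta> $ j - \<theta>' $ j \<in> \<int>"
  shows "shift k \<theta> m = shift k \<theta>' m"
  using assms(1)
proof (cases rule: region_cases)
  case (regular x)
  have "orb_rel (x + sgn (height k x) *\<^sub>R tmask k \<theta>') (x + sgn (height k x) *\<^sub>R tmask k \<theta>)"
  proof (rule orb_rel_translate)
    fix i
    have "(x + sgn (height k x) *\<^sub>R tmask k \<theta>) $ i - (x + sgn (height k x) *\<^sub>R tmask k \<theta>') $ i =
        sgn (height k x) * (if i \<in> tdirs k then \<theta> $ i - \<theta>' $ i else 0)"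
      by (simp add: tmask_def right_diff_distrib)
    also have "\<dots> \<in> \<int>"
      using assms(2) by (intro Ints_mult) (auto simp: sgn_if)
    finally show "(x + sgn (height k x) *\<^sub>R tmask k \<theta>) $ i - (x + sgn (height k x) *\<^sub>R tmask k \<theta>')
        $ i \<in> \<int>" .
  qed
  then show ?thesis using regular orb_rel_sym
    by (simp add: shift_None) (simp add: par_def orb_eq_iff)
next
  case (exceptional p b y)
  have "T2 (y_T2 (y + mk (fib k \<theta>) 0 0)) = T2 (y_T2 (y + mk (fib k \<theta>') 0 0))"
    using assms(2) by (auto simp: T2_eq_iff mk_add fib_def tdirs_def)
  then show ?thesis using exceptional
    by (simp add: shift_Some) (intro par_Some_eq, simp_all add: mk_add)
qed

text \<open>In a suitable parametrization the whole action is w -> w + V \<theta> with one linear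
  \<open>V\<close>, for all angles and all w near the point. Smoothness, continuity and
  connectedness of the orbits are read off from this form.\<close>

lemma shift_local:
  assumes "m \<in> region k"
  obtains i x N V where "i \<in> pindices" "x \<in> P i" "par i x = m" "open N" "x \<in> N" "N \<subseteq> P i"
      "bounded_linear V"
    "\<And>w. w \<in> N \<Longrightarrow> par i w \<in> region k"
    "\<And>w \<theta>. w \<in> N \<Longrightarrow> w + V \<theta> \<in> P i \<and> par i (w + V \<theta>) = shift k \<theta> (par i w)"
  using assms
proof (cases rule: region_cases)
  case (regular x)
  \<comment> \<open>On this neighbourhood \<open>height k\<close> keeps the sign it has at
    \<open>x\<close>, so the sign can be frozen in the linear map.\<close>
  let ?N = "P None \<inter> {w. 0 < height k w * height k x}"
  have N: "sgn (height k w) = sgn (height k x)" "height k w \<noteq> 0" if "w \<in> ?N" for w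
    using that by (auto simp: zero_less_mult_iff sgn_if)
  show ?thesis
  proof (rule that[of None x ?N "\<lambda>\<theta>. sgn (height k x) *\<^sub>R tmask k \<theta>"])
    show "open ?N"
      by (intro open_Int open_pdom open_Collect_less continuous_intros continuous_on_height)
    show "x \<in> ?N" using regular by (auto simp: zero_less_mult_iff linorder_neq_iff)
    show "bounded_linear (\<lambda>\<theta>. sgn (height k x) *\<^sub>R tmask k \<theta>)"
      by (auto simp: linear_conv_bounded_linear[symmetric] tmask_add tmask_scale
          scaleR_right_distrib intro!: linearI)
    show "w + sgn (height k x) *\<^sub>R tmask k \<theta> \<in> P None \<and>
        par None (w + sgn (height k x) *\<^sub>R tmask k \<theta>) = shift k \<theta> (par None w)" if "w \<in> ?N" for w \<theta>
      using that N[OF that] shift_regular_in by (simp add: shift_None)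
    show "par None w \<in> region k" if "w \<in> ?N" for w
      using that N[OF that] region_None by simp
  qed (use regular None_pindices in auto)
next
  case (exceptional p b y)
  show ?thesis
  proof (rule that[of "Some (p, b)" y "P (Some (p, b))" "\<lambda>\<theta>. mk (fib k \<theta>) 0 0"])
    show "bounded_linear (\<lambda>\<theta>. mk (fib k \<theta>) 0 0)"
      by (auto simp: linear_conv_bounded_linear[symmetric] mk_def fib_add fib_scale vec_eq_iff
          forall_6 intro!: linearI)
  qed (use exceptional Some_pindices open_pdom region_Some in \<open>auto simp: shift_Some pdom_add\<close>)
qed

lemma regions_cover: "region True \<union> region False = carrier_of M.A"
proof
  show "carrier_of M.A \<subseteq> region True \<union> region False"
  proof
    fix m assume "m \<in> carrier_of M.A"
    then show "m \<in> region True \<union> region False"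
    proof (cases rule: carrier_cases)
      case (regular x)
      have "(height True x)\<^sup>2 + (height False x)\<^sup>2 = 1" by (simp add: height_def)
      then have "height True x \<noteq> 0 \<or> height False x \<noteq> 0" by auto
      then show ?thesis using regular region_None by auto
    next
      case (exceptional p b y)
      then show ?thesis using region_exceptional by (cases "p \<in> alpha_centres") auto
    qed
  qed
qed (auto simp: region_def)

text \<open>The value 1/8 is the midpoint of [0, 1/4], so both heights equal the common positive
  value of sine and cosine at pi/4. The other coordinates vanish, so a group element changes them by
  its translation part only.\<close>

definition generic_point :: "real ^ 6" where
  "generic_point = vector [1/8, 0, 0, 0, 0, 0]"

lemma generic_point: "generic_point \<in> P None" "par None generic_point \<in> region k" "0 < height k
    generic_point"
proof -
  have "2 * (1/8) \<notin> (\<int> :: real set)" "2 * (1/8) - 1/2 \<notin> (\<int> :: real set)"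
    using Ints_small[of "1/4"] Ints_small[of "-1/4"] by auto
  then show P: "generic_point \<in> P None"
    by (simp add: pdom_def singular_iff generic_point_def)
  have "2 * pi * generic_point $ 1 = pi / 4" by (simp add: generic_point_def)
  then have "height k generic_point = (if k then cos (pi / 4) else sin (pi / 4))"
    by (simp only: height_def)
  then show h: "0 < height k generic_point" by (simp add: cos_45 sin_45)
  show "par None generic_point \<in> region k"
    using region_None[OF P] h by auto
qed

end

section \<open>The F-structure\<close>

text \<open>A discontinuous section of \<open>torus_exp\<close> by principal arguments. Its jumps
  are integral in every angle and invisible to \<open>shift\<close> by
  \<open>shift_periodic\<close>.\<close>

definition tlog :: "complex ^ 6 \<Rightarrow> real ^ 6" where
  "tlog t = (\<chi> j. Arg (t $ j) / (2 * pi))"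

lemma torus_exp_tlog:
  assumes "t \<in> torus J"
  shows "torus_exp J (tlog t) = t"
proof -
  have "cis (Arg (t $ j)) = t $ j" for j
    using assms cis_Arg[of "t $ j"]
      by (cases "t $ j = 0") (auto simp: torus_def sgn_div_norm dest: spec[of _ j])
  then show ?thesis
    using assms by (auto simp: torus_exp_def tlog_def torus_def vec_eq_iff)
qed

lemma torus_exp_in: "torus_exp J \<theta> \<in> torus J"
  by (simp add: torus_exp_def torus_def)

lemma torus_exp_add: "torus_exp J (\<theta> + \<theta>') = torus_exp J \<theta> * torus_exp J \<theta>'"
  by (simp add: torus_exp_def vec_eq_iff cis_mult distrib_left)

lemma torus_exp_0: "torus_exp J 0 = 1"
  by (simp add: torus_exp_def vec_eq_iff)

lemma torus_exp_eq_iff: "torus_exp J \<theta> = torus_exp J \<theta>' \<longleftrightarrow> (\<forall>j\<in>J. \<theta> $ j - \<theta>' $ j \<in> \<int>)"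
proof -
  have "cis (2 * pi * a) = cis (2 * pi * b) \<longleftrightarrow> a - b \<in> \<int>" for a b
  proof -
    have "cis (2 * pi * a) = cis (2 * pi * b) \<longleftrightarrow> cis (2 * pi * a - 2 * pi * b) = 1"
      by (simp add: cis_divide[symmetric])
    also have "2 * pi * a - 2 * pi * b = 2 * pi * (a - b)" by (simp add: algebra_simps)
    also have "cis (2 * pi * (a - b)) = 1 \<longleftrightarrow> a - b \<in> \<int>"
    proof
      assume "cis (2 * pi * (a - b)) = 1"
      then have "cos (2 * pi * (a - b)) = 1" by (metis cis.sel(1) one_complex.sel(1))
      then obtain n :: int where "2 * pi * (a - b) = n * 2 * pi" by (auto simp: cos_one_2pi_int)
      then have "a - b = n" by simp
      then show "a - b \<in> \<int>" by simp
    next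
      assume "a - b \<in> \<int>"
      then show "cis (2 * pi * (a - b)) = 1" by (rule cis_multiple_2pi)
    qed
    finally show ?thesis .
  qed
  then show ?thesis by (auto simp: torus_exp_def vec_eq_iff)
qed

text \<open>Since \<open>tlog\<close> has jumps, angles near \<open>tlog t0\<close> are found by
  adding to it the argument of t / t0, which is continuous near t0 because the quotient is close to
  1.\<close>

lemma torus_exp_open:
  assumes t0: "t0 \<in> torus J" and A: "open A" "tlog t0 \<in> A"
  obtains N where "open N" "t0 \<in> N" "\<And>t. t \<in> N \<Longrightarrow> t \<in> torus J \<Longrightarrow> \<exists>\<theta>\<in>A. torus_exp J \<theta> = t"
proof -
  define g where "g = (\<lambda>t. \<chi> j. tlog t0 $ j + Arg (t $ j / t0 $ j) / (2 * pi))"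
  have c: "cmod (t0 $ j) = 1" "t0 $ j \<noteq> 0" for j
    using t0 by (auto simp: torus_def) (metis norm_zero zero_neq_one)
  have "isCont (\<lambda>t. tlog t0 $ j + Arg (t $ j / t0 $ j) / (2 * pi)) t0" for j
  proof -
    have "isCont (\<lambda>t. t $ j / t0 $ j) t0"
      using c(2) by (intro continuous_intros) auto
    moreover have "isCont Arg (t0 $ j / t0 $ j)"
      using c(2)[of j] by (intro continuous_at_Arg) simp
    ultimately have "isCont (\<lambda>t. Arg (t $ j / t0 $ j)) t0"
      by (rule isCont_o2)
    then show ?thesis by (intro continuous_intros) auto
  qed
  then have "isCont g t0"
    unfolding isCont_def g_def by (intro tendsto_vec_lambda)
  moreover have "g t0 = tlog t0"
    using c(2) by (simp add: g_def vec_eq_iff)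
  ultimately obtain N where N: "open N" "t0 \<in> N" "\<forall>t\<in>N. g t \<in> A"
    using A by (auto simp: continuous_at_open)
  show thesis
  proof (rule that[OF N(1,2)])
    fix t assume t: "t \<in> N" "t \<in> torus J"
    have "torus_exp J (g t) $ j = t $ j" for j
    proof (cases "j \<in> J")
      case True
      have n: "cmod (t $ j / t0 $ j) = 1" using t(2) c by (simp add: torus_def norm_divide)
      have "cis (2 * pi * g t $ j) = cis (2 * pi * tlog t0 $ j) * cis (Arg (t $ j / t0 $ j))"
        by (simp add: g_def cis_mult distrib_left)
      also have "cis (2 * pi * tlog t0 $ j) = t0 $ j"
        using arg_cong[OF torus_exp_tlog[OF t0], of "\<lambda>x. x $ j"] True by (simp add: torus_exp_def)
      also have "cis (Arg (t $ j / t0 $ j)) = t $ j / t0 $ j"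
        using n cis_Arg[of "t $ j / t0 $ j"]
          by (cases "t $ j / t0 $ j = 0") (auto simp: sgn_div_norm)
      also have "t0 $ j * (t $ j / t0 $ j) = t $ j" using c by simp
      finally show ?thesis using True by (simp add: torus_exp_def)
    next
      case False
      then show ?thesis using t(2) by (simp add: torus_exp_def torus_def)
    qed
    then show "\<exists>\<theta>\<in>A. torus_exp J \<theta> = t"
      using N t by (intro bexI[of _ "g t"]) (simp_all add: vec_eq_iff)
  qed
qed

section \<open>The torus actions on the coverings\<close>

context resolution
begin

definition act :: "bool \<Rightarrow> complex ^ 6 \<Rightarrow> m_point \<times> nat \<Rightarrow> m_point \<times> nat" where
  "act k t x = (shift k (tlog t) (fst x), snd x)"

abbreviation "rdom k \<equiv> \<lambda>i. {x \<in> P i. par i x \<in> region k}"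
abbreviation "RA k \<equiv> etale_atlas pindices (rdom k) par"

lemmas etale_region = M.etale_restrict[OF openin_region]

lemma restrict_region: "restrict_atlas M.A (region k) = RA k"
  by (rule M.restrict_atlas_eq[OF openin_region])

lemma carrier_RA: "carrier_of (RA k) = region k"
  using M.carrier_of_restrict[OF openin_region] restrict_region by metis

lemma carrier_sheets_RA: "carrier_of (sheets (RA k) K) = region k \<times> K"
  by (simp add: carrier_of_sheets carrier_RA)

lemma topspace_sheets_RA: "topspace (atlas_topology (sheets (RA k) K)) = region k \<times> K"
  using etale.topspace[OF etale.etale_sheets[OF etale_region[of k], of K]] carrier_sheets_RA[of k K]
  unfolding sheets_etale_atlas by simp

lemma shift_torus_exp:
  assumes "m \<in> region k"
  shows "shift k (tlog (torus_exp (tdirs k) \<theta>)) m = shift k \<theta> m"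
proof (rule shift_periodic[OF assms])
  have "torus_exp (tdirs k) (tlog (torus_exp (tdirs k) \<theta>)) = torus_exp (tdirs k) \<theta>"
    by (rule torus_exp_tlog[OF torus_exp_in])
  then show "tlog (torus_exp (tdirs k) \<theta>) $ j - \<theta> $ j \<in> \<int>" if "j \<in> tdirs k" for j
    using that by (simp add: torus_exp_eq_iff)
qed

lemma shift_tlog_mult:
  assumes "m \<in> region k" "s \<in> torus (tdirs k)" "t \<in> torus (tdirs k)"
  shows "shift k (tlog (s * t)) m = shift k (tlog s) (shift k (tlog t) m)"
proof -
  have "s * t = torus_exp (tdirs k) (tlog s + tlog t)"
    using assms by (simp add: torus_exp_add torus_exp_tlog)
  then show ?thesis
    using assms(1) shift_torus_exp shift_add by simp
qed

lemma shift_tlog_1: "m \<in> region k \<Longrightarrow> shift k (tlog 1) m = m"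
  using shift_torus_exp[of m k 0] shift_0 by (simp add: torus_exp_0)

lemma torus_action_act: "torus_action (tdirs k) (region k \<times> K) (act k)"
  by (auto simp: torus_action_def act_def shift_in_region shift_tlog_1 shift_tlog_mult)

text \<open>In the parametrization of \<open>shift_local\<close> the action is linear in the angles
  and the coordinates jointly, and the sheet number does not change.\<close>

lemma smooth_torus_action_act: "smooth_torus_action (tdirs k) (sheets (RA k) K) (act k)"
  unfolding smooth_torus_action_def carrier_sheets_RA
proof (intro conjI torus_action_act)
  note E = etale.etale_sheets[OF etale_region[of k], of K]
  show "smooth_map (prod_atlas {(UNIV, \<lambda>\<theta>. \<theta>)} (sheets (RA k) K)) (sheets (RA k) K)
      (\<lambda>(\<theta>, x). act k (torus_exp (tdirs k) \<theta>) x)"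
    unfolding sheets_etale_atlas
  proof (rule smooth_map_prod_etale[OF E E])
    fix x and v :: "real ^ 6"
    assume "x \<in> carrier_of (etale_atlas (pindices \<times> K) (sheet_dom (rdom k)) (sheet_map par))"
    then obtain m l where x: "x = (m, l)" "m \<in> region k" "l \<in> K"
      using carrier_sheets_RA by (auto simp: sheets_etale_atlas)
    obtain i y N V where y: "i \<in> pindices" "y \<in> P i" "par i y = m" "open N" "y \<in> N" "N \<subseteq> P i"
        "bounded_linear V"
      "\<And>w. w \<in> N \<Longrightarrow> par i w \<in> region k"
      "\<And>w \<theta>. w \<in> N \<Longrightarrow> w + V \<theta> \<in> P i \<and> par i (w + V \<theta>) = shift k \<theta> (par i w)"
      using shift_local[OF x(2)] by metis
    have V: "smooth_on ((UNIV :: (real ^ 6) set) \<times> N) (\<lambda>p. snd p + V (fst p))"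
      by (intro smooth_on_bounded_linear bounded_linear_add bounded_linear_snd
          bounded_linear_compose[OF y(7) bounded_linear_fst])
    have "smooth_near (pindices \<times> K) (sheet_dom (rdom k)) (sheet_map par)
        (\<lambda>(v, w). case (v, sheet_map par (i, l) w) of (\<theta>, x) \<Rightarrow> act k (torus_exp (tdirs k) \<theta>) x)
            (v, y)"
    proof (rule smooth_nearI[OF _ _ _ V])
      show "open ((UNIV :: (real ^ 6) set) \<times> N)" "(v, y) \<in> UNIV \<times> N" "(i, l) \<in> pindices \<times> K"
        using y x by (auto intro: open_Times)
      fix p assume p: "p \<in> (UNIV :: (real ^ 6) set) \<times> N"
      then have w: "snd p \<in> N" by auto
      show "snd p + V (fst p) \<in> sheet_dom (rdom k) (i, l)"
        using y(8,9)[OF w] shift_in_region by simp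
      show "(case p of (v, w) \<Rightarrow> case (v, sheet_map par (i, l) w) of (\<theta>, x) \<Rightarrow> act k (torus_exp
          (tdirs k) \<theta>) x) =
          sheet_map par (i, l) (snd p + V (fst p))"
        using y(8,9)[OF w] shift_torus_exp by (simp add: act_def case_prod_beta)
    qed
    then show "\<exists>i y. i \<in> pindices \<times> K \<and> y \<in> sheet_dom (rdom k) i \<and> sheet_map par i y = x \<and>
        smooth_near (pindices \<times> K) (sheet_dom (rdom k)) (sheet_map par)
        (\<lambda>(v, w). case (v, sheet_map par i w) of (\<theta>, x) \<Rightarrow> act k (torus_exp (tdirs k) \<theta>) x) (v, y)"
      using x y by (intro exI[of _ "(i, l)"] exI[of _ y]) auto
  qed
qed

text \<open>A torus element fixing the class of \<open>generic_point\<close> translates it by the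
  effect of a group element. In a direction of \<open>tdirs k\<close> the point has coordinate 0 and
  the group translation is integral, so the angle is integral.\<close>

lemma act_kernel:
  assumes "K \<noteq> {}" "t \<in> torus (tdirs k)" "\<forall>x\<in>region k \<times> K. act k t x = x"
  shows "t = 1"
proof -
  obtain l where "l \<in> K" using assms(1) by auto
  then have "shift k (tlog t) (par None generic_point) = par None generic_point"
    using assms(3) generic_point(2)[of k] by (auto simp: act_def)
  then have "orb_rel generic_point (generic_point + tmask k (tlog t))"
    using generic_point(3)[of k] orb_rel_sym
      by (simp add: shift_None) (simp add: par_def orb_eq_iff)
  then obtain e n where en: "crystal e n" "generic_point + tmask k (tlog t) = e * generic_point + n"
    by (auto simp: orb_rel_def)
  have "tlog t $ j - 0 $ j \<in> \<int>" if j: "j \<in> tdirs k" for j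
  proof -
    have "j \<noteq> 1" using j one_notin_tdirs by auto
    then have "generic_point $ j = 0" using exhaust_6[of j] by (auto simp: generic_point_def)
    then have "tlog t $ j = n $ j"
      using arg_cong[OF en(2), of "\<lambda>x. x $ j"] j by (simp add: tmask_def)
    then show ?thesis using en(1) \<open>j \<noteq> 1\<close> by (simp add: crystal_def)
  qed
  then have "torus_exp (tdirs k) (tlog t) = torus_exp (tdirs k) 0"
    by (simp add: torus_exp_eq_iff)
  then show ?thesis using assms(2) by (simp add: torus_exp_tlog torus_exp_0)
qed

text \<open>Every sheet is open, so the label is locally constant. It is made real-valued for the
  theorem on continuous functions with discrete range.\<close>

lemma sheet_number_continuous:
  "continuous_map (atlas_topology (sheets (RA k) K)) euclideanreal (\<lambda>x. real (snd x))"
  unfolding continuous_map_def topspace_sheets_RA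
proof (intro conjI allI impI)
  fix W :: "real set"
  have "openin (atlas_topology (sheets (RA k) K)) (\<Union>l\<in>{l\<in>K. real l \<in> W}. region k \<times> {l})"
  proof (intro openin_Union, clarify)
    fix l assume "l \<in> K"
    have "topspace (atlas_topology (RA k)) = region k"
      using etale.topspace[OF etale_region[of k]] carrier_RA[of k] by simp
    then have "openin (atlas_topology (RA k)) (region k)"
      using openin_topspace[of "atlas_topology (RA k)"] by simp
    then show "openin (atlas_topology (sheets (RA k) K)) (region k \<times> {l})"
      by (rule etale.openin_sheet[OF etale_region _ \<open>l \<in> K\<close>])
  qed
  also have "(\<Union>l\<in>{l\<in>K. real l \<in> W}. region k \<times> {l}) = {x \<in> region k \<times> K. real (snd x) \<in> W}"
    by auto
  finally show "openin (atlas_topology (sheets (RA k) K)) {x \<in> region k \<times> K. real (snd x) \<in> W}" .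
qed auto

text \<open>A deck transformation cannot change the sheet along an orbit, because orbits are connected.\<close>

lemma deck_equivariant:
  assumes g: "\<gamma> \<in> deck_group (sheets (RA k) K) fst" and t: "t \<in> torus (tdirs k)" and x: "x \<in>
      region k \<times> K"
  shows "\<gamma> (act k t x) = act k t (\<gamma> x)"
proof -
  let ?C = "sheets (RA k) K" and ?T = "atlas_topology (sheets (RA k) K)"
  have g': "smooth_map ?C ?C \<gamma>" "\<And>y. y \<in> region k \<times> K \<Longrightarrow> fst (\<gamma> y) = fst y"
    using g by (auto simp: deck_group_def diffeo_def carrier_sheets_RA)
  have op: "open S" if "(S, \<sigma>) \<in> ?C" for S \<sigma>
    using etale.chart_open[OF etale.etale_sheets[OF etale_region[of k], of K]] that
    unfolding sheets_etale_atlas by blast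
  have gc: "continuous_map ?T ?T \<gamma>"
    by (rule smooth_map_imp_continuous_map[OF op op g'(1)])
  obtain m l where ml: "x = (m, l)" "m \<in> region k" "l \<in> K" using x by auto
  obtain i y N V where y: "i \<in> pindices" "y \<in> P i" "par i y = m" "open N" "y \<in> N" "N \<subseteq> P i"
      "bounded_linear V"
    "\<And>w. w \<in> N \<Longrightarrow> par i w \<in> region k"
    "\<And>w \<theta>. w \<in> N \<Longrightarrow> w + V \<theta> \<in> P i \<and> par i (w + V \<theta>) = shift k \<theta> (par i w)"
    using shift_local[OF ml(2)] by metis
  interpret V: bounded_linear V by fact
  define \<theta> where "\<theta> = tlog t"
  \<comment> \<open>The orbit segment from \<open>x\<close> to \<open>act k t x\<close>. The deck
    transformation preserves the point of M, so only the sheet number of its value along this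
    segment is in question.\<close>
  define f where "f = (\<lambda>s. (shift k (s *\<^sub>R \<theta>) m, l))"
  have f: "f s = sheet_map par (i, l) (y + s *\<^sub>R V \<theta>)" for s
    using y(9)[OF y(5), of "s *\<^sub>R \<theta>"] y(3) by (simp add: f_def V.scaleR)
  have dom: "y + s *\<^sub>R V \<theta> \<in> sheet_dom (rdom k) (i, l)" for s
    using y(9)[OF y(5), of "s *\<^sub>R \<theta>"] y(3) shift_in_region[OF ml(2)] by (simp add: V.scaleR)
  have path: "continuous_map (top_of_set {0..1}) (top_of_set (sheet_dom (rdom k) (i, l))) (\<lambda>s. y +
      s *\<^sub>R V \<theta>)"
    unfolding continuous_map_in_subtopology
    using dom by (auto intro!: continuous_intros)
  have "continuous_map (top_of_set (sheet_dom (rdom k) (i, l))) ?T (sheet_map par (i, l))"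
    unfolding sheets_etale_atlas
    by (rule etale.continuous_map_param[OF etale.etale_sheets[OF etale_region]]) (use y ml in auto)
  from continuous_map_compose[OF path this]
  have "continuous_map (top_of_set {0..1}) ?T f"
    by (simp add: comp_def f[symmetric] del: split_conv prod.case)
  from continuous_map_compose[OF continuous_map_compose[OF this gc] sheet_number_continuous]
  have "continuous_on {0..1} (\<lambda>s. real (snd (\<gamma> (f s))))"
    by (simp add: comp_def)
  then have "(\<lambda>s. real (snd (\<gamma> (f s)))) constant_on {0..1::real}"
  proof (rule continuous_discrete_range_constant[OF connected_Icc])
    fix s
    \<comment> \<open>Distinct sheet numbers are at distance at least 1, which is the gap demanded
      of a discrete range.\<close>
    have "1 \<le> norm (real a - real b)" if "real a \<noteq> real b" for a b
      using that by (auto simp: abs_if)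
    then show "\<exists>e>0. \<forall>r. r \<in> {0..1} \<and> real (snd (\<gamma> (f r))) \<noteq> real (snd (\<gamma> (f s))) \<longrightarrow>
        e \<le> norm (real (snd (\<gamma> (f r))) - real (snd (\<gamma> (f s))))"
      by (intro exI[of _ 1]) auto
  qed
  then obtain r where r: "\<And>s. s \<in> {0..1} \<Longrightarrow> real (snd (\<gamma> (f s))) = r"
    unfolding constant_on_def by blast
  have "snd (\<gamma> (f 1)) = snd (\<gamma> (f 0))"
    using r[of 1] r[of 0] by simp
  moreover have "f 0 = x" "f 1 = act k t x"
    using ml by (simp_all add: f_def act_def \<theta>_def shift_0)
  moreover have "fst (\<gamma> (act k t x)) = shift k \<theta> m" "fst (\<gamma> x) = m"
    using g'(2) x ml shift_in_region by (simp_all add: act_def \<theta>_def)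
  ultimately show ?thesis
    by (simp add: act_def \<theta>_def prod_eq_iff)
qed

text \<open>Because \<open>tlog\<close> is discontinuous, continuity is checked at each point with
  angles near \<open>tlog t0\<close>, supplied by \<open>torus_exp_open\<close>; periodicity makes
  the choice immaterial. The regions \<open>k\<close> and \<open>k'\<close> may differ because on a
  fibre product each torus also moves the component in the covering of the other.\<close>

lemma continuous_map_act:
  "continuous_map
     (prod_topology (top_of_set (torus (tdirs k))) (subtopology (atlas_topology (sheets (RA k')
         K)) {x. fst x \<in> region k}))
     (atlas_topology (sheets (RA k') K)) (\<lambda>(t, x). act k t x)"
  (is "continuous_map ?X ?Y ?f")
  unfolding continuous_map_eq_topcontinuous_at topcontinuous_at_def
proof (intro ballI conjI allI impI)
  have top: "topspace ?X = torus (tdirs k) \<times> {x \<in> region k' \<times> K. fst x \<in> region k}"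
    by (auto simp: topspace_sheets_RA)
  show "?f \<in> topspace ?X \<rightarrow> topspace ?Y"
    unfolding top topspace_sheets_RA using region_shift by (auto simp: act_def)
  fix z W assume z: "z \<in> topspace ?X" and W: "openin ?Y W \<and> ?f z \<in> W"
  obtain t0 m l where z': "z = (t0, (m, l))" "t0 \<in> torus (tdirs k)" "m \<in> region k'" "m \<in> region k"
      "l \<in> K"
    using z unfolding top by auto
  obtain i y N V where y: "i \<in> pindices" "y \<in> P i" "par i y = m" "open N" "y \<in> N" "N \<subseteq> P i"
      "bounded_linear V"
    "\<And>w. w \<in> N \<Longrightarrow> par i w \<in> region k"
    "\<And>w \<theta>. w \<in> N \<Longrightarrow> w + V \<theta> \<in> P i \<and> par i (w + V \<theta>) = shift k \<theta> (par i w)"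
    using shift_local[OF z'(4)] by metis
  interpret S: etale "pindices \<times> K" "sheet_dom (rdom k')" "sheet_map par"
    by (rule etale.etale_sheets[OF etale_region])
  have il: "(i, l) \<in> pindices \<times> K" using y z' by auto
  let ?O = "{w \<in> sheet_dom (rdom k') (i, l). sheet_map par (i, l) w \<in> W}"
  have O: "open ?O"
    using W il unfolding sheets_etale_atlas S.openin_iff by blast
  have "y + V (tlog t0) \<in> ?O"
    using y(9)[OF y(5), of "tlog t0"] y(3) z' W region_shift[OF z'(4)] by (auto simp: act_def)
  moreover have "open ((\<lambda>p. snd p + V (fst p)) -` ?O)"
    by (intro open_vimage O linear_continuous_on bounded_linear_add bounded_linear_snd
        bounded_linear_compose[OF y(7) bounded_linear_fst])
  ultimately obtain A B where AB: "open A" "open B" "tlog t0 \<in> A" "y \<in> B"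
      "A \<times> B \<subseteq> (\<lambda>p. snd p + V (fst p)) -` ?O"
    by (auto elim!: open_prod_elim)
  obtain N' where N': "open N'" "t0 \<in> N'" "\<And>t. t \<in> N' \<Longrightarrow> t \<in> torus (tdirs k) \<Longrightarrow> \<exists>\<theta>\<in>A. torus_exp
      (tdirs k) \<theta> = t"
    using torus_exp_open[OF z'(2) AB(1,3)] by metis
  define B' where "B' = B \<inter> N \<inter> rdom k' i"
  have B': "openin ?Y (sheet_map par (i, l) ` B')"
    unfolding sheets_etale_atlas
    by (rule S.open_image[OF il]) (use AB y S.open_dom[OF il] in \<open>auto simp: B'_def\<close>)
  show "\<exists>U. openin ?X U \<and> z \<in> U \<and> (\<forall>y\<in>U. ?f y \<in> W)"
  proof (intro exI conjI ballI)
    show "openin ?X ((torus (tdirs k) \<inter> N') \<times> ({x. fst x \<in> region k} \<inter> sheet_map par (i, l) ` B'))"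
      unfolding openin_prod_Times_iff using N'(1) B'
        by (auto simp: openin_subtopology_Int2 openin_open_Int)
    show "z \<in> (torus (tdirs k) \<inter> N') \<times> ({x. fst x \<in> region k} \<inter> sheet_map par (i, l) ` B')"
      using z' y AB N' by (auto simp: B'_def)
    fix q assume "q \<in> (torus (tdirs k) \<inter> N') \<times> ({x. fst x \<in> region k} \<inter> sheet_map par (i, l) ` B')"
    then obtain t w where q: "q = (t, (par i w, l))" "t \<in> torus (tdirs k)" "t \<in> N'" "w \<in> B'" by auto
    obtain \<theta> where th: "\<theta> \<in> A" "torus_exp (tdirs k) \<theta> = t" using N'(3)[OF q(3,2)] by auto
    have w: "w \<in> N" "w \<in> B" using q by (auto simp: B'_def)
    have "sheet_map par (i, l) (w + V \<theta>) \<in> W"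
      using AB(5) th(1) w by fastforce
    moreover have "?f q = sheet_map par (i, l) (w + V \<theta>)"
      using y(8,9)[OF w(1)] shift_torus_exp th(2) q by (auto simp: act_def)
    ultimately show "?f q \<in> W" by simp
  qed
qed auto

text \<open>
  The actions live on \<open>region True\<close> and \<open>region False\<close> themselves.  The one non-trivial covering
  asked for is obtained by taking two disjoint copies of \<open>region True\<close>: a Galois covering is not
  required to be connected.
\<close>

definition F_structure :: "(m_point, m_point \<times> nat, real ^ 6, 6) f_structure" where
  "F_structure = \<lparr>fs_num = 2, fs_open = \<lambda>i. region (i = 0),
     fs_cover = \<lambda>i. sheets (RA (i = 0)) (if i = 0 then {0, 1} else {0}), fs_proj = \<lambda>i. fst,
     fs_dirs = \<lambda>i. tdirs (i = 0), fs_act = \<lambda>i. act (i = 0), fs_aut = \<lambda>i \<gamma> t. t\<rparr>"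

lemma F_simps [simp]:
  "fs_num F_structure = 2" "fs_open F_structure i = region (i = 0)"
  "fs_cover F_structure i = sheets (RA (i = 0)) (if i = 0 then {0, 1} else {0})"
  "fs_proj F_structure i = fst" "fs_dirs F_structure i = tdirs (i = 0)"
  "fs_act F_structure i = act (i = 0)" "fs_aut F_structure i \<gamma> t = t"
  by (simp_all add: F_structure_def)

section \<open>Lifts of the actions to the fibre products\<close>

lemma fibre_productD:
  assumes "x \<in> fs_fibre_product F_structure I" "i \<in> I" "j \<in> I"
  shows "fst (x i) \<in> region (j = 0)" "fst (x i) = fst (x j)" "x \<in> extensional I"
    "x j \<in> region (j = 0) \<times> (if j = 0 then {0, 1} else {0})"
proof -
  have x: "x \<in> (\<Pi>\<^sub>E i\<in>I. region (i = 0) \<times> (if i = 0 then {0, 1} else {0}))"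
      "\<forall>i\<in>I. \<forall>j\<in>I. fst (x i) = fst (x j)"
    using assms(1) unfolding fs_fibre_product_def F_simps carrier_sheets_RA by blast+
  show eq: "fst (x i) = fst (x j)" using x(2) assms(2,3) by blast
  show xj: "x j \<in> region (j = 0) \<times> (if j = 0 then {0, 1} else {0})"
    by (rule PiE_mem[OF x(1) assms(3)])
  show "fst (x i) \<in> region (j = 0)" using xj unfolding eq by (simp only: mem_Times_iff)
  show "x \<in> extensional I" using x(1) by (simp add: PiE_def)
qed

text \<open>A point of the fibre product is a point of M in all the regions together with one sheet
  number for each index. Each action comes from maps of M, so its lift moves all components
  simultaneously, which keeps them over a common point, and leaves the sheet numbers alone.
  Commutation is then \<open>shift_commute\<close>.\<close>

lemma lifts_commute: "fs_lifts_commute F_structure I"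
  unfolding fs_lifts_commute_def F_simps carrier_sheets_RA
proof (intro conjI)
  show "\<forall>i\<in>I. \<forall>t\<in>torus (tdirs (i = 0)). \<forall>x\<in>region (i = 0) \<times> (if i = 0 then {0, 1} else {0}).
      fst x \<in> (\<Inter>j\<in>I. region (j = 0)) \<longrightarrow> fst (act (i = 0) t x) \<in> (\<Inter>j\<in>I. region (j = 0))"
    using region_shift by (auto simp: act_def)
  define \<psi> where "\<psi> = (\<lambda>(i::nat) t x. \<lambda>j\<in>I. act (i = 0) t (x j :: m_point \<times> nat))"
  let ?X = "fs_fibre_product F_structure I" and ?T = "fs_fibre_topology F_structure I"
  have in_X: "\<psi> i t x \<in> ?X" if "i \<in> I" "t \<in> torus (tdirs (i = 0))" "x \<in> ?X" for i t x
  proof -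
    have a: "act (i = 0) t (x j) \<in> region (j = 0) \<times> (if j = 0 then {0, 1} else {0})" if j: "j \<in> I"
        for j
      using fibre_productD[OF \<open>x \<in> ?X\<close> j \<open>i \<in> I\<close>] fibre_productD[OF \<open>x \<in> ?X\<close> j j] region_shift
      by (auto simp: act_def)
    have b: "fst (act (i = 0) t (x j)) = fst (act (i = 0) t (x j'))" if "j \<in> I" "j' \<in> I" for j j'
      using fibre_productD(2)[OF \<open>x \<in> ?X\<close> that] by (simp add: act_def)
    show ?thesis
      unfolding fs_fibre_product_def F_simps carrier_sheets_RA
    proof (intro CollectI conjI ballI)
      show "\<psi> i t x \<in> (\<Pi>\<^sub>E j\<in>I. region (j = 0) \<times> (if j = 0 then {0, 1} else {0}))"
        unfolding \<psi>_def restrict_PiE_iff using a by blast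
      show "fst (\<psi> i t x j) = fst (\<psi> i t x j')" if "j \<in> I" "j' \<in> I" for j j'
        using b[OF that] that by (simp add: \<psi>_def)
    qed
  qed
  have reg: "fst (x j) \<in> region (i = 0)" if "x \<in> ?X" "i \<in> I" "j \<in> I" for x i j
    using fibre_productD(1)[OF that(1,3,2)] .
  have cont: "continuous_map (prod_topology (top_of_set (torus (tdirs (i = 0)))) ?T) ?T (\<lambda>(t, x).
      \<psi> i t x)"
    if i: "i \<in> I" for i
  proof -
    let ?Z = "prod_topology (top_of_set (torus (tdirs (i = 0)))) ?T"
    have topT: "topspace ?T \<subseteq> ?X" by (auto simp: fs_fibre_topology_def)
    have comp: "continuous_map ?Z (atlas_topology (fs_cover F_structure j)) (\<lambda>z. act (i = 0) (fst
        z) (snd z j))"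
      if j: "j \<in> I" for j
    proof -
      let ?Y = "atlas_topology (fs_cover F_structure j)"
      have "continuous_map ?T ?Y (\<lambda>x. x j)"
        unfolding fs_fibre_topology_def
        by (rule continuous_map_from_subtopology[OF continuous_map_product_projection[OF j]])
      from continuous_map_compose[OF continuous_map_snd this]
      have "continuous_map ?Z ?Y (\<lambda>z. snd z j)" by (simp only: comp_def)
      then have "continuous_map ?Z (subtopology ?Y {x. fst x \<in> region (i = 0)}) (\<lambda>z. snd z j)"
        by (rule continuous_map_into_subtopology) (use topT reg[OF _ i j] in auto)
      from continuous_map_pairedI[OF continuous_map_fst this]
      have "continuous_map ?Z (prod_topology (top_of_set (torus (tdirs (i = 0))))
          (subtopology ?Y {x. fst x \<in> region (i = 0)})) (\<lambda>z. (fst z, snd z j))" .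
      from continuous_map_compose[OF this continuous_map_act[of "i = 0" "j = 0" "if j = 0 then {0,
          1} else {0}", folded F_simps(3)]]
      show ?thesis by (simp add: comp_def del: F_simps)
    qed
    show ?thesis
      unfolding fs_fibre_topology_def[of _ I] continuous_map_in_subtopology
          continuous_map_componentwise
      unfolding fs_fibre_topology_def[of _ I, symmetric]
    proof (intro conjI ballI)
      show "(\<lambda>(t, x). \<psi> i t x) \<in> topspace ?Z \<rightarrow> ?X"
        using topT in_X[OF i] by auto
      show "(\<lambda>(t, x). \<psi> i t x) ` topspace ?Z \<subseteq> extensional I"
        by (auto simp: \<psi>_def)
      fix j assume j: "j \<in> I"
      show "continuous_map ?Z (atlas_topology (fs_cover F_structure j)) (\<lambda>z. (case z of (t, x) \<Rightarrow> \<psi>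
          i t x) j)"
        using comp[OF j] j by (simp add: \<psi>_def case_prod_beta)
    qed
  qed
  have ext: "x = restrict x I" if "x \<in> ?X" for x
    using that by (simp add: fs_fibre_product_def extensional_restrict PiE_def)
  have action: "torus_action (tdirs (i = 0)) ?X (\<psi> i)" if i: "i \<in> I" for i
    unfolding torus_action_def
  proof (intro conjI ballI)
    show "\<psi> i t x \<in> ?X" if "t \<in> torus (tdirs (i = 0))" "x \<in> ?X" for t x
      using in_X[OF i that] .
    show "\<psi> i 1 x = x" if "x \<in> ?X" for x
    proof -
      have "act (i = 0) 1 (x j) = x j" if "j \<in> I" for j
        using shift_tlog_1[OF reg[OF \<open>x \<in> ?X\<close> i that]] by (simp add: act_def)
      then have "\<psi> i 1 x = restrict x I"
        unfolding \<psi>_def by (rule restrict_ext)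
      then show ?thesis using ext[OF that] by simp
    qed
    show "\<psi> i (s * t) x = \<psi> i s (\<psi> i t x)"
      if st: "s \<in> torus (tdirs (i = 0))" "t \<in> torus (tdirs (i = 0))" and x: "x \<in> ?X" for s t x
      unfolding \<psi>_def
    proof (rule restrict_ext)
      fix j assume j: "j \<in> I"
      show "act (i = 0) (s * t) (x j) = act (i = 0) s ((\<lambda>j\<in>I. act (i = 0) t (x j)) j)"
        using shift_tlog_mult[OF reg[OF x i j] st] j by (simp add: act_def)
    qed
  qed
  have commute: "\<psi> i s (\<psi> j t x) = \<psi> j t (\<psi> i s x)" if i: "i \<in> I" and j: "j \<in> I" and x: "x \<in> ?X"
      for i j s t x
    unfolding \<psi>_def
  proof (rule restrict_ext)
    fix l assume l: "l \<in> I"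
    show "act (i = 0) s ((\<lambda>j'\<in>I. act (j = 0) t (x j')) l) = act (j = 0) t ((\<lambda>j\<in>I. act (i = 0) s (x
        j)) l)"
      using shift_commute[OF reg[OF x i l] reg[OF x j l]] l by (simp add: act_def)
  qed
  have lift: "\<psi> i t x i = act (i = 0) t (x i)" if "i \<in> I" for i t x
    using that by (simp add: \<psi>_def)
  show "\<exists>\<psi>. (\<forall>i\<in>I. torus_action (tdirs (i = 0)) ?X (\<psi> i) \<and>
      continuous_map (prod_topology (top_of_set (torus (tdirs (i = 0)))) ?T) ?T (\<lambda>(t, x). \<psi> i t x) \<and>
      (\<forall>t\<in>torus (tdirs (i = 0)). \<forall>x\<in>?X. \<psi> i t x i = act (i = 0) t (x i))) \<and>
      (\<forall>i\<in>I. \<forall>j\<in>I. \<forall>s\<in>torus (tdirs (i = 0)). \<forall>t\<in>torus (tdirs (j = 0)). \<forall>x\<in>?X. \<psi> i s (\<psi> j t x) = \<psi>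
          j t (\<psi> i s x))"
    by (intro exI[of _ \<psi>] conjI ballI action cont lift commute)
qed

text \<open>The homomorphisms into the automorphism groups of the tori are trivial, since by
  \<open>deck_equivariant\<close> the deck transformations commute with the actions.\<close>

lemma is_f_structure: "is_f_structure M.A F_structure"
  unfolding is_f_structure_def
proof (intro conjI allI impI ballI)
  show "(\<Union>i<fs_num F_structure. fs_open F_structure i) = carrier_of M.A"
    using regions_cover by (auto simp: numeral_2_eq_2 lessThan_Suc)
  fix i assume "i < fs_num F_structure"
  show "openin (atlas_topology M.A) (fs_open F_structure i)" by (simp add: openin_region)
  let ?K = "if i = 0 then {0, 1} else {0 :: nat}"
  have "Hausdorff_space (atlas_topology (RA (i = 0)))"
    using M.Hausdorff_restrict[OF openin_region Hausdorff] by (simp add: restrict_region)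
  moreover have "countable pindices"
    using finite_centres by (simp add: pindices_def countable_finite)
  ultimately show "smooth_manifold (fs_cover F_structure i)"
    unfolding F_simps by (rule etale.smooth_manifold_sheets[OF etale_region])
  show "finite_galois_covering (fs_cover F_structure i) (restrict_atlas M.A (fs_open F_structure
      i)) (fs_proj F_structure i)"
    unfolding F_simps restrict_region
      by (rule etale.finite_galois_covering_sheets[OF etale_region]) auto
  show "fs_dirs F_structure i \<noteq> {}" by (simp add: tdirs_def)
  show "smooth_torus_action (fs_dirs F_structure i) (fs_cover F_structure i) (fs_act F_structure i)"
    unfolding F_simps by (rule smooth_torus_action_act)
  have "{t \<in> torus (fs_dirs F_structure i). \<forall>x\<in>carrier_of (fs_cover F_structure i). fs_act
      F_structure i t x = x} \<subseteq> {1}"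
    unfolding F_simps carrier_sheets_RA using act_kernel[of ?K _ "i = 0"] by auto
  then show "finite {t \<in> torus (fs_dirs F_structure i). \<forall>x\<in>carrier_of (fs_cover F_structure i).
      fs_act F_structure i t x = x}"
    by (rule finite_subset) simp
  fix \<gamma> assume \<gamma>: "\<gamma> \<in> deck_group (fs_cover F_structure i) (fs_proj F_structure i)"
  show "torus_aut (fs_dirs F_structure i) (fs_aut F_structure i \<gamma>)"
    by (simp add: torus_aut_def bij_betw_def inj_on_def)
  show "fs_aut F_structure i (compose (carrier_of (fs_cover F_structure i)) \<gamma> \<delta>) t =
      fs_aut F_structure i \<gamma> (fs_aut F_structure i \<delta> t)" for \<delta> t
    by simp
  show "\<gamma> (fs_act F_structure i t x) = fs_act F_structure i (fs_aut F_structure i \<gamma> t) (\<gamma> x)"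
    if "t \<in> torus (fs_dirs F_structure i)" "x \<in> carrier_of (fs_cover F_structure i)" for t x
    using deck_equivariant[of \<gamma> "i = 0" ?K t x] \<gamma> that by (simp add: carrier_sheets_RA)
qed (rule lifts_commute)

lemma exactly_one_nontrivial: "\<exists>!i. i < fs_num F_structure \<and> \<not> trivial_covering F_structure i"
proof (rule ex1I[of _ 0])
  have "(par None generic_point, 0) \<in> region True \<times> {0, 1 :: nat}" "(par None generic_point, 1) \<in>
      region True \<times> {0, 1 :: nat}"
    using generic_point(2) by auto
  then have "\<not> inj_on fst (region True \<times> {0, 1 :: nat})"
    by (metis fst_conv inj_onD prod.inject zero_neq_one)
  then show "0 < fs_num F_structure \<and> \<not> trivial_covering F_structure 0"
    by (simp add: trivial_covering_def carrier_sheets_RA)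
  fix i assume i: "i < fs_num F_structure \<and> \<not> trivial_covering F_structure i"
  show "i = 0"
  proof (rule ccontr)
    assume "i \<noteq> 0"
    then have "trivial_covering F_structure i"
      by (auto simp: trivial_covering_def carrier_sheets_RA inj_on_def)
    with i show False by simp
  qed
qed

end

section \<open>Polarization\<close>

lemma dim_coordinate_subspace: "dim {w :: real ^ 6. \<forall>j. j \<notin> J \<longrightarrow> w $ j = 0} = card J"
  using dim_substandard_cart[where 'a = real and 'n = 6, of J] by (simp add: dim_vec_eq)

lemma subspace_coordinate: "subspace {w :: real ^ 6. \<forall>j. j \<notin> J \<longrightarrow> w $ j = 0}"
  by (simp add: subspace_def)

context resolution
begin

text \<open>The projection forgets the sheet number, and sheet 0 occurs in both coverings; angles
  replace torus elements by periodicity.\<close>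

lemma fs_invariant_iff:
  "fs_invariant F_structure S \<longleftrightarrow> (\<forall>k. \<forall>m\<in>S \<inter> region k. \<forall>\<theta>. shift k \<theta> m \<in> S)"
proof
  assume inv: "fs_invariant F_structure S"
  show "\<forall>k. \<forall>m\<in>S \<inter> region k. \<forall>\<theta>. shift k \<theta> m \<in> S"
  proof (intro allI ballI)
    fix k m \<theta> assume m: "m \<in> S \<inter> region k"
    define i :: nat where "i = (if k then 0 else 1)"
    have i: "i < 2" "(i = 0) = k" by (auto simp: i_def)
    have "(m, 0) \<in> region k \<times> (if i = 0 then {0, 1} else {0})" using m by auto
    then have "fst (act k (torus_exp (tdirs k) \<theta>) (m, 0)) \<in> S"
      using inv[unfolded fs_invariant_def F_simps carrier_sheets_RA, rule_format, of i m "(m, 0)"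
          "torus_exp (tdirs k) \<theta>"]
        m torus_exp_in[of "tdirs k" \<theta>] i by (cases k) simp_all
    then show "shift k \<theta> m \<in> S"
      using m by (simp add: act_def shift_torus_exp)
  qed
next
  assume "\<forall>k. \<forall>m\<in>S \<inter> region k. \<forall>\<theta>. shift k \<theta> m \<in> S"
  then show "fs_invariant F_structure S"
    by (auto simp: fs_invariant_def act_def)
qed

lemma fs_orbitI:
  assumes "R \<subseteq> carrier_of M.A" "p \<in> R" "\<And>k m \<theta>. m \<in> R \<Longrightarrow> m \<in> region k \<Longrightarrow> shift k \<theta> m \<in> R"
    "\<And>S. p \<in> S \<Longrightarrow> (\<And>k m \<theta>. m \<in> S \<Longrightarrow> m \<in> region k \<Longrightarrow> shift k \<theta> m \<in> S) \<Longrightarrow> R \<subseteq> S"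
  shows "fs_orbit M.A F_structure p = R"
  unfolding fs_orbit_def fs_invariant_iff
proof
  show "\<Inter>{S. S \<subseteq> carrier_of M.A \<and> (\<forall>k. \<forall>m\<in>S \<inter> region k. \<forall>\<theta>. shift k \<theta> m \<in> S) \<and> p \<in> S} \<subseteq> R"
    using assms(1-3) by (intro Inter_lower) auto
  show "R \<subseteq> \<Inter>{S. S \<subseteq> carrier_of M.A \<and> (\<forall>k. \<forall>m\<in>S \<inter> region k. \<forall>\<theta>. shift k \<theta> m \<in> S) \<and> p \<in> S}"
    using assms(4) by (intro Inter_greatest) auto
qed

text \<open>Translations preserve membership in both regions by \<open>region_shift\<close>, so
  starting outside the other region only one torus ever acts.\<close>

lemma orbit_one_region:
  assumes "m \<in> region k" "m \<notin> region (\<not> k)"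
  shows "fs_orbit M.A F_structure m = range (\<lambda>\<theta>. shift k \<theta> m)"
proof (rule fs_orbitI)
  show "range (\<lambda>\<theta>. shift k \<theta> m) \<subseteq> carrier_of M.A"
    using shift_in_region[OF assms(1)] region_subset by blast
  show "m \<in> range (\<lambda>\<theta>. shift k \<theta> m)"
    using shift_0[OF assms(1)] by (metis rangeI)
  show "shift k' \<theta> m' \<in> range (\<lambda>\<theta>. shift k \<theta> m)" if m': "m' \<in> range (\<lambda>\<theta>. shift k \<theta> m)" "m' \<in>
      region k'" for k' m' \<theta>
  proof -
    obtain \<theta>' where th: "m' = shift k \<theta>' m" using m' by auto
    then have "k' = k" using m'(2) region_shift[OF assms(1)] assms(2) by (cases k; cases k') auto
    then have "shift k' \<theta> m' = shift k (\<theta> + \<theta>') m" using th shift_add[OF assms(1)] by simp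
    then show ?thesis by (metis rangeI)
  qed
  show "range (\<lambda>\<theta>. shift k \<theta> m) \<subseteq> S"
    if "m \<in> S" "\<And>k m \<theta>. m \<in> S \<Longrightarrow> m \<in> region k \<Longrightarrow> shift k \<theta> m \<in> S" for S
    using that assms(1) by blast
qed

text \<open>The two kinds of translations commute over the intersection, so any word in them reduces
  to one translation of each kind.\<close>

lemma orbit_two_regions:
  assumes "m \<in> region True" "m \<in> region False"
  shows "fs_orbit M.A F_structure m = range (\<lambda>(\<theta>, \<theta>'). shift True \<theta> (shift False \<theta>' m))" (is "_ =
      ?R")
proof (rule fs_orbitI)
  have r: "shift False \<theta> m \<in> region k" "shift True \<theta> m \<in> region k" for \<theta> k
    using assms region_shift[OF assms(1)] region_shift[OF assms(2)] by (cases k; simp)+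
  then have R: "shift True \<theta> (shift False \<theta>' m) \<in> region k" for \<theta> \<theta>' k
    using region_shift by blast
  show "?R \<subseteq> carrier_of M.A" using R[of _ _ True] region_subset by auto
  have "m = (\<lambda>(\<theta>, \<theta>'). shift True \<theta> (shift False \<theta>' m)) (0, 0)"
    using assms by (simp add: shift_0)
  then show "m \<in> ?R" by (rule range_eqI)
  show "shift k' \<theta> m' \<in> ?R" if m': "m' \<in> ?R" for k' m' \<theta>
  proof -
    obtain a b where ab: "m' = shift True a (shift False b m)" using m' by auto
    have "shift k' \<theta> m' = (\<lambda>(\<theta>, \<theta>'). shift True \<theta> (shift False \<theta>' m)) (if k' then (\<theta> + a, b) else
        (a, \<theta> + b))"
    proof (cases k')
      case True
      then show ?thesis using ab shift_add[OF r(1), of True \<theta> a b] by simp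
    next
      case False
      have "shift False \<theta> (shift True a (shift False b m)) = shift True a (shift False \<theta> (shift
          False b m))"
        by (rule shift_commute) (rule r)+
      then show ?thesis using False ab shift_add[OF assms(2), of \<theta> b] by simp
    qed
    then show ?thesis by (metis rangeI)
  qed
  show "?R \<subseteq> S" if "m \<in> S" "\<And>k m \<theta>. m \<in> S \<Longrightarrow> m \<in> region k \<Longrightarrow> shift k \<theta> m \<in> S" for S
    using that assms r by auto
qed

text \<open>Group elements act on each coordinate separately, and points of the coordinate plane
  through \<open>x\<close> differ from it only in the directions \<open>J\<close>.
  \<open>crystal_gap\<close> therefore bounds away, for all group elements at once, every other
  branch of the image of the plane.\<close>

lemma slice_regular:
  assumes x: "x \<in> P None"
  shows "\<exists>i y L r. i \<in> pindices \<and> y \<in> P i \<and> par i y = par None x \<and> subspace L \<and> dim L = card J \<and> 0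
      < r \<and>
    (\<forall>w. norm w < r \<longrightarrow> y + w \<in> P i \<longrightarrow>
      (par i (y + w) \<in> {par None (x + v) | v. \<forall>j. j \<notin> J \<longrightarrow> v $ j = 0} \<longleftrightarrow> w \<in> L))"
proof -
  let ?L = "{w :: real ^ 6. \<forall>j. j \<notin> J \<longrightarrow> w $ j = 0}"
  obtain r where r: "0 < r"
    "\<And>e n i. crystal e n \<Longrightarrow> \<bar>(e * x + n) $ i - x $ i\<bar> < r \<Longrightarrow> (e * x + n) $ i = x $ i"
    using crystal_gap[of x x] by blast
  have "w \<in> ?L" if w: "norm w < r" "par None (x + w) \<in> {par None (x + v) | v. v \<in> ?L}" for w
  proof -
    obtain v where v: "v \<in> ?L" "par None (x + w) = par None (x + v)" using w(2) by blast
    then have "orb_rel (x + v) (x + w)" using orb_rel_sym by (auto simp: par_def orb_eq_iff)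
    then obtain e n where en: "crystal e n" "x + w = e * (x + v) + n" by (auto simp: orb_rel_def)
    have "w $ j = 0" if j: "j \<notin> J" for j
    proof -
      \<comment> \<open>Outside \<open>J\<close> the vector v drops out, and w_j becomes the amount
        by which a group element moves the j-th coordinate of \<open>x\<close>; the gap forces it to
        vanish when w is small.\<close>
      have *: "x $ j + w $ j = (e * x + n) $ j"
        using arg_cong[OF en(2), of "\<lambda>x. x $ j"] v(1) j by (simp add: distrib_left)
      have "\<bar>w $ j\<bar> < r" using component_le_norm_cart[of w j] w(1) by simp
      moreover have "(e * x + n) $ j - x $ j = w $ j" using * by linarith
      ultimately have "(e * x + n) $ j = x $ j" by (intro r(2)[OF en(1)]) (simp only:)
      then show ?thesis using * by simp
    qed
    then show ?thesis by simp
  qed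
  then have "\<forall>w. norm w < r \<longrightarrow> x + w \<in> P None \<longrightarrow> (par None (x + w) \<in> {par None (x + v) | v. v \<in> ?L}
      \<longleftrightarrow> w \<in> ?L)"
    by blast
  then show ?thesis
    using x r(1) None_pindices dim_coordinate_subspace[of J] subspace_coordinate[of J]
    by (intro exI[of _ None] exI[of _ x] exI[of _ ?L] exI[of _ r]) simp
qed

text \<open>Multiplying the angles by the sign of \<open>height k\<close>, whose square is 1,
  removes the sign from the translation.\<close>

lemma range_shift_regular:
  assumes "height k x \<noteq> 0"
  shows "range (\<lambda>\<theta>. shift k \<theta> (par None x)) = {par None (x + v) | v. \<forall>j. j \<notin> tdirs k \<longrightarrow> v $ j = 0}"
proof
  show "range (\<lambda>\<theta>. shift k \<theta> (par None x)) \<subseteq> {par None (x + v) | v. \<forall>j. j \<notin> tdirs k \<longrightarrow> v $ j = 0}"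
    by (auto simp: shift_None tmask_def intro!: exI[of _ "sgn (height k x) *\<^sub>R tmask k _"])
  show "{par None (x + v) | v. \<forall>j. j \<notin> tdirs k \<longrightarrow> v $ j = 0} \<subseteq> range (\<lambda>\<theta>. shift k \<theta> (par None x))"
  proof clarify
    fix v :: "real ^ 6" assume v: "\<forall>j. j \<notin> tdirs k \<longrightarrow> v $ j = 0"
    then have "tmask k v = v" by (auto simp: tmask_def vec_eq_iff)
    then have "sgn (height k x) *\<^sub>R tmask k (sgn (height k x) *\<^sub>R v) = v"
      using assms by (simp add: tmask_scale sgn_if)
    then have "shift k (sgn (height k x) *\<^sub>R v) (par None x) = par None (x + v)"
      by (simp add: shift_None)
    then show "par None (x + v) \<in> range (\<lambda>\<theta>. shift k \<theta> (par None x))" by (metis rangeI)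
  qed
qed

text \<open>In a tube chart translations change only the two torus coordinates, and
  \<open>par_Some_inj\<close> recovers \<open>zeta\<close> and \<open>slope\<close> from the point.
  The orbit is thus a coordinate plane in the entire chart domain, and any radius will do.\<close>

lemma slice_exceptional:
  assumes p: "p \<in> centres" "k = (p \<in> alpha_centres)" and y: "y \<in> P (Some (p, b))"
  shows "\<exists>i y' L r. i \<in> pindices \<and> y' \<in> P i \<and> par i y' = par (Some (p, b)) y \<and> subspace L \<and> dim L
      = 2 \<and> 0 < r \<and>
    (\<forall>w. norm w < r \<longrightarrow> y' + w \<in> P i \<longrightarrow>
      (par i (y' + w) \<in> range (\<lambda>\<theta>. shift k \<theta> (par (Some (p, b)) y)) \<longleftrightarrow> w \<in> L))"
proof -
  let ?L = "{w :: real ^ 6. \<forall>j. j \<notin> {1, 2} \<longrightarrow> w $ j = 0}"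
  have L: "w \<in> ?L \<longleftrightarrow> zeta w = 0 \<and> slope w = 0" for w
    by (auto simp: zeta_def slope_def forall_6 complex_eq_iff)
  have add: "zeta (y + w) = zeta y + zeta w" "slope (y + w) = slope y + slope w" for w
    by (simp_all add: zeta_def slope_def complex_eq_iff)
  have "par (Some (p, b)) (y + w) \<in> range (\<lambda>\<theta>. shift k \<theta> (par (Some (p, b)) y)) \<longleftrightarrow> w \<in> ?L"
    if w: "y + w \<in> P (Some (p, b))" for w
  proof
    assume "par (Some (p, b)) (y + w) \<in> range (\<lambda>\<theta>. shift k \<theta> (par (Some (p, b)) y))"
    then obtain \<theta> where "par (Some (p, b)) (y + w) = par (Some (p, b)) (y + mk (fib k \<theta>) 0 0)"
      using shift_Some[OF p y] by auto
    then have "eh_chart b (zeta (y + mk (fib k \<theta>) 0 0), slope (y + mk (fib k \<theta>) 0 0)) =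
        eh_chart b (zeta (y + w), slope (y + w))"
      using par_Some_inj[OF p(1) p(1), of "y + w" b "y + mk (fib k \<theta>) 0 0" b] w y pdom_add by simp
    then show "w \<in> ?L" unfolding L by (simp add: mk_add eh_chart_eq_iff add)
  next
    assume w: "w \<in> ?L"
    define \<theta> where "\<theta> = (if k then vector [0, 0, 0, 0, w $ 1, w $ 2] else vector [0, 0, w $ 1, w $
        2, 0, 0] :: real ^ 6)"
    have "fib k \<theta> = (w $ 1, w $ 2)" by (simp add: fib_def \<theta>_def)
    then have "mk (fib k \<theta>) 0 0 = w" using w by (simp add: mk_def vec_eq_iff forall_6)
    then have "shift k \<theta> (par (Some (p, b)) y) = par (Some (p, b)) (y + w)"
      using shift_Some[OF p y, of \<theta>] by simp
    then show "par (Some (p, b)) (y + w) \<in> range (\<lambda>\<theta>. shift k \<theta> (par (Some (p, b)) y))"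
      by (metis rangeI)
  qed
  moreover have "dim ?L = 2" unfolding dim_coordinate_subspace by simp
  ultimately show ?thesis
    using y subspace_coordinate[of "{1, 2}"] Some_pindices[OF p(1)]
    by (intro exI[of _ "Some (p, b)"] exI[of _ y] exI[of _ ?L] exI[of _ 1]) simp
qed

lemma card_tdirs: "card (tdirs k) = 2" "card (tdirs True \<union> tdirs False) = 4"
  by (simp_all add: tdirs_def)

lemma embedded_one_region:
  assumes "m \<in> region k"
  shows "embedded_submanifold M.A 2 (range (\<lambda>\<theta>. shift k \<theta> m))"
proof (rule M.embedded_submanifold_slice)
  fix p assume "p \<in> range (\<lambda>\<theta>. shift k \<theta> m)"
  then obtain \<theta>0 where p: "p = shift k \<theta>0 m" by auto
  then have pr: "p \<in> region k" using shift_in_region[OF assms] by simp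
  \<comment> \<open>The orbit is homogeneous: it is also the orbit of \<open>p\<close>, so a slice
    has to be found only through the base point of an orbit.\<close>
  have R: "range (\<lambda>\<theta>. shift k \<theta> m) = range (\<lambda>\<theta>. shift k \<theta> p)"
  proof
    show "range (\<lambda>\<theta>. shift k \<theta> p) \<subseteq> range (\<lambda>\<theta>. shift k \<theta> m)"
      using shift_add[OF assms, of _ \<theta>0] unfolding p by (metis image_subsetI rangeI)
    have "shift k \<theta> m = shift k (\<theta> - \<theta>0) p" for \<theta>
      using shift_add[OF assms, of "\<theta> - \<theta>0" \<theta>0] unfolding p by simp
    then show "range (\<lambda>\<theta>. shift k \<theta> m) \<subseteq> range (\<lambda>\<theta>. shift k \<theta> p)" by auto
  qed
  from pr show "\<exists>i x L r. i \<in> pindices \<and> x \<in> P i \<and> par i x = p \<and> subspace L \<and> dim L = 2 \<and> 0 < r \<and>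
      (\<forall>w. norm w < r \<longrightarrow> x + w \<in> P i \<longrightarrow> (par i (x + w) \<in> range (\<lambda>\<theta>. shift k \<theta> m) \<longleftrightarrow> w \<in> L))"
    unfolding R
  proof (cases rule: region_cases)
    case (regular x)
    show "\<exists>i x L r. i \<in> pindices \<and> x \<in> P i \<and> par i x = p \<and> subspace L \<and> dim L = 2 \<and> 0 < r \<and>
      (\<forall>w. norm w < r \<longrightarrow> x + w \<in> P i \<longrightarrow> (par i (x + w) \<in> range (\<lambda>\<theta>. shift k \<theta> p) \<longleftrightarrow> w \<in> L))"
      unfolding regular(3) range_shift_regular[OF regular(2)]
      using slice_regular[OF regular(1), of "tdirs k"] unfolding card_tdirs .
  next
    case (exceptional q b y)
    show "\<exists>i x L r. i \<in> pindices \<and> x \<in> P i \<and> par i x = p \<and> subspace L \<and> dim L = 2 \<and> 0 < r \<and>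
      (\<forall>w. norm w < r \<longrightarrow> x + w \<in> P i \<longrightarrow> (par i (x + w) \<in> range (\<lambda>\<theta>. shift k \<theta> p) \<longleftrightarrow> w \<in> L))"
      unfolding exceptional(5) by (rule slice_exceptional[OF exceptional(1-3)])
  qed
qed

text \<open>An exceptional point lies in only one region, so here the orbifold parametrization
  suffices. Both signs are determined by x_1, which the translations preserve, and the orbit is the
  image of an affine 4-plane.\<close>

lemma embedded_two_regions:
  assumes m: "m \<in> region True" "m \<in> region False"
  shows "embedded_submanifold M.A 4 (range (\<lambda>(\<theta>, \<theta>'). shift True \<theta> (shift False \<theta>' m)))" (is
      "embedded_submanifold _ _ ?R")
proof (rule M.embedded_submanifold_slice)
  let ?J = "tdirs True \<union> tdirs False"
  obtain x where x: "x \<in> P None" "height True x \<noteq> 0" "m = par None x"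
    using m(1)
  proof (cases rule: region_cases)
    case (exceptional p b y)
    then show ?thesis using m(2) region_exceptional by auto
  qed
  then have h: "height k x \<noteq> 0" for k using region_None m(2) by (cases k) auto
  have R: "?R = {par None (x + v) | v. \<forall>j. j \<notin> ?J \<longrightarrow> v $ j = 0}"
  proof
    have hc: "height k (x + c *\<^sub>R tmask l \<theta>) = height k x" for k l c \<theta> by (rule height_cong) simp
    show "?R \<subseteq> {par None (x + v) | v. \<forall>j. j \<notin> ?J \<longrightarrow> v $ j = 0}"
    proof clarify
      fix \<theta> \<theta>'
      have "shift True \<theta> (shift False \<theta>' m) =
          par None (x + (sgn (height False x) *\<^sub>R tmask False \<theta>' + sgn (height True x) *\<^sub>R tmask
              True \<theta>))"
        by (simp add: x(3) shift_None hc add.assoc)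
      moreover have "\<forall>j. j \<notin> ?J \<longrightarrow>
          (sgn (height False x) *\<^sub>R tmask False \<theta>' + sgn (height True x) *\<^sub>R tmask True \<theta>) $ j = 0"
        by (simp add: tmask_def)
      ultimately show "\<exists>v. shift True \<theta> (shift False \<theta>' m) = par None (x + v) \<and> (\<forall>j. j \<notin> ?J \<longrightarrow> v $
          j = 0)"
        by blast
    qed
    show "{par None (x + v) | v. \<forall>j. j \<notin> ?J \<longrightarrow> v $ j = 0} \<subseteq> ?R"
    proof clarify
      fix v :: "real ^ 6" assume v: "\<forall>j. j \<notin> ?J \<longrightarrow> v $ j = 0"
      have "tmask False v + tmask True v = v"
        using v by (auto simp: vec_eq_iff tmask_def tdirs_def)
      moreover have "sgn (height k x) *\<^sub>R tmask k (sgn (height k x) *\<^sub>R v) = tmask k v" for k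
        using h[of k] by (simp add: tmask_scale sgn_if)
      ultimately have "par None (x + v) = (\<lambda>(\<theta>, \<theta>'). shift True \<theta> (shift False \<theta>' m))
          (sgn (height True x) *\<^sub>R v, sgn (height False x) *\<^sub>R v)"
        by (simp add: x(3) shift_None hc add.assoc)
      then show "par None (x + v) \<in> ?R" by (rule range_eqI)
    qed
  qed
  fix p assume "p \<in> ?R"
  then obtain v where v: "p = par None (x + v)" "\<forall>j. j \<notin> ?J \<longrightarrow> v $ j = 0" unfolding R by blast
  have "(v $ 1 = 0) \<and> v $ 2 = 0" using v(2) one_notin_tdirs by auto
  then have "x + v = (x + 1 *\<^sub>R tmask False v) + 1 *\<^sub>R tmask True v"
    using v(2) by (auto simp: vec_eq_iff tmask_def tdirs_def)
  moreover have "height True (x + 1 *\<^sub>R tmask False v) \<noteq> 0"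
    using h[of True] height_cong[of "x + 1 *\<^sub>R tmask False v" x True] by simp
  ultimately have xv: "x + v \<in> P None"
    using shift_regular_in[OF shift_regular_in[OF x(1) h]] by metis
  \<comment> \<open>The affine plane is recentred at its point \<open>x + v\<close>, through which
    the slice is taken.\<close>
  have "{par None (x + u) | u. \<forall>j. j \<notin> ?J \<longrightarrow> u $ j = 0} = {par None (x + v + u) | u. \<forall>j. j \<notin> ?J \<longrightarrow> u
      $ j = 0}"
  proof (intro subset_antisym; clarify)
    fix u :: "real ^ 6" assume u: "\<forall>j. j \<notin> ?J \<longrightarrow> u $ j = 0"
    show "\<exists>u'. par None (x + u) = par None (x + v + u') \<and> (\<forall>j. j \<notin> ?J \<longrightarrow> u' $ j = 0)"
      using u v(2) by (intro exI[of _ "u - v"]) simp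
    show "\<exists>u'. par None (x + v + u) = par None (x + u') \<and> (\<forall>j. j \<notin> ?J \<longrightarrow> u' $ j = 0)"
      using u v(2) by (intro exI[of _ "v + u"]) (simp add: add.assoc)
  qed
  then show "\<exists>i x L r. i \<in> pindices \<and> x \<in> P i \<and> par i x = p \<and> subspace L \<and> dim L = 4 \<and> 0 < r \<and>
      (\<forall>w. norm w < r \<longrightarrow> x + w \<in> P i \<longrightarrow> (par i (x + w) \<in> ?R \<longleftrightarrow> w \<in> L))"
    using slice_regular[OF xv, of ?J] unfolding R v(1) card_tdirs by simp
qed

lemma polarized: "polarized M.A F_structure"
  unfolding polarized_def F_simps
proof (intro allI impI, elim conjE)
  fix I :: "nat set" assume I: "I \<noteq> {}" "I \<subseteq> {..<2}"
  have u: "{..<2::nat} = {0, 1}" by auto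
  have one: "embedded_submanifold M.A 2 (fs_orbit M.A F_structure p)" if "p \<in> region k" "p \<notin>
      region (\<not> k)" for p k
    unfolding orbit_one_region[OF that] by (rule embedded_one_region[OF that(1)])
  consider "I = {0}" | "I = {1}" | "I = {0, 1}" using I unfolding u by blast
  then show "\<exists>d. \<forall>p\<in>(\<Inter>i\<in>I. region (i = 0)) - (\<Union>i\<in>{..<2} - I. region (i = 0)).
      embedded_submanifold M.A d (fs_orbit M.A F_structure p)"
  proof cases
    case 1
    have "{..<2} - I = {1}" unfolding u 1 by auto
    then show ?thesis using one[of _ True] 1 by (intro exI[of _ 2]) simp
  next
    case 2
    have "{..<2} - I = {0}" unfolding u 2 by auto
    then show ?thesis using one[of _ False] 2 by (intro exI[of _ 2]) simp
  next
    case 3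
    have "embedded_submanifold M.A 4 (fs_orbit M.A F_structure p)" if "p \<in> region True" "p \<in>
        region False" for p
      unfolding orbit_two_regions[OF that] by (rule embedded_two_regions[OF that])
    then show ?thesis using 3 by (intro exI[of _ 4]) simp
  qed
qed

end

theorem mainTheorem5:
  fixes eps :: real
  assumes "0 < eps" and "eps \<le> 1/8"
  shows "closed_manifold (resolved_M eps) \<and>
    (\<exists>F :: (m_point, m_point \<times> nat, real ^ 6, 6) f_structure.
       is_f_structure (resolved_M eps) F \<and>
       polarized (resolved_M eps) F \<and>
       (\<exists>!i. i < fs_num F \<and> \<not> trivial_covering F i))"
proof -
  interpret resolution eps
    using assms by unfold_locales
  show ?thesis
    unfolding resolved_M_eq using closed_manifold is_f_structure polarized exactly_one_nontrivial by blast
qed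

end
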